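(* Consider the stochastic contextual matching market and the BARB algorithm described in the context (with $\eta = R\sqrt{d\log\left((1+TB_x^2/\lambda)T^2\right)}+\lambda^{1/2}B_\theta$). Assume that the cumulative distribution function $F$ of the minimum difference $\delta_{\min}$ satisfies: there exist constants $\Delta_0>0$ and $c>0$ such that $F(\Delta)\le c\Delta$ for all $\Delta\le\Delta_0$. Then, when $T$ is sufficiently large, the regret of BARB satisfies $Reg_i(T)=\tilde O(T^{2/3})$ for all $i\in[N]$, where $\tilde O$ hides polylogarithmic factors in $T$ and problem-dependent constants.
   Context: Market: $N$ players $p_1,\dots,p_N$ and $K\ge N$ arms $a_1,\dots,a_K$, horizon $T$. Each arm $a_j$ has a fixed, strict, known preference order $\succ_{a_j}$ over players. Each player $p_i$ has an unknown parameter $\theta_i\in\mathbb{R}^d$ with $\|\theta_i\|_2\le B_\theta$. At each round $t$, every arm $a_j$ has a context $x_j(t)\in\mathbb{R}^d$ with $\|x_j(t)\|_2\le B_x$ a.s., revealed before matching; utility $U_{i,j}(t)=\theta_i^\top x_j(t)$; $B_y:=2B_\theta B_x\le 1$. Stochastic contexts: the tuple $(x_1(t),\dots,x_K(t))$ is drawn independently across rounds from a fixed unknown distribution. In each round a matching $\mu_t$ is chosen; if $p_i$ is matched to $a_j$ one observes $y_i(t)=U_{i,j}(t)+\epsilon_{i,j}(t)$ with i.i.d. mean-zero noise, conditionally $R$-subgaussian given the past; unmatched players get $y_i(t)=0$. A matching $\mu$ is stable at time $t$ if there is no pair $(p_i,a_j)$ with $p_i\succ_{a_j}\mu(a_j)$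 and $U_{i,j}(t)>U_{i,\mu(p_i)}(t)$; $\mathcal{S}_t$ is the set of stable matchings and $U_i^*(t)=\max_{\mu\in\mathcal{S}_t}U_{i,\mu(i)}(t)$. Regret: $Reg_i(T)=\sum_{t=1}^T U_i^*(t)-\mathbb{E}[\sum_{t=1}^T y_i(t)]$. Minimum difference of a context realization: $\delta_{\min}=\min_{i}\min_{j\ne j'}|\theta_i^\top(x_j-x_{j'})|$. BARB algorithm (inputs $T$, arm preferences, $d$, $\eta$, initial candidate gap $\Delta_1>0$, ridge parameter $\lambda>0$): global round counter $t$ starts at $1$. For batches $k=1,2,\dots$: $\xi_k=\Delta_k/\eta$, reset $V_i=\lambda I_d$, $\hat\theta_i=0$, counter $N_k=0$. Each round: observe contexts. If some $(i,j)$ has $\|x_j\|_{V_i^{-1}}>\xi_k$, compute a maximum cardinality matching on the bipartite graph of all such pairs, match covered players accordingly (others unmatched), and update for matched players $V_i=\lambda I+\sum_s x_{i_s}x_{i_s}^\top$, $\hat\theta_i=V_i^{-1}\sum_s x_{i_s}y_{i,i_s}$ over that player's exploration rounds in the current batch. Otherwise set $\hat U_{i,j}=\hat\theta_i^\top x_j$, play the output of player-proposing Gale–Shapley on $\hat U$ and the arms' preferences, and increment $N_k$ if some player's minimal gap between consecutive values among its top $N+1$ sorted estimated utilities is $\le 2\Delta_k$. After each round increment $t$ and stop if $t>T$; if $N_k>\frac{3\log T}{16\Delta_k^2}$, set $\Delta_{k+1}=\Delta_k/\sqrt2$ and start the next batch. *)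

theory Defs
  imports "HOL-Analysis.Analysis" "HOL-Probability.Probability"
begin

(* Players: finite linearly ordered type 'n (N = CARD('n)); arms: finite linearly
   ordered type 'k (K = CARD('k)); contexts live in (real, 'd) vec (d = CARD('d)).
   A context realization of all arms is x :: ((real, 'd) vec, 'k) vec, with x $ j the context of arm j.
   Arm preferences: arank j :: 'n => nat, injective; p \<succ>_{a_j} p' iff arank j p < arank j p'.
   A matching is a partial map from players to arms. *)

type_synonym ('n, 'k) matching = "'n \<Rightarrow> 'k option"

definition is_matching :: "(('n::{finite,linorder}), ('k::{finite,linorder})) matching \<Rightarrow> bool" where
  "is_matching \<mu> \<longleftrightarrow> (\<forall>i i' j. \<mu> i = Some j \<and> \<mu> i' = Some j \<longrightarrow> i = i')"

definition util :: "(('n::{finite,linorder}) \<Rightarrow> (real, ('d::finite)) vec) \<Rightarrow> ((real, 'd) vec, ('k::{finite,linorder})) vec \<Rightarrow> 'n \<Rightarrow> 'k \<Rightarrow> real" where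
  "util \<theta> x i j = \<theta> i \<bullet> (x $ j)"

(* stability w.r.t. utilities U and arm ranks; an unmatched agent prefers any partner *)
definition stable :: "(('k::{finite,linorder}) \<Rightarrow> ('n::{finite,linorder}) \<Rightarrow> nat) \<Rightarrow> ('n \<Rightarrow> 'k \<Rightarrow> real) \<Rightarrow> ('n, 'k) matching \<Rightarrow> bool" where
  "stable arank U \<mu> \<longleftrightarrow> is_matching \<mu> \<and>
     \<not> (\<exists>i j. (\<forall>i'. \<mu> i' = Some j \<longrightarrow> arank j i < arank j i') \<and>
              (case \<mu> i of None \<Rightarrow> True | Some j' \<Rightarrow> U i j > U i j'))"

definition match_val :: "(('n::{finite,linorder}) \<Rightarrow> ('k::{finite,linorder}) \<Rightarrow> real) \<Rightarrow> ('n, 'k) matching \<Rightarrow> 'n \<Rightarrow> real" where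
  "match_val U \<mu> i = (case \<mu> i of None \<Rightarrow> 0 | Some j \<Rightarrow> U i j)"

definition Ustar :: "(('k::{finite,linorder}) \<Rightarrow> ('n::{finite,linorder}) \<Rightarrow> nat) \<Rightarrow> ('n \<Rightarrow> (real, ('d::finite)) vec) \<Rightarrow> ((real, 'd) vec, 'k) vec \<Rightarrow> 'n \<Rightarrow> real" where
  "Ustar arank \<theta> x i = Max {match_val (util \<theta> x) \<mu> i | \<mu>. stable arank (util \<theta> x) \<mu>}"

definition delta_min :: "(('n::{finite,linorder}) \<Rightarrow> (real, ('d::finite)) vec) \<Rightarrow> ((real, 'd) vec, ('k::{finite,linorder})) vec \<Rightarrow> real" where
  "delta_min \<theta> x = Min {\<bar>\<theta> i \<bullet> (x $ j - x $ j')\<bar> | i j j'. j \<noteq> j'}"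

definition max_card_matching :: "(('n::{finite,linorder}) \<times> ('k::{finite,linorder})) set \<Rightarrow> ('n, 'k) matching \<Rightarrow> bool" where
  "max_card_matching E \<mu> \<longleftrightarrow> is_matching \<mu> \<and> (\<forall>i j. \<mu> i = Some j \<longrightarrow> (i, j) \<in> E) \<and>
     (\<forall>\<mu>'. is_matching \<mu>' \<and> (\<forall>i j. \<mu>' i = Some j \<longrightarrow> (i, j) \<in> E) \<longrightarrow>
        card {i. \<mu>' i \<noteq> None} \<le> card {i. \<mu> i \<noteq> None})"

definition pbetter :: "(('n::{finite,linorder}) \<Rightarrow> ('k::{finite,linorder}) \<Rightarrow> real) \<Rightarrow> 'n \<Rightarrow> 'k \<Rightarrow> 'k \<Rightarrow> bool" where
  "pbetter Uh i j j' \<longleftrightarrow> Uh i j > Uh i j' \<or> (Uh i j = Uh i j' \<and> j < j')"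

definition best_arm :: "(('n::{finite,linorder}) \<Rightarrow> ('k::{finite,linorder}) \<Rightarrow> real) \<Rightarrow> 'n \<Rightarrow> 'k set \<Rightarrow> 'k" where
  "best_arm Uh i S = (THE j. j \<in> S \<and> (\<forall>j'\<in>S. j' \<noteq> j \<longrightarrow> pbetter Uh i j j'))"

(* state: rej i = arms that have rejected player i; hold j = player tentatively held by arm j.
   One step: the smallest free player that has not been rejected by every arm proposes to
   its best arm among those that have not rejected it; the arm keeps its preferred proposer. *)
definition gs_step :: "(('k::{finite,linorder}) \<Rightarrow> ('n::{finite,linorder}) \<Rightarrow> nat) \<Rightarrow> ('n \<Rightarrow> 'k \<Rightarrow> real) \<Rightarrow>
    ('n \<Rightarrow> 'k set) \<times> ('k \<Rightarrow> 'n option) \<Rightarrow> ('n \<Rightarrow> 'k set) \<times> ('k \<Rightarrow> 'n option)" where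
  "gs_step arank Uh st = (case st of (rej, hold) \<Rightarrow>
     (let F = {i. (\<forall>j. hold j \<noteq> Some i) \<and> rej i \<noteq> UNIV} in
      if F = {} then (rej, hold) else
      (let i = Min F; j = best_arm Uh i (- rej i) in
       (case hold j of
          None \<Rightarrow> (rej, hold(j := Some i))
        | Some i' \<Rightarrow> if arank j i < arank j i'
                     then (rej(i' := insert j (rej i')), hold(j := Some i))
                     else (rej(i := insert j (rej i)), hold)))))"

(* (N+1)*K steps suffice to reach the terminal state; later steps are no-ops *)
definition gale_shapley :: "(('k::{finite,linorder}) \<Rightarrow> ('n::{finite,linorder}) \<Rightarrow> nat) \<Rightarrow> ('n \<Rightarrow> 'k \<Rightarrow> real) \<Rightarrow> ('n, 'k) matching" where
  "gale_shapley arank Uh =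
     (let hold = snd ((gs_step arank Uh ^^ ((CARD('n) + 1) * CARD('k))) (\<lambda>_. {}, \<lambda>_. None)) in
      (\<lambda>i. if \<exists>j. hold j = Some i then Some (THE j. hold j = Some i) else None))"

definition barb_eta :: "nat \<Rightarrow> nat \<Rightarrow> real \<Rightarrow> real \<Rightarrow> real \<Rightarrow> real \<Rightarrow> real" where
  "barb_eta d T R lam Bth Bx =
     R * sqrt (real d * ln ((1 + real T * Bx\<^sup>2 / lam) * (real T)\<^sup>2)) + sqrt lam * Bth"

definition gram :: "real \<Rightarrow> (((real, ('d::finite)) vec) \<times> real) list \<Rightarrow> ((real, 'd) vec, 'd) vec" where
  "gram lam D = mat lam + sum_list (map (\<lambda>(x, y). (\<chi> a b. x $ a * x $ b)) D)"

definition ridge_est :: "real \<Rightarrow> (((real, ('d::finite)) vec) \<times> real) list \<Rightarrow> (real, 'd) vec" where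
  "ridge_est lam D = matrix_inv (gram lam D) *v sum_list (map (\<lambda>(x, y). y *\<^sub>R x) D)"

definition wnorm :: "((real, ('d::finite)) vec, 'd) vec \<Rightarrow> (real, 'd) vec \<Rightarrow> real" where
  "wnorm A x = sqrt (x \<bullet> (A *v x))"

definition small_gap :: "nat \<Rightarrow> (('n::{finite,linorder}) \<Rightarrow> ('k::{finite,linorder}) \<Rightarrow> real) \<Rightarrow> 'n \<Rightarrow> real \<Rightarrow> bool" where
  "small_gap N Uh i Del =
     (let L = take (N + 1) (rev (sort (map (Uh i) (sorted_list_of_set (UNIV :: 'k set))))) in
      \<exists>m. m + 1 < length L \<and> L ! m - L ! (m + 1) \<le> 2 * Del)"

(* state: (Delta_k, N_k, exploration data of each player in the current batch) *)
type_synonym ('n, 'd) barb_state = "real \<times> nat \<times> ('n \<Rightarrow> (((real, 'd) vec) \<times> real) list)"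

(* one round of BARB: input the contexts x and the noise array e of this round (e (i,j) is the
   noise seen if player i is matched to arm j); output the matching played, the observations y,
   and the new state.  T is the horizon, passed to the algorithm. *)
definition barb_round ::
  "nat \<Rightarrow> real \<Rightarrow> real \<Rightarrow> real \<Rightarrow> real \<Rightarrow> (('k::{finite,linorder}) \<Rightarrow> ('n::{finite,linorder}) \<Rightarrow> nat) \<Rightarrow>
   (('n \<times> 'k) set \<Rightarrow> ('n, 'k) matching) \<Rightarrow> ('n \<Rightarrow> (real, ('d::finite)) vec) \<Rightarrow>
   (((real, 'd) vec, 'k) vec) \<times> ('n \<times> 'k \<Rightarrow> real) \<Rightarrow> ('n, 'd) barb_state \<Rightarrow>
   ('n, 'k) matching \<times> ('n \<Rightarrow> real) \<times> ('n, 'd) barb_state" where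
  "barb_round T R lam Bth Bx arank mcm \<theta> xe st =
    (case xe of (x, e) \<Rightarrow> case st of (Del, Nk, D) \<Rightarrow>
     (let eta = barb_eta CARD('d) T R lam Bth Bx;
          xi = Del / eta;
          E = {(i, j). wnorm (matrix_inv (gram lam (D i))) (x $ j) > xi};
          yof = (\<lambda>\<mu> i. case \<mu> i of None \<Rightarrow> 0 | Some j \<Rightarrow> util \<theta> x i j + e (i, j))
      in if E \<noteq> {} then
           (let \<mu> = mcm E; y = yof \<mu>;
                D' = (\<lambda>i. case \<mu> i of None \<Rightarrow> D i | Some j \<Rightarrow> D i @ [(x $ j, y i)])
            in (\<mu>, y, (Del, Nk, D')))
         else
           (let Uh = (\<lambda>i j. ridge_est lam (D i) \<bullet> (x $ j));
                \<mu> = gale_shapley arank Uh; y = yof \<mu>;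
                Nk' = (if \<exists>i. small_gap CARD('n) Uh i Del then Nk + 1 else Nk)
            in if real Nk' > 3 * ln (real T) / (16 * Del\<^sup>2)
               then (\<mu>, y, (Del / sqrt 2, 0, (\<lambda>_. [])))
               else (\<mu>, y, (Del, Nk', D)))))"

(* state before round t+1 (after t rounds), given the per-round randomness omega 1, omega 2, ... *)
primrec barb_hist ::
  "nat \<Rightarrow> real \<Rightarrow> real \<Rightarrow> real \<Rightarrow> real \<Rightarrow> real \<Rightarrow> (('k::{finite,linorder}) \<Rightarrow> ('n::{finite,linorder}) \<Rightarrow> nat) \<Rightarrow>
   (('n \<times> 'k) set \<Rightarrow> ('n, 'k) matching) \<Rightarrow> ('n \<Rightarrow> (real, ('d::finite)) vec) \<Rightarrow>
   (nat \<Rightarrow> (((real, 'd) vec, 'k) vec) \<times> ('n \<times> 'k \<Rightarrow> real)) \<Rightarrow> nat \<Rightarrow> ('n, 'd) barb_state" where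
  "barb_hist T R lam Bth Bx Del1 arank mcm \<theta> \<omega> 0 = (Del1, 0, (\<lambda>_. []))"
| "barb_hist T R lam Bth Bx Del1 arank mcm \<theta> \<omega> (Suc t) =
     snd (snd (barb_round T R lam Bth Bx arank mcm \<theta> (\<omega> (Suc t))
                 (barb_hist T R lam Bth Bx Del1 arank mcm \<theta> \<omega> t)))"

(* observation y_i(t) in round t >= 1 *)
definition barb_obs ::
  "nat \<Rightarrow> real \<Rightarrow> real \<Rightarrow> real \<Rightarrow> real \<Rightarrow> real \<Rightarrow> (('k::{finite,linorder}) \<Rightarrow> ('n::{finite,linorder}) \<Rightarrow> nat) \<Rightarrow>
   (('n \<times> 'k) set \<Rightarrow> ('n, 'k) matching) \<Rightarrow> ('n \<Rightarrow> (real, ('d::finite)) vec) \<Rightarrow>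
   (nat \<Rightarrow> (((real, 'd) vec, 'k) vec) \<times> ('n \<times> 'k \<Rightarrow> real)) \<Rightarrow> nat \<Rightarrow> 'n \<Rightarrow> real" where
  "barb_obs T R lam Bth Bx Del1 arank mcm \<theta> \<omega> t i =
     fst (snd (barb_round T R lam Bth Bx arank mcm \<theta> (\<omega> t)
                 (barb_hist T R lam Bth Bx Del1 arank mcm \<theta> \<omega> (t - 1)))) i"

definition round_measure :: "(((real, ('d::finite)) vec, ('k::{finite,linorder})) vec) measure \<Rightarrow> real measure \<Rightarrow> ((((real, 'd) vec, 'k) vec) \<times> (('n::{finite,linorder}) \<times> 'k \<Rightarrow> real)) measure" where
  "round_measure Dx \<nu> = Dx \<Otimes>\<^sub>M PiM UNIV (\<lambda>_. \<nu>)"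

definition barb_regret ::
  "nat \<Rightarrow> real \<Rightarrow> real \<Rightarrow> real \<Rightarrow> real \<Rightarrow> real \<Rightarrow> (('k::{finite,linorder}) \<Rightarrow> ('n::{finite,linorder}) \<Rightarrow> nat) \<Rightarrow>
   (('n \<times> 'k) set \<Rightarrow> ('n, 'k) matching) \<Rightarrow> ('n \<Rightarrow> (real, ('d::finite)) vec) \<Rightarrow>
   (((real, 'd) vec, 'k) vec) measure \<Rightarrow> real measure \<Rightarrow> 'n \<Rightarrow> real" where
  "barb_regret T R lam Bth Bx Del1 arank mcm \<theta> Dx \<nu> i =
     (let M = PiM {1..T} (\<lambda>_. round_measure Dx \<nu>) in
      (\<integral>\<omega>. (\<Sum>t\<in>{1..T}. Ustar arank \<theta> (fst (\<omega> t)) i) \<partial>M)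
      - (\<integral>\<omega>. (\<Sum>t\<in>{1..T}. barb_obs T R lam Bth Bx Del1 arank mcm \<theta> \<omega> t i) \<partial>M))"

end

theory Submission
  imports Defs "HOL-Real_Asymp.Real_Asymp"
begin

text \<open>
  A round costs regret only if the players explore, if the estimates of the current batch are
  inaccurate, or if the round is flagged because some player has a small estimated gap: with accurate
  estimates and without small gaps every player ranks its \<open>N\<close> best arms correctly, and player-proposing
  Gale--Shapley never goes beyond the first \<open>N\<close> arms of a list. In a batch with candidate gap \<open>\<Delta>\<close> the
  elliptical potential bounds the number of exploration rounds by a polylogarithmic multiple of
  \<open>1 / \<Delta>\<^sup>2\<close>, and the stopping rule of the batch does the same for the flagged rounds. As \<open>1 / \<Delta>\<^sup>2\<close>
  doubles from batch to batch, the last gap governs the total. A batch with gap \<open>\<Delta> \<le> D\<close>, where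
  \<open>D = T powr (- 1 / 3)\<close>, ends only after about \<open>1 / \<Delta>\<^sup>2\<close> flagged rounds; with accurate estimates
  these satisfy \<open>delta_min \<le> 4 * D\<close>, so only \<open>O(T * D) = O(T powr (2 / 3))\<close> of them are expected.

  The regret is linear in the failure events, so the confidence bound is needed only for each fixed
  round, without a maximal inequality. The exponential supermartingale of the noise is set back to
  \<open>1\<close> when a batch starts, hence its expectation is at most one plus the expected number of batches,
  which is logarithmic. Integrating it against a Gaussian in the dual variable gives the
  self-normalised bound.
\<close>

section \<open>Player-proposing deferred acceptance\<close>

lemma pbetter_trans: "pbetter U i a b \<Longrightarrow> pbetter U i b c \<Longrightarrow> pbetter U i a c"
  unfolding pbetter_def by auto

lemma pbetter_asym: "pbetter U i a b \<Longrightarrow> \<not> pbetter U i b a"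
  unfolding pbetter_def by auto

lemma pbetter_total: "a \<noteq> b \<Longrightarrow> pbetter U i a b \<or> pbetter U i b a"
  unfolding pbetter_def by (metis linorder_neqE)

definition favourite ::
    "('n::{finite,linorder} \<Rightarrow> 'k::{finite,linorder} \<Rightarrow> real) \<Rightarrow> 'n \<Rightarrow> 'k set \<Rightarrow> 'k \<Rightarrow> bool" where
  "favourite U i S j \<longleftrightarrow> j \<notin> S \<and> (\<forall>j'. j' \<notin> S \<longrightarrow> j' \<noteq> j \<longrightarrow> pbetter U i j j')"

lemma favourite_unique: "favourite U i S j \<Longrightarrow> favourite U i S j' \<Longrightarrow> j = j'"
  unfolding favourite_def using pbetter_asym by metis

lemma ex_favourite:
  assumes "S \<noteq> UNIV"
  shows "\<exists>j. favourite U i S j"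
proof -
  have "asymp_on (- S) (pbetter U i)" "transp_on (- S) (pbetter U i)"
    using pbetter_asym pbetter_trans by (auto intro!: asymp_onI transp_onI) blast+
  then obtain j where "j \<in> - S" "\<forall>j'\<in>- S. j' \<noteq> j \<longrightarrow> \<not> pbetter U i j' j"
    using Finite_Set.bex_min_element[of "- S" "pbetter U i"] assms by auto
  then show ?thesis
    unfolding favourite_def using pbetter_total by blast
qed

lemma favourite_best_arm:
  assumes "S \<noteq> UNIV"
  shows "favourite U i S (best_arm U i (- S))"
proof -
  obtain j where j: "favourite U i S j"
    using ex_favourite[OF assms] by blast
  have "best_arm U i (- S) = (THE j. favourite U i S j)"
    unfolding best_arm_def favourite_def by (rule arg_cong[where f=The]) auto
  also have "\<dots> = j"
    using j favourite_unique by (intro the_equality) auto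
  finally have "best_arm U i (- S) = j" .
  then show ?thesis using j by simp
qed

definition gs_free ::
    "('n::{finite,linorder} \<Rightarrow> 'k::{finite,linorder} set) \<times> ('k \<Rightarrow> 'n option) \<Rightarrow> 'n set" where
  "gs_free st = {i. (\<forall>j. snd st j \<noteq> Some i) \<and> fst st i \<noteq> UNIV}"

lemma gs_step_idle: "gs_free st = {} \<Longrightarrow> gs_step arank U st = st"
  unfolding gs_step_def gs_free_def by (cases st) simp

definition gs_propose ::
    "('k::{finite,linorder} \<Rightarrow> 'n::{finite,linorder} \<Rightarrow> nat) \<Rightarrow> 'n \<Rightarrow> 'k \<Rightarrow>
     ('n \<Rightarrow> 'k set) \<times> ('k \<Rightarrow> 'n option) \<Rightarrow> ('n \<Rightarrow> 'k set) \<times> ('k \<Rightarrow> 'n option)" where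
  "gs_propose arank i j st = (case st of (rej, hold) \<Rightarrow> case hold j of
      None \<Rightarrow> (rej, hold(j := Some i))
    | Some i' \<Rightarrow> if arank j i < arank j i'
                 then (rej(i' := insert j (rej i')), hold(j := Some i))
                 else (rej(i := insert j (rej i)), hold))"

lemma gs_step_proposal:
  fixes rej :: "'n::{finite,linorder} \<Rightarrow> 'k::{finite,linorder} set"
  assumes active: "gs_free (rej, hold) \<noteq> {}"
  obtains i j where "\<And>j. hold j \<noteq> Some i" "favourite U i (rej i) j"
    "gs_step arank U (rej, hold) = gs_propose arank i j (rej, hold)"
proof -
  define i where "i = Min (gs_free (rej, hold))"
  define j where "j = best_arm U i (- rej i)"
  have free_eq: "{i. (\<forall>j. hold j \<noteq> Some i) \<and> rej i \<noteq> UNIV} = gs_free (rej, hold)"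
    unfolding gs_free_def by simp
  have "i \<in> gs_free (rej, hold)"
    unfolding i_def using active by (intro Min_in) auto
  then have free: "\<And>j. hold j \<noteq> Some i" and "rej i \<noteq> UNIV"
    unfolding gs_free_def by auto
  then have "favourite U i (rej i) j"
    unfolding j_def by (intro favourite_best_arm)
  moreover have "gs_step arank U (rej, hold) = gs_propose arank i j (rej, hold)"
    using active unfolding gs_step_def gs_propose_def prod.case free_eq Let_def j_def i_def by simp
  ultimately show thesis by (rule that[OF free])
qed

definition ranks_top ::
    "('n::{finite,linorder} \<Rightarrow> 'k::{finite,linorder} \<Rightarrow> real) \<Rightarrow> ('n \<Rightarrow> 'k \<Rightarrow> real) \<Rightarrow> bool" where
  "ranks_top Uh U \<longleftrightarrow> (\<forall>i S j j'. card S < CARD('n) \<longrightarrow> favourite Uh i S j \<longrightarrow>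
     j' \<notin> S \<longrightarrow> j' \<noteq> j \<longrightarrow> U i j' < U i j)"

lemma ranks_topD:
  fixes U :: "'n::{finite,linorder} \<Rightarrow> 'k::{finite,linorder} \<Rightarrow> real"
  assumes "ranks_top Uh U" "card S < CARD('n)" "favourite Uh i S j" "j' \<notin> S" "j' \<noteq> j"
  shows "U i j' < U i j"
  using assms unfolding ranks_top_def by blast

locale strict_priorities =
  fixes arank :: "'k::{finite,linorder} \<Rightarrow> 'n::{finite,linorder} \<Rightarrow> nat"
  assumes rank_strict: "inj (arank j)"
begin

text \<open>Whoever loses a contested arm, proposer or holder, is treated alike: both rank the arm first among
  those that have not rejected them.\<close>

lemma gs_step_cases:
  assumes holds: "\<And>i j. hold j = Some i \<Longrightarrow> favourite U i (rej i) j"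
  obtains (Finished) "gs_free (rej, hold) = {}" "gs_step arank U (rej, hold) = (rej, hold)"
  | (Vacant) i j where "gs_free (rej, hold) \<noteq> {}" "favourite U i (rej i) j" "\<And>j'. hold j' \<noteq> Some i"
      "hold j = None" "gs_step arank U (rej, hold) = (rej, hold(j := Some i))"
  | (Contested) winner loser j where "gs_free (rej, hold) \<noteq> {}" "winner \<noteq> loser"
      "arank j winner < arank j loser" "favourite U winner (rej winner) j"
      "favourite U loser (rej loser) j" "hold j = Some winner \<or> hold j = Some loser"
      "\<And>j'. hold j' = Some winner \<Longrightarrow> j' = j" "\<And>j'. hold j' = Some loser \<Longrightarrow> j' = j"
      "gs_step arank U (rej, hold) = (rej(loser := insert j (rej loser)), hold(j := Some winner))"
proof (cases "gs_free (rej, hold) = {}")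
  case True
  then show thesis using Finished gs_step_idle by blast
next
  case active: False
  obtain i j where free: "\<And>j. hold j \<noteq> Some i" and j: "favourite U i (rej i) j"
    and step: "gs_step arank U (rej, hold) = gs_propose arank i j (rej, hold)"
    using gs_step_proposal[OF active, where U = U and arank = arank] by blast
  show thesis
  proof (cases "hold j")
    case None
    then show thesis using Vacant[OF active j free] step unfolding gs_propose_def by simp
  next
    case (Some i')
    have ne: "i' \<noteq> i" using Some free by auto
    have j': "favourite U i' (rej i') j" using holds Some by blast
    have held: "a = j" if "hold a = Some i'" for a
      using favourite_unique[OF holds[OF that] j'] .
    show thesis
    proof (cases "arank j i < arank j i'")
      case True
      then have "gs_step arank U (rej, hold) = (rej(i' := insert j (rej i')), hold(j := Some i))"
        using step Some unfolding gs_propose_def by simp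
      then show thesis
        using Contested[OF active ne[symmetric] True j j' _ _ held] free Some by blast
    next
      case False
      then have "arank j i' < arank j i"
        using ne rank_strict[of j] by (meson inj_eq linorder_neqE_nat)
      moreover have "gs_step arank U (rej, hold) = (rej(i := insert j (rej i)), hold(j := Some i'))"
        using step Some False unfolding gs_propose_def by (simp add: fun_upd_idem)
      ultimately show thesis
        using Contested[OF active ne _ j' j _ held] free Some by blast
    qed
  qed
qed

definition gs_inv ::
    "('n \<Rightarrow> 'k \<Rightarrow> real) \<Rightarrow> ('n \<Rightarrow> 'k set) \<Rightarrow> ('k \<Rightarrow> 'n option) \<Rightarrow> bool" where
  "gs_inv U rej hold \<longleftrightarrow>
     (\<forall>i j. hold j = Some i \<longrightarrow> favourite U i (rej i) j) \<and>
     (\<forall>i j. j \<in> rej i \<longrightarrow> (\<exists>i'. hold j = Some i' \<and> arank j i' < arank j i))"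

lemma gs_inv_favourite: "gs_inv U rej hold \<Longrightarrow> hold j = Some i \<Longrightarrow> favourite U i (rej i) j"
  unfolding gs_inv_def by blast

lemma gs_inv_rejected:
  assumes "gs_inv U rej hold" "j \<in> rej i"
  obtains i' where "hold j = Some i'" "arank j i' < arank j i"
  using assms unfolding gs_inv_def by blast

lemma gs_inv_holds_unique:
  "gs_inv U rej hold \<Longrightarrow> hold j = Some i \<Longrightarrow> hold j' = Some i \<Longrightarrow> j = j'"
  using gs_inv_favourite favourite_unique by metis

lemma gs_inv_card_rejections:
  assumes inv: "gs_inv U rej hold"
  shows "card (rej i) < CARD('n)"
proof -
  have holder: "\<exists>i'. hold j = Some i' \<and> i' \<noteq> i" if "j \<in> rej i" for j
    by (rule gs_inv_rejected[OF inv that]) auto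
  have "inj_on (the \<circ> hold) (rej i)"
    using holder gs_inv_holds_unique[OF inv] by (intro inj_onI) (metis comp_apply option.sel)
  moreover have "(the \<circ> hold) ` rej i \<subset> UNIV"
    using holder by force
  ultimately show ?thesis
    by (metis card_image finite psubset_card_mono)
qed

lemma gs_inv_step:
  assumes inv: "gs_inv U rej hold"
    and step: "gs_step arank U (rej, hold) = (rej', hold')"
  shows "gs_inv U rej' hold'"
proof (rule gs_step_cases[OF gs_inv_favourite[OF inv]])
  assume "gs_step arank U (rej, hold) = (rej, hold)"
  then show ?thesis using inv step by simp
next
  fix i j assume "favourite U i (rej i) j" "hold j = None"
    "gs_step arank U (rej, hold) = (rej, hold(j := Some i))"
  then show ?thesis
    using inv step by (auto simp: gs_inv_def split: if_splits) fastforce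
next
  fix winner loser j
  assume contest: "winner \<noteq> loser" "arank j winner < arank j loser" "favourite U winner (rej winner) j"
    "hold j = Some winner \<or> hold j = Some loser" "\<And>j'. hold j' = Some loser \<Longrightarrow> j' = j"
    "gs_step arank U (rej, hold) = (rej(loser := insert j (rej loser)), hold(j := Some winner))"
  have eq: "rej' = rej(loser := insert j (rej loser))" "hold' = hold(j := Some winner)"
    using contest(6) step by auto
  show ?thesis
    unfolding gs_inv_def
  proof (intro conjI allI impI)
    fix i b assume "hold' b = Some i"
    then show "favourite U i (rej' i) b"
      using contest(1,3,5) gs_inv_favourite[OF inv] unfolding eq by (auto split: if_splits)
  next
    fix i b assume "b \<in> rej' i"
    then consider (new) "i = loser" "b = j" | (earlier) "b \<in> rej i"
      unfolding eq by (auto split: if_splits)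
    then show "\<exists>i'. hold' b = Some i' \<and> arank b i' < arank b i"
    proof cases
      case new
      then show ?thesis using contest(2) unfolding eq by simp
    next
      case earlier
      then obtain i' where "hold b = Some i'" "arank b i' < arank b i"
        using gs_inv_rejected[OF inv] by blast
      then show ?thesis using contest(2,4) unfolding eq by force
    qed
  qed
qed

lemma gs_step_progress:
  assumes inv: "gs_inv U rej hold"
    and active: "gs_free (rej, hold) \<noteq> {}" and step: "gs_step arank U (rej, hold) = (rej', hold')"
  shows "card (Sigma UNIV rej') + card (dom hold') = Suc (card (Sigma UNIV rej) + card (dom hold))"
proof (rule gs_step_cases[OF gs_inv_favourite[OF inv]])
  assume "gs_free (rej, hold) = {}"
  then show ?thesis using active by simp
next
  fix i j assume "hold j = None" "gs_step arank U (rej, hold) = (rej, hold(j := Some i))"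
  then show ?thesis using step by (auto simp: domIff)
next
  fix winner loser j
  assume contest: "favourite U loser (rej loser) j" "hold j = Some winner \<or> hold j = Some loser"
    "gs_step arank U (rej, hold) = (rej(loser := insert j (rej loser)), hold(j := Some winner))"
  have "Sigma UNIV (rej(loser := insert j (rej loser))) = insert (loser, j) (Sigma UNIV rej)"
    by (auto split: if_splits)
  moreover have "(loser, j) \<notin> Sigma UNIV rej" using contest(1) unfolding favourite_def by simp
  moreover have "dom (hold(j := Some winner)) = dom hold" using contest(2) by auto
  ultimately show ?thesis using contest(3) step by auto
qed

definition gs_run ::
    "('n \<Rightarrow> 'k \<Rightarrow> real) \<Rightarrow> nat \<Rightarrow> ('n \<Rightarrow> 'k set) \<times> ('k \<Rightarrow> 'n option)" where
  "gs_run U m = (gs_step arank U ^^ m) (\<lambda>_. {}, \<lambda>_. None)"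

lemma gs_run_0: "gs_run U 0 = (\<lambda>_. {}, \<lambda>_. None)"
  unfolding gs_run_def by simp

lemma gs_run_Suc: "gs_run U (Suc m) = gs_step arank U (gs_run U m)"
  unfolding gs_run_def by simp

lemma gs_inv_run: "gs_inv U (fst (gs_run U m)) (snd (gs_run U m))"
proof (induction m)
  case 0
  show ?case by (simp add: gs_run_0 gs_inv_def)
next
  case (Suc m)
  show ?case
    unfolding gs_run_Suc by (rule gs_inv_step[OF Suc]) simp
qed

lemma gs_run_terminates:
  assumes m: "(CARD('n) + 1) * CARD('k) \<le> m"
  shows "gs_free (gs_run U m) = {}"
proof (rule ccontr)
  define potential where
    "potential m = card (Sigma UNIV (fst (gs_run U m))) + card (dom (snd (gs_run U m)))" for m
  assume "gs_free (gs_run U m) \<noteq> {}"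
  then have "m \<le> potential m"
  proof (induction m)
    case (Suc m)
    have active: "gs_free (gs_run U m) \<noteq> {}"
      using Suc.prems gs_step_idle unfolding gs_run_Suc by metis
    then have "potential (Suc m) = Suc (potential m)"
      unfolding potential_def gs_run_Suc by (intro gs_step_progress[OF gs_inv_run]) simp_all
    then show ?case using Suc.IH[OF active] by simp
  qed simp
  obtain i where "fst (gs_run U m) i \<noteq> UNIV"
    using \<open>gs_free (gs_run U m) \<noteq> {}\<close> unfolding gs_free_def by auto
  then have "Sigma UNIV (fst (gs_run U m)) \<subset> UNIV" by auto
  then have "card (Sigma UNIV (fst (gs_run U m))) < CARD('n \<times> 'k)"
    by (intro psubset_card_mono) auto
  moreover have "card (dom (snd (gs_run U m))) \<le> CARD('k)"
    by (intro card_mono) auto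
  ultimately have "potential m < (CARD('n) + 1) * CARD('k)"
    unfolding potential_def by simp
  then show False using \<open>m \<le> potential m\<close> m by linarith
qed

lemma gale_shapley_eq_iff:
  "gale_shapley arank U i = Some j \<longleftrightarrow>
    snd (gs_run U ((CARD('n) + 1) * CARD('k))) j = Some i"
proof -
  let ?hold = "snd (gs_run U ((CARD('n) + 1) * CARD('k)))"
  have gs: "gale_shapley arank U i =
      (if \<exists>j. ?hold j = Some i then Some (THE j. ?hold j = Some i) else None)"
    unfolding gale_shapley_def gs_run_def by (simp add: Let_def)
  have "(THE j. ?hold j = Some i) = j" if "?hold j = Some i" for j
    using that gs_inv_holds_unique[OF gs_inv_run] by blast
  then show ?thesis unfolding gs by auto
qed

definition blocking_pair ::
    "('n \<Rightarrow> 'k \<Rightarrow> real) \<Rightarrow> ('n, 'k) matching \<Rightarrow> 'n \<Rightarrow> 'k \<Rightarrow> bool" where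
  "blocking_pair U \<mu> i j \<longleftrightarrow> (\<forall>i'. \<mu> i' = Some j \<longrightarrow> arank j i < arank j i') \<and>
     (\<forall>j'. \<mu> i = Some j' \<longrightarrow> U i j' < U i j)"

lemma stable_iff: "stable arank U \<mu> \<longleftrightarrow> is_matching \<mu> \<and> (\<forall>i j. \<not> blocking_pair U \<mu> i j)"
proof -
  have "(case \<mu> i of None \<Rightarrow> True | Some j' \<Rightarrow> U i j' < U i j) \<longleftrightarrow>
      (\<forall>j'. \<mu> i = Some j' \<longrightarrow> U i j' < U i j)" for i j
    by (simp split: option.split)
  then show ?thesis unfolding stable_def blocking_pair_def by simp
qed

end

locale strict_market = strict_priorities arank
  for arank :: "'k::{finite,linorder} \<Rightarrow> 'n::{finite,linorder} \<Rightarrow> nat" +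
  assumes players_le_arms: "CARD('n) \<le> CARD('k)"
begin

lemma gs_run_all_held:
  assumes m: "(CARD('n) + 1) * CARD('k) \<le> m"
  shows "\<exists>j. snd (gs_run U m) j = Some i"
proof -
  have "card (fst (gs_run U m) i) < CARD('k)"
    using gs_inv_card_rejections[OF gs_inv_run] players_le_arms by (rule less_le_trans)
  then have "fst (gs_run U m) i \<noteq> UNIV" by auto
  then show ?thesis using gs_run_terminates[OF m] unfolding gs_free_def by auto
qed

lemma gale_shapley_stable: "stable arank U (gale_shapley arank U)"
proof -
  define m where "m = (CARD('n) + 1) * CARD('k)"
  define rej hold where "rej = fst (gs_run U m)" and "hold = snd (gs_run U m)"
  have inv: "gs_inv U rej hold"
    unfolding rej_def hold_def by (rule gs_inv_run)
  have gs: "gale_shapley arank U i = Some j \<longleftrightarrow> hold j = Some i" for i j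
    unfolding hold_def m_def by (rule gale_shapley_eq_iff)
  have "\<not> blocking_pair U (gale_shapley arank U) i j" for i j
  proof
    assume block: "blocking_pair U (gale_shapley arank U) i j"
    obtain j' where j': "hold j' = Some i"
      using gs_run_all_held[where U=U] unfolding hold_def m_def by blast
    then have less: "U i j' < U i j"
      using block unfolding blocking_pair_def gs by blast
    then have "\<not> pbetter U i j' j" unfolding pbetter_def by auto
    then have "j \<in> rej i"
      using gs_inv_favourite[OF inv j'] less unfolding favourite_def by auto
    then obtain i' where "hold j = Some i'" "arank j i' < arank j i"
      by (rule gs_inv_rejected[OF inv])
    then show False
      using block unfolding blocking_pair_def gs by (metis order_less_asym)
  qed
  moreover have "is_matching (gale_shapley arank U)"
    unfolding is_matching_def gs by auto
  ultimately show ?thesis unfolding stable_iff by blast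
qed

lemma stable_all_matched:
  assumes stable: "stable arank U \<mu>"
  obtains j where "\<mu> i = Some j"
proof (cases "\<mu> i")
  case None
  have "card (\<mu> ` (- {i})) \<le> card (- {i})" by (intro card_image_le) simp
  also have "\<dots> < CARD('n)" by (intro psubset_card_mono) auto
  also have "\<dots> \<le> CARD('k)" by (rule players_le_arms)
  also have "CARD('k) = card (range (Some :: 'k \<Rightarrow> 'k option))" by (simp add: card_image)
  finally have "\<not> range (Some :: 'k \<Rightarrow> 'k option) \<subseteq> \<mu> ` (- {i})"
    by (meson card_mono finite finite_imageI not_le)
  then obtain j where "Some j \<notin> \<mu> ` (- {i})" by auto
  then have "blocking_pair U \<mu> i j"
    using None unfolding blocking_pair_def image_iff by (metis ComplI option.distinct(1) singletonD)
  then show thesis using stable unfolding stable_iff by blast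
qed

text \<open>Had an arm rejected its stable partner, the player it preferred would block.\<close>

lemma gs_run_keeps_stable_partner:
  assumes top: "ranks_top Uh U" and stable: "stable arank U \<mu>"
  shows "\<mu> i = Some j \<Longrightarrow> j \<notin> fst (gs_run Uh m) i"
proof (induction m arbitrary: i j)
  case 0
  then show ?case by (simp add: gs_run_0)
next
  case (Suc m)
  obtain rej hold where run: "gs_run Uh m = (rej, hold)" by fastforce
  have inv: "gs_inv Uh rej hold"
    using gs_inv_run[of Uh m] unfolding run by simp
  have kept: "\<mu> a = Some b \<Longrightarrow> b \<notin> rej a" for a b
    using Suc.IH run by simp
  show ?case
  proof (rule gs_step_cases[OF gs_inv_favourite[OF inv]])
    fix winner loser b
    assume contest: "winner \<noteq> loser" "arank b winner < arank b loser"
      "favourite Uh winner (rej winner) b"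
      "gs_step arank Uh (rej, hold) = (rej(loser := insert b (rej loser)), hold(b := Some winner))"
    have "\<mu> loser \<noteq> Some b"
    proof
      assume b: "\<mu> loser = Some b"
      obtain b' where b': "\<mu> winner = Some b'"
        by (rule stable_all_matched[OF stable])
      have matching: "is_matching \<mu>" using stable unfolding stable_iff by blast
      have "b' \<noteq> b" using b b' contest(1) matching unfolding is_matching_def by blast
      then have "U winner b' < U winner b"
        using ranks_topD[OF top gs_inv_card_rejections[OF inv] contest(3)] kept[OF b'] by blast
      then have "blocking_pair U \<mu> winner b"
        using b b' contest(2) matching unfolding blocking_pair_def is_matching_def
        by (metis option.inject)
      then show False using stable unfolding stable_iff by blast
    qed
    then show "j \<notin> fst (gs_run Uh (Suc m)) i"
      using kept Suc.prems contest(4) unfolding gs_run_Suc run by auto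
  qed (use kept Suc.prems in \<open>auto simp: gs_run_Suc run\<close>)
qed

lemma gale_shapley_optimal:
  assumes top: "ranks_top Uh U" and stable: "stable arank U \<mu>"
  shows "match_val U \<mu> i \<le> match_val U (gale_shapley arank Uh) i"
proof -
  define m where "m = (CARD('n) + 1) * CARD('k)"
  obtain j where j: "snd (gs_run Uh m) j = Some i"
    using gs_run_all_held[where U=Uh] unfolding m_def by blast
  then have gs: "gale_shapley arank Uh i = Some j"
    unfolding gale_shapley_eq_iff m_def .
  obtain j' where j': "\<mu> i = Some j'"
    by (rule stable_all_matched[OF stable])
  have "U i j' \<le> U i j"
    using ranks_topD[OF top gs_inv_card_rejections[OF gs_inv_run] gs_inv_favourite[OF gs_inv_run j]]
      gs_run_keeps_stable_partner[OF top stable j']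
    by (cases "j' = j") (auto intro: less_imp_le)
  then show ?thesis unfolding match_val_def gs j' by simp
qed

end

lemma gale_shapley_cong:
  assumes "pbetter U = pbetter U'"
  shows "gale_shapley arank U = gale_shapley arank U'"
proof -
  have "best_arm U = best_arm U'"
    unfolding best_arm_def assms ..
  then have "gs_step arank U = gs_step arank U'"
    unfolding gs_step_def by (rule ssubst) (rule refl)
  then show ?thesis unfolding gale_shapley_def by simp
qed

section \<open>Order statistics of the estimated utilities\<close>

lemma sorted_desc_nth_iff:
  fixes xs :: "'a::linorder list"
  assumes "sorted_wrt (\<ge>) xs" and up: "\<And>x y. P x \<Longrightarrow> x \<le> y \<Longrightarrow> P y" and "q < length xs"
  shows "P (xs ! q) \<longleftrightarrow> q < length (filter P xs)"
  using assms(1,3)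
proof (induction xs arbitrary: q)
  case (Cons x xs)
  show ?case
  proof (cases "P x")
    case True
    then show ?thesis using Cons by (cases q) auto
  next
    case False
    then have "\<not> P y" if "y \<in> set (x # xs)" for y
      using Cons.prems(1) up that by auto
    then show ?thesis using Cons.prems(2) by (metis filter_False length_0_conv not_less_zero nth_mem)
  qed
qed simp

definition desc_vals :: "('k::{finite,linorder} \<Rightarrow> real) \<Rightarrow> real list" where
  "desc_vals f = rev (sort (map f (sorted_list_of_set UNIV)))"

lemma length_desc_vals [simp]: "length (desc_vals (f :: 'k::{finite,linorder} \<Rightarrow> real)) = CARD('k)"
  unfolding desc_vals_def by simp

lemma desc_vals_nth_iff:
  fixes f :: "'k::{finite,linorder} \<Rightarrow> real"
  assumes up: "\<And>x y. P x \<Longrightarrow> x \<le> y \<Longrightarrow> P y" and q: "q < CARD('k)"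
  shows "P (desc_vals f ! q) \<longleftrightarrow> q < card {j. P (f j)}"
proof -
  let ?xs = "map f (sorted_list_of_set UNIV)"
  have "sorted_wrt (\<ge>) (desc_vals f)"
    unfolding desc_vals_def sorted_wrt_rev by simp
  then have "P (desc_vals f ! q) \<longleftrightarrow> q < length (filter P (desc_vals f))"
    using up q by (intro sorted_desc_nth_iff) auto
  also have "mset (desc_vals f) = mset ?xs"
    unfolding desc_vals_def by simp
  then have "length (filter P (desc_vals f)) = length (filter P ?xs)"
    by (metis mset_filter size_mset)
  also have "\<dots> = length (filter (P \<circ> f) (sorted_list_of_set UNIV))"
    by (simp add: filter_map)
  also have "\<dots> = card (set (filter (P \<circ> f) (sorted_list_of_set UNIV)))"
    by (intro distinct_card[symmetric]) simp
  also have "set (filter (P \<circ> f) (sorted_list_of_set UNIV)) = {j. P (f j)}"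
    by simp
  finally show ?thesis .
qed

lemma small_gap_iff:
  fixes U :: "'n::{finite,linorder} \<Rightarrow> 'k::{finite,linorder} \<Rightarrow> real"
  shows "small_gap n U i \<Delta> \<longleftrightarrow>
    (\<exists>m. m + 1 < CARD('k) \<and> m < n \<and> desc_vals (U i) ! m - desc_vals (U i) ! (m + 1) \<le> 2 * \<Delta>)"
proof -
  let ?top = "take (n + 1) (desc_vals (U i))"
  have "small_gap n U i \<Delta> \<longleftrightarrow> (\<exists>m. m + 1 < length ?top \<and> ?top ! m - ?top ! (m + 1) \<le> 2 * \<Delta>)"
    unfolding small_gap_def Let_def desc_vals_def ..
  moreover have "m + 1 < length ?top \<longleftrightarrow> m + 1 < CARD('k) \<and> m < n" for m
    by auto
  ultimately show ?thesis
    by (metis add_less_mono1 less_SucI nth_take Suc_eq_plus1)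
qed

lemma not_small_gap_favourite:
  fixes U :: "'n::{finite,linorder} \<Rightarrow> 'k::{finite,linorder} \<Rightarrow> real"
  assumes no_gap: "\<not> small_gap n U i \<Delta>" and S: "card S < n"
    and fav: "favourite U i S j" and j': "j' \<notin> S" "j' \<noteq> j"
  shows "2 * \<Delta> < U i j - U i j'"
proof (rule ccontr)
  assume close: "\<not> 2 * \<Delta> < U i j - U i j'"
  define above where "above = {a. U i j < U i a}"
  define p where "p = card above"
  have "above \<subseteq> S"
    using fav unfolding above_def favourite_def pbetter_def by force
  then have "p < n"
    using S card_mono[of S above] unfolding p_def by simp
  have le: "U i j' \<le> U i j"
    using fav j' unfolding favourite_def pbetter_def by force
  have "card (insert j (insert j' above)) = p + 2"
    using j'(2) le unfolding p_def above_def by (subst card_insert_disjoint; auto simp: card_insert_if)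
  moreover have "insert j (insert j' above) \<subseteq> {a. U i j' \<le> U i a}"
    using le unfolding above_def by auto
  then have "card (insert j (insert j' above)) \<le> card {a. U i j' \<le> U i a}"
    by (intro card_mono) auto
  ultimately have many: "p + 1 < card {a. U i j' \<le> U i a}" by simp
  also have "\<dots> \<le> CARD('k)" by (intro card_mono) auto
  finally have p: "p + 1 < CARD('k)" .
  have "U i j' \<le> desc_vals (U i) ! (p + 1)"
    using desc_vals_nth_iff[of "\<lambda>z. U i j' \<le> z" "p + 1" "U i"] p many by auto
  moreover have "\<not> U i j < desc_vals (U i) ! p"
    using desc_vals_nth_iff[of "\<lambda>z. U i j < z" p "U i"] p unfolding p_def above_def by auto
  ultimately have "desc_vals (U i) ! p - desc_vals (U i) ! (p + 1) \<le> 2 * \<Delta>"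
    using close by linarith
  then show False using no_gap p \<open>p < n\<close> unfolding small_gap_iff by blast
qed

lemma small_gap_close_pair:
  fixes U :: "'n::{finite,linorder} \<Rightarrow> 'k::{finite,linorder} \<Rightarrow> real"
  assumes "small_gap n U i \<Delta>"
  obtains j j' where "j \<noteq> j'" "\<bar>U i j - U i j'\<bar> \<le> 2 * \<Delta>"
proof -
  obtain m where m: "m + 1 < CARD('k)" "desc_vals (U i) ! m - desc_vals (U i) ! (m + 1) \<le> 2 * \<Delta>"
    using assms unfolding small_gap_iff by blast
  define high low where "high = desc_vals (U i) ! m" and "low = desc_vals (U i) ! (m + 1)"
  define between where "between = {j. low \<le> U i j \<and> U i j \<le> high}"
  have "m + 1 < card {j. low \<le> U i j}"
    using desc_vals_nth_iff[of "\<lambda>z. low \<le> z" "m + 1" "U i"] m unfolding low_def by auto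
  also have "\<dots> \<le> card (between \<union> {j. high < U i j})"
    unfolding between_def by (intro card_mono) auto
  also have "\<dots> \<le> card between + card {j. high < U i j}"
    by (rule card_Un_le)
  also have "card {j. high < U i j} \<le> m"
    using desc_vals_nth_iff[of "\<lambda>z. high < z" m "U i"] m unfolding high_def by auto
  finally have "\<not> card between \<le> Suc 0" by simp
  then obtain j j' where "j \<in> between" "j' \<in> between" "j \<noteq> j'"
    using card_le_Suc0_iff_eq[of between] by auto
  then show thesis
    using that[of j j'] m(2) unfolding between_def high_def low_def by auto
qed

lemma delta_min_le_iff:
  fixes \<theta> :: "'n::{finite,linorder} \<Rightarrow> (real, 'd::finite) vec"
    and x :: "((real, 'd) vec, 'k::{finite,linorder}) vec"
  assumes two_arms: "\<exists>j j'::'k. j \<noteq> j'"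
  shows "delta_min \<theta> x \<le> a \<longleftrightarrow> (\<exists>i j j'. j \<noteq> j' \<and> \<bar>util \<theta> x i j - util \<theta> x i j'\<bar> \<le> a)"
proof -
  let ?gaps = "{\<bar>\<theta> i \<bullet> (x $ j - x $ j')\<bar> | i j j'. j \<noteq> j'}"
  have "?gaps = (\<lambda>(i, j, j'). \<bar>\<theta> i \<bullet> (x $ j - x $ j')\<bar>) ` {(i, j, j'). j \<noteq> j'}"
    by (auto simp: image_def)
  then have "finite ?gaps" by simp
  moreover have "?gaps \<noteq> {}" using two_arms by blast
  ultimately show ?thesis
    unfolding delta_min_def util_def by (subst Min_le_iff) (auto simp: inner_diff_right)
qed

lemma small_gap_delta_min:
  assumes gap: "small_gap n U i \<Delta>" and close: "\<And>j. \<bar>U i j - util \<theta> x i j\<bar> \<le> \<Delta>"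
  shows "delta_min \<theta> x \<le> 4 * \<Delta>"
proof -
  obtain j j' where "j \<noteq> j'" and pair: "\<bar>U i j - U i j'\<bar> \<le> 2 * \<Delta>"
    by (rule small_gap_close_pair[OF gap])
  then have "delta_min \<theta> x \<le> \<bar>util \<theta> x i j - util \<theta> x i j'\<bar>"
    using delta_min_le_iff by blast
  also have "\<dots> \<le> 4 * \<Delta>"
    using close[of j] close[of j'] pair by linarith
  finally show ?thesis .
qed

lemma ranks_top_no_small_gap:
  fixes U Uh :: "'n::{finite,linorder} \<Rightarrow> 'k::{finite,linorder} \<Rightarrow> real"
  assumes close: "\<And>i j. \<bar>Uh i j - U i j\<bar> \<le> \<Delta>" and no_gap: "\<And>i. \<not> small_gap CARD('n) Uh i \<Delta>"
  shows "ranks_top Uh U"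
  unfolding ranks_top_def
proof (intro allI impI)
  fix i S j j' assume "card S < CARD('n)" "favourite Uh i S j" "j' \<notin> S" "j' \<noteq> j"
  then have "2 * \<Delta> < Uh i j - Uh i j'"
    using not_small_gap_favourite[OF no_gap] by blast
  then show "U i j' < U i j"
    using close[of i j] close[of i j'] by linarith
qed

context strict_market
begin

lemma ex_stable: "\<exists>\<mu>. stable arank U \<mu>"
  using gale_shapley_stable by blast

lemma Ustar_attained:
  obtains \<mu> where "stable arank (util \<theta> x) \<mu>" "Ustar arank \<theta> x i = match_val (util \<theta> x) \<mu> i"
proof -
  have "Ustar arank \<theta> x i \<in> {match_val (util \<theta> x) \<mu> i | \<mu>. stable arank (util \<theta> x) \<mu>}"
    unfolding Ustar_def by (rule Max_in) (simp_all add: ex_stable)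
  then show thesis using that by blast
qed

lemma Ustar_greater_iff:
  "a < Ustar arank \<theta> x i \<longleftrightarrow>
    (\<exists>\<mu>. stable arank (util \<theta> x) \<mu> \<and> a < match_val (util \<theta> x) \<mu> i)"
  unfolding Ustar_def by (subst Max_gr_iff) (auto simp: ex_stable)

lemma Ustar_le_gale_shapley:
  fixes Uh :: "'n \<Rightarrow> 'k \<Rightarrow> real"
  assumes "\<And>i j. \<bar>Uh i j - util \<theta> x i j\<bar> \<le> \<Delta>" "\<And>i. \<not> small_gap CARD('n) Uh i \<Delta>"
  shows "Ustar arank \<theta> x i \<le> match_val (util \<theta> x) (gale_shapley arank Uh) i"
proof (rule Ustar_attained)
  fix \<mu> assume "stable arank (util \<theta> x) \<mu>" "Ustar arank \<theta> x i = match_val (util \<theta> x) \<mu> i"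
  then show ?thesis
    using gale_shapley_optimal[OF ranks_top_no_small_gap[OF assms]] by simp
qed

end

section \<open>Positive definite matrices\<close>

lemma matrix_inv_right: "invertible A \<Longrightarrow> A ** matrix_inv A = mat 1"
  and matrix_inv_left: "invertible A \<Longrightarrow> matrix_inv A ** A = mat 1"
  unfolding invertible_def matrix_inv_def by (metis (mono_tags, lifting) someI_ex)+

lemma matrix_inv_cancel:
  fixes A :: "real^'n^'n"
  assumes "invertible A"
  shows "A *v (matrix_inv A *v w) = w" "matrix_inv A *v (A *v w) = w"
  using matrix_inv_right[OF assms] matrix_inv_left[OF assms] by (simp_all add: matrix_vector_mul_assoc)

definition pos_def :: "real^'n^'n \<Rightarrow> bool" where
  "pos_def V \<longleftrightarrow> (\<forall>u w. u \<bullet> (V *v w) = w \<bullet> (V *v u)) \<and> (\<forall>w. w \<noteq> 0 \<longrightarrow> 0 < w \<bullet> (V *v w))"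

lemma pos_def_sym: "pos_def V \<Longrightarrow> u \<bullet> (V *v w) = w \<bullet> (V *v u)"
  unfolding pos_def_def by blast

lemma pos_def_pos: "pos_def V \<Longrightarrow> w \<noteq> 0 \<Longrightarrow> 0 < w \<bullet> (V *v w)"
  unfolding pos_def_def by blast

lemma pos_def_nonneg: "pos_def V \<Longrightarrow> 0 \<le> w \<bullet> (V *v w)"
  using pos_def_pos[of V w] by (cases "w = 0") auto

lemma invertible_pos_def:
  assumes "pos_def V"
  shows "invertible V"
proof -
  have "w = 0" if "V *v w = 0" for w
    using pos_def_pos[OF assms, of w] that by auto
  then show ?thesis
    unfolding invertible_left_inverse matrix_left_invertible_ker by blast
qed

lemma pos_def_matrix_inv:
  assumes "pos_def V"
  shows "pos_def (matrix_inv V)"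
proof -
  let ?W = "matrix_inv V"
  note cancel = matrix_inv_cancel[OF invertible_pos_def[OF assms]]
  have form: "u \<bullet> (?W *v w) = (?W *v w) \<bullet> (V *v (?W *v u))" for u w
    unfolding cancel(1) by (rule inner_commute)
  then have "u \<bullet> (?W *v w) = w \<bullet> (?W *v u)" for u w
    using pos_def_sym[OF assms] by metis
  moreover have "0 < w \<bullet> (?W *v w)" if "w \<noteq> 0" for w
  proof -
    have "?W *v w \<noteq> 0"
    proof
      assume "?W *v w = 0"
      then have "V *v (?W *v w) = 0" by simp
      then show False using that unfolding cancel(1) by simp
    qed
    then show ?thesis unfolding form by (rule pos_def_pos[OF assms])
  qed
  ultimately show ?thesis unfolding pos_def_def by blast
qed

lemma wnorm_sq: "pos_def V \<Longrightarrow> (wnorm V w)\<^sup>2 = w \<bullet> (V *v w)"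
  unfolding wnorm_def using pos_def_nonneg by simp

lemma wnorm_nonneg: "pos_def V \<Longrightarrow> 0 \<le> wnorm V w"
  unfolding wnorm_def using pos_def_nonneg by simp

lemma pos_def_Cauchy_Schwarz:
  assumes V: "pos_def V"
  shows "\<bar>z \<bullet> (V *v w)\<bar> \<le> wnorm V z * wnorm V w"
proof (cases "w = 0")
  case True
  then show ?thesis by (simp add: wnorm_def)
next
  case False
  define b c where "b = w \<bullet> (V *v w)" and "c = z \<bullet> (V *v w)"
  have b: "0 < b" unfolding b_def by (rule pos_def_pos[OF V False])
  define v where "v = z - (c / b) *\<^sub>R w"
  have "0 \<le> v \<bullet> (V *v v)" by (rule pos_def_nonneg[OF V])
  also have "\<dots> = z \<bullet> (V *v z) - (c / b) * c - (c / b) * c + (c / b) * (c / b) * b"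
    unfolding v_def using pos_def_sym[OF V, of w z]
    by (simp add: matrix_vector_mult_diff_distrib inner_diff_left inner_diff_right
        matrix_vector_mult_scaleR b_def c_def algebra_simps)
  also have "\<dots> = (wnorm V z)\<^sup>2 - c\<^sup>2 / b"
    using b by (simp add: power2_eq_square wnorm_sq[OF V, unfolded power2_eq_square])
  finally have "c\<^sup>2 \<le> (wnorm V z * wnorm V w)\<^sup>2"
    using b by (simp add: field_simps power_mult_distrib wnorm_sq[OF V, of w] b_def)
  then show ?thesis
    unfolding c_def[symmetric] using wnorm_nonneg[OF V] by (simp add: abs_le_square_iff[symmetric])
qed

lemma wnorm_matrix_inv_le:
  assumes V: "pos_def V" and "lam > 0" and lower: "\<And>w. lam * (norm w)\<^sup>2 \<le> w \<bullet> (V *v w)"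
  shows "sqrt lam * wnorm (matrix_inv V) w \<le> norm w"
proof -
  let ?W = "matrix_inv V"
  define z where "z = ?W *v w"
  have "lam * (norm z)\<^sup>2 \<le> w \<bullet> z"
    using lower[of z] matrix_inv_cancel(1)[OF invertible_pos_def[OF V], of w]
    by (simp add: z_def inner_commute)
  also have "w \<bullet> z \<le> norm w * norm z" by (rule norm_cauchy_schwarz)
  finally have "lam * norm z \<le> norm w"
    by (cases "z = 0") (simp_all add: power2_eq_square mult.assoc[symmetric])
  then have "lam * (norm w * norm z) \<le> norm w * norm w"
    by (metis mult.left_commute mult_left_mono norm_ge_zero)
  moreover have "lam * (w \<bullet> z) \<le> lam * (norm w * norm z)"
    using \<open>lam > 0\<close> norm_cauchy_schwarz by (intro mult_left_mono) auto
  moreover have "(sqrt lam * wnorm ?W w)\<^sup>2 = lam * (w \<bullet> z)"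
    using \<open>lam > 0\<close> by (simp add: power_mult_distrib wnorm_sq[OF pos_def_matrix_inv[OF V]] z_def)
  ultimately have "(sqrt lam * wnorm ?W w)\<^sup>2 \<le> (norm w)\<^sup>2"
    by (simp add: power2_eq_square)
  then show ?thesis by (rule power2_le_imp_le) simp
qed

section \<open>Determinants of rank-one updates\<close>

lemma matrix_add_rdistrib: "(A + B) ** C = A ** C + B ** C"
  by (simp add: matrix_matrix_mult_def vec_eq_iff sum.distrib distrib_right)

definition rank_one :: "real^'m \<Rightarrow> real^'n \<Rightarrow> real^'n^'m" where
  "rank_one y x = (\<chi> a b. y $ a * x $ b)"

lemma rank_one_mult_vec: "rank_one y x *v u = (x \<bullet> u) *\<^sub>R y"
  unfolding rank_one_def matrix_vector_mult_def inner_vec_def vec_eq_iff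
  by (simp add: sum_distrib_right sum_distrib_left mult_ac)

lemma matrix_mult_rank_one: "A ** rank_one y x = rank_one (A *v y) x"
  unfolding rank_one_def matrix_matrix_mult_def matrix_vector_mult_def vec_eq_iff
  by (simp add: sum_distrib_left sum_distrib_right mult_ac)

lemma rank_one_mult_transpose: "rank_one y x ** transpose A = rank_one y (A *v x)"
  unfolding rank_one_def matrix_matrix_mult_def matrix_vector_mult_def transpose_def vec_eq_iff
  by (simp add: sum_distrib_left mult_ac)

lemma det_one_plus_rank_one_axis:
  fixes z :: "real^'n"
  shows "det (mat 1 + rank_one z (c *\<^sub>R axis k 1)) = 1 + c * z $ k"
proof -
  define w where "w = axis k 1 + c *\<^sub>R z"
  have "mat 1 + rank_one z (c *\<^sub>R axis k 1) =
      (\<chi> i j. if j = k then w $ i else (mat 1 :: real^'n^'n) $ i $ j)"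
    by (auto simp: vec_eq_iff rank_one_def w_def mat_def axis_def)
  then have "det (mat 1 + rank_one z (c *\<^sub>R axis k 1)) = w $ k"
    using cramer_lemma[of k "mat 1" w] unfolding matrix_vector_mul_lid det_I by simp
  then show ?thesis by (simp add: w_def)
qed

text \<open>An orthogonal change of basis turns \<open>x\<close> into a multiple of an axis vector.\<close>

lemma det_one_plus_rank_one:
  fixes x y :: "real^'n"
  shows "det (mat 1 + rank_one y x) = 1 + x \<bullet> y"
proof -
  obtain k :: 'n where True by simp
  obtain f where f: "orthogonal_transformation f" "f x = norm x *\<^sub>R axis k (1::real)"
    using orthogonal_transformation_exists[of x "norm x *\<^sub>R axis k (1::real)"]
    by (auto simp: norm_axis_1)
  define Q where "Q = matrix f"
  have f_eq: "f w = Q *v w" for w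
    unfolding Q_def using f(1) by (simp add: matrix_works orthogonal_transformation_linear)
  have Q: "Q ** transpose Q = mat 1"
    using f(1) unfolding orthogonal_transformation_matrix Q_def orthogonal_matrix_def by auto
  have "det Q * det (transpose Q) = 1"
    by (metis Q det_I det_mul)
  then have "det (mat 1 + rank_one y x) = det (Q ** (mat 1 + rank_one y x) ** transpose Q)"
    by (simp add: det_mul mult_ac)
  also have "Q ** (mat 1 + rank_one y x) ** transpose Q = mat 1 + rank_one (Q *v y) (Q *v x)"
    by (simp add: matrix_add_ldistrib matrix_add_rdistrib Q matrix_mult_rank_one
        rank_one_mult_transpose)
  also have "Q *v x = norm x *\<^sub>R axis k 1"
    using f(2) unfolding f_eq .
  also have "det (mat 1 + rank_one (Q *v y) (norm x *\<^sub>R axis k 1)) = 1 + norm x * (Q *v y) $ k"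
    by (rule det_one_plus_rank_one_axis)
  also have "norm x * (Q *v y) $ k = f x \<bullet> f y"
    unfolding f(2) f_eq[of y] by (simp add: inner_axis')
  also have "\<dots> = x \<bullet> y"
    using f(1) unfolding orthogonal_transformation_def by simp
  finally show ?thesis .
qed

lemma det_plus_rank_one:
  fixes A :: "real^'n^'n"
  assumes "invertible A"
  shows "det (A + rank_one y x) = det A * (1 + x \<bullet> (matrix_inv A *v y))"
proof -
  have "A + rank_one y x = A ** (mat 1 + rank_one (matrix_inv A *v y) x)"
    by (simp add: matrix_add_ldistrib matrix_mult_rank_one matrix_inv_cancel[OF assms])
  then show ?thesis by (simp add: det_mul det_one_plus_rank_one)
qed

lemma abs_det_le:
  fixes A :: "real^'n^'n"
  assumes "\<And>i j. \<bar>A $ i $ j\<bar> \<le> L"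
  shows "\<bar>det A\<bar> \<le> fact CARD('n) * L ^ CARD('n)"
proof -
  let ?perms = "{p. p permutes (UNIV :: 'n set)}"
  have "\<bar>det A\<bar> \<le> (\<Sum>p\<in>?perms. \<bar>of_int (sign p) * (\<Prod>i\<in>UNIV. A $ i $ p i)\<bar>)"
    unfolding det_def by (rule sum_abs)
  also have "\<dots> \<le> (\<Sum>p\<in>?perms. L ^ CARD('n))"
  proof (intro sum_mono)
    fix p :: "'n \<Rightarrow> 'n"
    have "(\<Prod>i\<in>UNIV. \<bar>A $ i $ p i\<bar>) \<le> (\<Prod>i\<in>(UNIV::'n set). L)"
      using assms by (intro prod_mono) auto
    then show "\<bar>of_int (sign p) * (\<Prod>i\<in>UNIV. A $ i $ p i)\<bar> \<le> L ^ CARD('n)"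
      by (simp add: abs_mult abs_prod sign_def)
  qed
  also have "\<dots> = fact CARD('n) * L ^ CARD('n)"
    by (simp add: card_permutations)
  finally show ?thesis .
qed

lemma pos_def_abs_entry_le:
  assumes V: "pos_def V" and upper: "\<And>w. w \<bullet> (V *v w) \<le> L * (norm w)\<^sup>2"
  shows "\<bar>V $ a $ b\<bar> \<le> L"
proof -
  have axis: "(wnorm V (axis i 1))\<^sup>2 \<le> L" for i
    unfolding wnorm_sq[OF V] using upper[of "axis i 1"] by (simp add: norm_axis_1)
  have "\<bar>V $ a $ b\<bar> = \<bar>axis a 1 \<bullet> (V *v axis b 1)\<bar>"
    by (simp add: inner_axis' matrix_vector_mul_component inner_axis)
  also have "\<dots> \<le> wnorm V (axis a 1) * wnorm V (axis b 1)"
    by (rule pos_def_Cauchy_Schwarz[OF V])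
  also have "\<dots> \<le> ((wnorm V (axis a 1))\<^sup>2 + (wnorm V (axis b 1))\<^sup>2) / 2"
    using sum_squares_bound[of "wnorm V (axis a 1)" "wnorm V (axis b 1)"] by (simp add: field_simps)
  also have "\<dots> \<le> L" using axis[of a] axis[of b] by simp
  finally show ?thesis .
qed

section \<open>Gaussian mixtures\<close>

lemma nn_integral_gaussian_real:
  fixes a :: real
  assumes "a > 0"
  shows "(\<integral>\<^sup>+x. ennreal (exp (- a * x\<^sup>2)) \<partial>lborel) = ennreal (sqrt (pi / a))"
proof -
  define s where "s = 1 / sqrt (2 * a)"
  have s: "s > 0" "2 * s\<^sup>2 = 1 / a"
    unfolding s_def using assms by (auto simp: power_divide)
  have "2 * pi * s\<^sup>2 = pi * (2 * s\<^sup>2)" by simp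
  then have "2 * pi * s\<^sup>2 = pi / a" unfolding s(2) by simp
  then have "exp (- a * x\<^sup>2) = sqrt (pi / a) * normal_density 0 s x" for x
    unfolding normal_density_def s(2) using assms by simp
  then show ?thesis
    using assms s by (subst nn_integral_eq_integral) auto
qed

definition gauss_weight :: "real \<Rightarrow> 'a::real_normed_vector \<Rightarrow> real" where
  "gauss_weight a w = exp (- a * (norm w)\<^sup>2)"

lemma borel_measurable_gauss_weight [measurable]:
  "(gauss_weight a :: 'a::euclidean_space \<Rightarrow> real) \<in> borel_measurable borel"
  unfolding gauss_weight_def by measurable

lemma nn_integral_gauss_weight:
  assumes "a > 0"
  shows "(\<integral>\<^sup>+w. ennreal (gauss_weight a (w :: 'a::euclidean_space)) \<partial>lborel)
    = ennreal (sqrt (pi / a) ^ DIM('a))"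
proof -
  have "ennreal (gauss_weight a w) = (\<Prod>b\<in>Basis. ennreal (exp (- a * (w \<bullet> b)\<^sup>2)))" for w :: 'a
  proof -
    have "(norm w)\<^sup>2 = (\<Sum>b\<in>Basis. (w \<bullet> b)\<^sup>2)"
      unfolding power2_norm_eq_inner euclidean_inner[of w w] by (simp add: power2_eq_square)
    then have "exp (- a * (norm w)\<^sup>2) = (\<Prod>b\<in>Basis. exp (- a * (w \<bullet> b)\<^sup>2))"
      by (simp add: sum_distrib_left flip: exp_sum sum_negf)
    then show ?thesis unfolding gauss_weight_def by (simp add: prod_ennreal)
  qed
  then have "(\<integral>\<^sup>+w. ennreal (gauss_weight a (w :: 'a)) \<partial>lborel)
      = (\<integral>\<^sup>+w. (\<Prod>b\<in>Basis. ennreal (exp (- a * ((w :: 'a) \<bullet> b)\<^sup>2))) \<partial>lborel)"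
    by simp
  also have "\<dots> = (\<Prod>b\<in>(Basis :: 'a set). (\<integral>\<^sup>+x. ennreal (exp (- a * x\<^sup>2)) \<partial>lborel))"
    by (rule nn_integral_lborel_prod) auto
  also have "\<dots> = ennreal (sqrt (pi / a) ^ DIM('a))"
    using assms unfolding nn_integral_gaussian_real[OF assms] by (simp add: ennreal_power)
  finally show ?thesis .
qed

lemma complete_square_pos_def:
  fixes V :: "real^'n^'n" and S w :: "real^'n"
  assumes V: "pos_def V" and s: "s > 0"
  defines "w0 \<equiv> (1 / s) *\<^sub>R (matrix_inv V *v S)"
  shows "(w0 + w) \<bullet> S - s / 2 * ((w0 + w) \<bullet> (V *v (w0 + w))) =
    (wnorm (matrix_inv V) S)\<^sup>2 / (2 * s) - s / 2 * (w \<bullet> (V *v w))"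
proof -
  define q where "q = (wnorm (matrix_inv V) S)\<^sup>2"
  have Vw0: "V *v w0 = (1 / s) *\<^sub>R S"
    unfolding w0_def
    by (simp add: matrix_vector_mult_scaleR matrix_inv_cancel[OF invertible_pos_def[OF V]])
  have w0S: "w0 \<bullet> S = q / s"
    unfolding w0_def q_def wnorm_sq[OF pos_def_matrix_inv[OF V]] by (simp add: inner_commute)
  have "(w0 + w) \<bullet> (V *v (w0 + w)) = w0 \<bullet> (V *v w0) + 2 * (w \<bullet> (V *v w0)) + w \<bullet> (V *v w)"
    using pos_def_sym[OF V, of w0 w]
    by (simp add: matrix_vector_right_distrib inner_add_left inner_add_right)
  also have "\<dots> = q / s / s + 2 * (w \<bullet> S) / s + w \<bullet> (V *v w)"
    unfolding Vw0 by (simp add: w0S)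
  finally have quad: "(w0 + w) \<bullet> (V *v (w0 + w)) = q / s / s + 2 * (w \<bullet> S) / s + w \<bullet> (V *v w)" .
  show ?thesis
    unfolding quad q_def[symmetric] using s by (simp add: inner_add_left w0S field_simps)
qed

lemma gaussian_mixture_lower:
  fixes V :: "real^'n^'n"
  assumes V: "pos_def V" and s: "s > 0" and L: "L > 0"
    and upper: "\<And>w. w \<bullet> (V *v w) \<le> L * (norm w)\<^sup>2"
  shows "ennreal (exp ((wnorm (matrix_inv V) S)\<^sup>2 / (2 * s)) * sqrt (2 * pi / (s * L)) ^ CARD('n))
    \<le> (\<integral>\<^sup>+u. ennreal (exp (u \<bullet> S - s / 2 * (u \<bullet> (V *v u)))) \<partial>lborel)"
proof -
  define q where "q = (wnorm (matrix_inv V) S)\<^sup>2 / (2 * s)"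
  define w0 where "w0 = (1 / s) *\<^sub>R (matrix_inv V *v S)"
  let ?F = "\<lambda>u. ennreal (exp (u \<bullet> S - s / 2 * (u \<bullet> (V *v u))))"
  have meas: "?F \<in> borel_measurable borel"
    by (intro measurable_compose[OF _ measurable_ennreal] borel_measurable_continuous_onI
        continuous_intros linear_continuous_on matrix_vector_mul_bounded_linear)
  have "ennreal (exp q * sqrt (2 * pi / (s * L)) ^ CARD('n))
      = ennreal (exp q) * (\<integral>\<^sup>+w. ennreal (gauss_weight (s * L / 2) (w :: real^'n)) \<partial>lborel)"
    using s L by (subst nn_integral_gauss_weight) (simp_all add: ennreal_mult' mult.commute)
  also have "\<dots> = (\<integral>\<^sup>+w. ennreal (exp q) * ennreal (gauss_weight (s * L / 2) (w :: real^'n)) \<partial>lborel)"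
    by (rule nn_integral_cmult[symmetric]) simp
  also have "\<dots> \<le> (\<integral>\<^sup>+w. ?F (w0 + w) \<partial>lborel)"
  proof (intro nn_integral_mono)
    fix w :: "real^'n"
    have "s / 2 * (w \<bullet> (V *v w)) \<le> s / 2 * (L * (norm w)\<^sup>2)"
      using s upper[of w] by (intro mult_left_mono) auto
    then show "ennreal (exp q) * ennreal (gauss_weight (s * L / 2) w) \<le> ?F (w0 + w)"
      unfolding w0_def complete_square_pos_def[OF V s]
      by (simp add: q_def gauss_weight_def ennreal_leI flip: ennreal_mult' exp_add)
  qed
  also have "\<dots> = (\<integral>\<^sup>+u. ?F u \<partial>(distr lborel borel ((+) w0)))"
    by (rule nn_integral_distr[symmetric]) (use meas in auto)
  finally show ?thesis unfolding lborel_distr_plus q_def .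
qed

section \<open>Ridge regression\<close>

lemma mat_mult_vec: "mat (lam :: real) *v w = lam *\<^sub>R (w :: real^'d)"
  unfolding mat_def matrix_vector_mult_def vec_eq_iff
  by (simp add: if_distrib[of "\<lambda>z. z * _"] cong: if_cong)

lemma det_mat: "det (mat lam :: real^'d^'d) = lam ^ CARD('d)"
  by (subst det_diagonal) (auto simp: mat_def)

definition weighted_sum :: "((real^'d) \<times> real) list \<Rightarrow> real^'d" where
  "weighted_sum D = sum_list (map (\<lambda>(x, y). y *\<^sub>R x) D)"

lemma weighted_sum_Nil [simp]: "weighted_sum [] = 0"
  unfolding weighted_sum_def by simp

lemma weighted_sum_snoc [simp]: "weighted_sum (D @ [(x, y)]) = weighted_sum D + y *\<^sub>R x"
  unfolding weighted_sum_def by simp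

lemma gram_Nil [simp]: "gram lam [] = mat lam"
  unfolding gram_def by simp

lemma gram_snoc [simp]: "gram lam (D @ [p]) = gram lam D + rank_one (fst p) (fst p)"
  unfolding gram_def rank_one_def by (cases p) simp

abbreviation gram_inv :: "real \<Rightarrow> ((real^'d) \<times> real) list \<Rightarrow> real^'d^'d" where
  "gram_inv lam D \<equiv> matrix_inv (gram lam D)"

lemma ridge_est_eq: "ridge_est lam D = gram_inv lam D *v weighted_sum D"
  unfolding ridge_est_def weighted_sum_def ..

lemma inner_gram:
  "u \<bullet> (gram lam D *v w) = lam * (u \<bullet> w) + (\<Sum>p\<leftarrow>D. (fst p \<bullet> u) * (fst p \<bullet> w))"
proof (induction D rule: rev_induct)
  case Nil
  then show ?case by (simp add: mat_mult_vec)
next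
  case (snoc p D)
  then show ?case
    by (simp add: matrix_vector_mult_add_rdistrib rank_one_mult_vec inner_add_right inner_commute)
qed

lemma gram_quad_lower: "lam * (norm w)\<^sup>2 \<le> w \<bullet> (gram lam D *v w)"
proof -
  have "0 \<le> (\<Sum>p\<leftarrow>D. (fst p \<bullet> w) * (fst p \<bullet> w))" by (intro sum_list_nonneg) auto
  then show ?thesis unfolding inner_gram by (simp add: power2_norm_eq_inner)
qed

lemma gram_quad_upper:
  fixes B :: real
  assumes bound: "\<And>p. p \<in> set D \<Longrightarrow> norm (fst p) \<le> B" and len: "length D \<le> n"
  shows "w \<bullet> (gram lam D *v w) \<le> (lam + real n * B\<^sup>2) * (norm w)\<^sup>2"
proof -
  have "(\<Sum>p\<leftarrow>D. (fst p \<bullet> w) * (fst p \<bullet> w)) \<le> (\<Sum>p\<leftarrow>D. B\<^sup>2 * (norm w)\<^sup>2)"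
  proof (rule sum_list_mono)
    fix p assume "p \<in> set D"
    then have "\<bar>fst p \<bullet> w\<bar> \<le> B * norm w"
      using bound by (meson Cauchy_Schwarz_ineq2 mult_right_mono norm_ge_zero order_trans)
    then have "\<bar>fst p \<bullet> w\<bar>\<^sup>2 \<le> (B * norm w)\<^sup>2" by (intro power_mono) auto
    then show "(fst p \<bullet> w) * (fst p \<bullet> w) \<le> B\<^sup>2 * (norm w)\<^sup>2"
      by (simp add: power2_eq_square mult_ac)
  qed
  also have "\<dots> \<le> real n * (B\<^sup>2 * (norm w)\<^sup>2)"
    using len by (simp add: sum_list_triv mult_right_mono)
  finally show ?thesis
    unfolding inner_gram by (simp add: power2_norm_eq_inner algebra_simps)
qed

lemma pos_def_gram:
  assumes "lam > 0"
  shows "pos_def (gram lam D)"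
proof -
  have "0 < w \<bullet> (gram lam D *v w)" if "w \<noteq> 0" for w
  proof -
    have "0 < lam * (norm w)\<^sup>2" using assms that by simp
    then show ?thesis using gram_quad_lower by (rule less_le_trans)
  qed
  then show ?thesis
    unfolding pos_def_def inner_gram by (simp add: inner_commute mult.commute)
qed

lemma pos_def_gram_inv: "lam > 0 \<Longrightarrow> pos_def (gram_inv lam D)"
  by (intro pos_def_matrix_inv pos_def_gram)

lemma det_gram_snoc:
  assumes "lam > 0"
  shows "det (gram lam (D @ [p])) = det (gram lam D) * (1 + (wnorm (gram_inv lam D) (fst p))\<^sup>2)"
  using assms
  by (simp add: det_plus_rank_one invertible_pos_def pos_def_gram wnorm_sq pos_def_gram_inv)

lemma det_gram_le:
  fixes D :: "((real^'d) \<times> real) list" and B :: real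
  assumes "lam > 0" "\<And>p. p \<in> set D \<Longrightarrow> norm (fst p) \<le> B" "length D \<le> n"
  shows "det (gram lam D) \<le> fact CARD('d) * (lam + real n * B\<^sup>2) ^ CARD('d)"
  using abs_det_le[OF pos_def_abs_entry_le[OF pos_def_gram gram_quad_upper], of lam D B n] assms
  by (simp add: abs_le_iff)

lemma elliptical_potential:
  fixes D :: "((real^'d) \<times> real) list" and B z :: real
  assumes lam: "lam > 0" and bound: "\<And>p. p \<in> set D \<Longrightarrow> norm (fst p) \<le> B"
    and T: "length D \<le> T" and z: "z > 0"
    and growth: "lam ^ CARD('d) * (1 + z) ^ n \<le> det (gram lam D)"
  shows "real n * z \<le> (ln (fact CARD('d)) + real CARD('d) * ln (1 + real T * B\<^sup>2 / lam)) * (1 + z)"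
proof -
  let ?d = "CARD('d)" and ?r = "1 + real T * B\<^sup>2 / lam"
  have r: "?r > 0" using lam by (intro add_pos_nonneg) auto
  have "lam ^ ?d * (1 + z) ^ n \<le> fact ?d * (lam + real T * B\<^sup>2) ^ ?d"
    using growth det_gram_le[OF lam bound T] by (rule order_trans)
  also have "lam + real T * B\<^sup>2 = lam * ?r" using lam by (simp add: field_simps)
  also have "fact ?d * (lam * ?r) ^ ?d = lam ^ ?d * (fact ?d * ?r ^ ?d)"
    by (simp add: power_mult_distrib)
  finally have "(1 + z) ^ n \<le> fact ?d * ?r ^ ?d" using lam by simp
  then have "ln ((1 + z) ^ n) \<le> ln (fact ?d * ?r ^ ?d)" using z r by (intro ln_mono) auto
  then have log: "real n * ln (1 + z) \<le> ln (fact ?d) + real ?d * ln ?r"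
    using r z by (simp add: ln_mult ln_realpow)
  have "ln (1 / (1 + z)) \<le> 1 / (1 + z) - 1" using z by (intro ln_le_minus_one) auto
  then have "z / (1 + z) \<le> ln (1 + z)" using z by (simp add: ln_div field_simps)
  then have "real n * (z / (1 + z)) \<le> real n * ln (1 + z)" by (intro mult_left_mono) auto
  then have "real n * (z / (1 + z)) \<le> ln (fact ?d) + real ?d * ln ?r" using log by linarith
  then show ?thesis using z by (simp add: field_simps)
qed

definition noise_sum :: "real^'d \<Rightarrow> ((real^'d) \<times> real) list \<Rightarrow> real^'d" where
  "noise_sum th D = (\<Sum>(x, y)\<leftarrow>D. (y - th \<bullet> x) *\<^sub>R x)"

lemma noise_sum_Nil [simp]: "noise_sum th [] = 0"
  unfolding noise_sum_def by simp

lemma noise_sum_snoc [simp]: "noise_sum th (D @ [(x, y)]) = noise_sum th D + (y - th \<bullet> x) *\<^sub>R x"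
  unfolding noise_sum_def by simp

lemma noise_sum_eq: "noise_sum th D = weighted_sum D - gram lam D *v th + lam *\<^sub>R th"
proof (induction D rule: rev_induct)
  case Nil
  show ?case by (simp add: mat_mult_vec)
next
  case (snoc p D)
  obtain x y where p: "p = (x, y)" by fastforce
  show ?case
    unfolding p noise_sum_snoc snoc
    by (simp add: matrix_vector_mult_add_rdistrib rank_one_mult_vec scaleR_diff_left inner_commute)
qed

lemma ridge_est_error:
  assumes lam: "lam > 0"
  shows "\<bar>(ridge_est lam D - th) \<bullet> x\<bar> \<le>
    wnorm (gram_inv lam D) x * (wnorm (gram_inv lam D) (noise_sum th D) + sqrt lam * norm th)"
proof -
  let ?W = "gram_inv lam D"
  note W = pos_def_gram_inv[OF lam, of D]
  have "ridge_est lam D - th = ?W *v weighted_sum D - ?W *v (gram lam D *v th)"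
    unfolding ridge_est_eq matrix_inv_cancel(2)[OF invertible_pos_def[OF pos_def_gram[OF lam]]] ..
  also have "\<dots> = ?W *v noise_sum th D - lam *\<^sub>R (?W *v th)"
    unfolding noise_sum_eq[of th D lam]
    by (simp add: matrix_vector_mult_diff_distrib matrix_vector_right_distrib matrix_vector_mult_scaleR)
  finally have "(ridge_est lam D - th) \<bullet> x = x \<bullet> (?W *v noise_sum th D) - lam * (x \<bullet> (?W *v th))"
    by (simp add: inner_diff_right inner_commute[of _ x])
  moreover have "\<bar>lam * (x \<bullet> (?W *v th))\<bar> \<le> wnorm ?W x * (sqrt lam * norm th)"
  proof -
    have "\<bar>lam * (x \<bullet> (?W *v th))\<bar> \<le> lam * (wnorm ?W x * wnorm ?W th)"
      using pos_def_Cauchy_Schwarz[OF W, of x th] lam by (simp add: abs_mult)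
    also have "\<dots> = wnorm ?W x * (sqrt lam * (sqrt lam * wnorm ?W th))"
      using lam by simp
    also have "\<dots> \<le> wnorm ?W x * (sqrt lam * norm th)"
      using wnorm_matrix_inv_le[OF pos_def_gram[OF lam] lam gram_quad_lower] wnorm_nonneg[OF W] lam
      by (intro mult_left_mono) auto
    finally show ?thesis .
  qed
  ultimately show ?thesis
    using pos_def_Cauchy_Schwarz[OF W, of x "noise_sum th D"] by (simp add: distrib_left)
qed

section \<open>The self-normalised noise\<close>

definition noise_exponential :: "real \<Rightarrow> real^'d \<Rightarrow> real^'d \<Rightarrow> ((real^'d) \<times> real) list \<Rightarrow> real" where
  "noise_exponential R th u D =
     exp (\<Sum>(x, y)\<leftarrow>D. (u \<bullet> x) * (y - th \<bullet> x) - R\<^sup>2 / 2 * (u \<bullet> x)\<^sup>2)"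

lemma noise_exponential_Nil [simp]: "noise_exponential R th u [] = 1"
  unfolding noise_exponential_def by simp

lemma noise_exponential_snoc [simp]:
  "noise_exponential R th u (D @ [(x, y)]) =
    noise_exponential R th u D * exp ((u \<bullet> x) * (y - th \<bullet> x) - R\<^sup>2 / 2 * (u \<bullet> x)\<^sup>2)"
  unfolding noise_exponential_def by (simp add: exp_add)

lemma noise_exponential_pos: "0 < noise_exponential R th u D"
  unfolding noise_exponential_def by simp

lemma noise_exponential_eq:
  "noise_exponential R th u D =
    exp (u \<bullet> noise_sum th D - R\<^sup>2 / 2 * (u \<bullet> (gram lam D *v u) - lam * (norm u)\<^sup>2))"
proof (induction D rule: rev_induct)
  case Nil
  show ?case by (simp add: mat_mult_vec power2_norm_eq_inner)
next
  case (snoc p D)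
  obtain x y where p: "p = (x, y)" by fastforce
  show ?case
    unfolding p noise_exponential_snoc snoc
    by (simp add: matrix_vector_mult_add_rdistrib rank_one_mult_vec inner_add_right
        inner_commute[of x u] power2_eq_square algebra_simps flip: exp_add)
qed

lemma power_le_exp_half:
  fixes x :: real
  assumes x: "x > 0" and y: "real n * ln (x\<^sup>2) \<le> y"
  shows "x ^ n \<le> exp (y / 2)"
proof -
  have "real n * ln x \<le> y / 2" using x y by (simp add: ln_realpow)
  then have "exp (real n * ln x) \<le> exp (y / 2)" by simp
  then show ?thesis using x by (simp add: exp_of_nat_mult)
qed

lemma self_normalised_mixture:
  fixes D :: "((real^'d) \<times> real) list" and B :: real
  assumes lam: "lam > 0" and R: "R > 0" and T: "T > 0"
    and bound: "\<And>p. p \<in> set D \<Longrightarrow> norm (fst p) \<le> B" and len: "length D \<le> T"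
    and large: "R\<^sup>2 * (real CARD('d) * ln ((1 + real T * B\<^sup>2 / lam) * (real T)\<^sup>2))
      \<le> (wnorm (gram_inv lam D) (noise_sum th D))\<^sup>2"
  defines "a \<equiv> R\<^sup>2 * lam / 2"
  shows "ennreal (real T ^ CARD('d)) * (\<integral>\<^sup>+u. ennreal (gauss_weight a (u :: real^'d)) \<partial>lborel)
    \<le> (\<integral>\<^sup>+u. ennreal (noise_exponential R th u D * gauss_weight a u) \<partial>lborel)"
proof -
  let ?d = "CARD('d)"
  define L where "L = lam + real T * B\<^sup>2"
  define q where "q = (wnorm (gram_inv lam D) (noise_sum th D))\<^sup>2"
  define r where "r = sqrt (L / lam)"
  have L: "L > 0" unfolding L_def using lam by (intro add_pos_nonneg) auto
  have r: "r > 0" "r\<^sup>2 = 1 + real T * B\<^sup>2 / lam"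
    unfolding r_def using L lam by (auto simp: L_def field_simps)
  have "(1 + real T * B\<^sup>2 / lam) * (real T)\<^sup>2 = (real T * r)\<^sup>2"
    by (simp add: power_mult_distrib r(2))
  then have "real ?d * ln ((real T * r)\<^sup>2) \<le> q / R\<^sup>2"
    using large R unfolding q_def by (simp add: pos_le_divide_eq mult.commute)
  then have growth: "(real T * r) ^ ?d \<le> exp (q / (2 * R\<^sup>2))"
    using power_le_exp_half[of "real T * r" ?d "q / R\<^sup>2"] r T by (simp add: mult.commute)
  have "sqrt (pi / a) = r * sqrt (2 * pi / (R\<^sup>2 * L))"
    unfolding r_def a_def using L lam R by (simp add: real_sqrt_mult[symmetric] field_simps)
  then have "real T ^ ?d * sqrt (pi / a) ^ ?d = (real T * r) ^ ?d * sqrt (2 * pi / (R\<^sup>2 * L)) ^ ?d"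
    by (simp add: power_mult_distrib)
  also have "\<dots> \<le> exp (q / (2 * R\<^sup>2)) * sqrt (2 * pi / (R\<^sup>2 * L)) ^ ?d"
    using L R by (intro mult_right_mono growth) auto
  finally have "ennreal (real T ^ ?d * sqrt (pi / a) ^ ?d)
      \<le> (\<integral>\<^sup>+u. ennreal (exp (u \<bullet> noise_sum th D - R\<^sup>2 / 2 * (u \<bullet> (gram lam D *v u)))) \<partial>lborel)"
    using gaussian_mixture_lower[OF pos_def_gram[OF lam] _ L, of "R\<^sup>2" D "noise_sum th D"] R
      gram_quad_upper[OF bound len]
    unfolding q_def L_def by (auto intro: order_trans ennreal_leI)
  moreover have "exp (u \<bullet> noise_sum th D - R\<^sup>2 / 2 * (u \<bullet> (gram lam D *v u)))
      = noise_exponential R th u D * gauss_weight a u" for u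
    unfolding noise_exponential_eq[of R th u D lam] gauss_weight_def a_def
    by (simp add: algebra_simps flip: exp_add)
  moreover have "a > 0" unfolding a_def using R lam by simp
  ultimately show ?thesis by (simp add: nn_integral_gauss_weight ennreal_mult')
qed

section \<open>BARB along one trajectory\<close>

abbreviation gap :: "('n, 'd) barb_state \<Rightarrow> real" where
  "gap st \<equiv> fst st"

abbreviation flags :: "('n, 'd) barb_state \<Rightarrow> nat" where
  "flags st \<equiv> fst (snd st)"

abbreviation samples :: "('n, 'd) barb_state \<Rightarrow> 'n \<Rightarrow> ((real, 'd) vec \<times> real) list" where
  "samples st \<equiv> snd (snd st)"

type_synonym ('d, 'k) contexts = "((real, 'd) vec, 'k) vec"

type_synonym ('n, 'k, 'd) environment = "nat \<Rightarrow> ('d, 'k) contexts \<times> ('n \<times> 'k \<Rightarrow> real)"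

locale barb_algorithm = strict_market arank
  for arank :: "'k::{finite,linorder} \<Rightarrow> 'n::{finite,linorder} \<Rightarrow> nat" +
  fixes \<theta> :: "'n \<Rightarrow> (real, 'd::finite) vec"
    and mcm :: "('n \<times> 'k) set \<Rightarrow> ('n, 'k) matching"
    and Bth Bx R lam Del1 :: real
  assumes theta_bound: "norm (\<theta> i) \<le> Bth"
    and utility_bound: "2 * Bth * Bx \<le> 1"
    and R_pos: "R > 0" and lam_pos: "lam > 0" and Del1_pos: "Del1 > 0"
    and mcm_spec: "max_card_matching E (mcm E)"
begin

definition conf_level :: "nat \<Rightarrow> real" where
  "conf_level T = real CARD('d) * ln ((1 + real T * Bx\<^sup>2 / lam) * (real T)\<^sup>2)"

definition eta :: "nat \<Rightarrow> real" where
  "eta T = barb_eta CARD('d) T R lam Bth Bx"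

definition log_det_growth :: "nat \<Rightarrow> real" where
  "log_det_growth T = ln (fact CARD('d)) + real CARD('d) * ln (1 + real T * Bx\<^sup>2 / lam)"

definition explore_rate :: "nat \<Rightarrow> real" where
  "explore_rate T = real CARD('n) * log_det_growth T * (Del1\<^sup>2 + (eta T)\<^sup>2)"

definition flag_rate :: "nat \<Rightarrow> real" where
  "flag_rate T = 3 * ln (real T) / 16 + Del1\<^sup>2"

definition flag_limit :: "nat \<Rightarrow> real \<Rightarrow> real" where
  "flag_limit T \<Delta> = 3 * ln (real T) / (16 * \<Delta>\<^sup>2)"

definition inv_sq_gap_bound :: "nat \<Rightarrow> real \<Rightarrow> real \<Rightarrow> real" where
  "inv_sq_gap_bound T D g = 1 / Del1\<^sup>2 + 2 / D\<^sup>2 + 32 / (3 * ln (real T)) * g"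

definition fine_gap :: "nat \<Rightarrow> real" where
  "fine_gap T = real T powr (- 1 / 3)"

definition max_batches :: "nat \<Rightarrow> real" where
  "max_batches T = log 2 (Del1\<^sup>2 * inv_sq_gap_bound T (fine_gap T) (real T))"

definition failure_prob :: "nat \<Rightarrow> real" where
  "failure_prob T = real CARD('n) * (1 + max_batches T) / real T"

lemma eta_eq: "eta T = R * sqrt (conf_level T) + sqrt lam * Bth"
  unfolding eta_def barb_eta_def conf_level_def ..

lemma Bth_nonneg: "0 \<le> Bth"
  using theta_bound norm_ge_zero order_trans by blast

lemma log_det_growth_nonneg: "0 \<le> log_det_growth T"
  unfolding log_det_growth_def using lam_pos
  by (intro add_nonneg_nonneg mult_nonneg_nonneg ln_ge_zero) auto

lemma explore_rate_nonneg: "0 \<le> explore_rate T"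
  unfolding explore_rate_def using log_det_growth_nonneg by simp

lemma mcm_edges: "mcm E i = Some j \<Longrightarrow> (i, j) \<in> E"
  using mcm_spec[of E] unfolding max_card_matching_def by blast

lemma mcm_nonempty:
  assumes "E \<noteq> {}"
  obtains i j where "mcm E i = Some j"
proof (rule ccontr)
  assume "\<not> thesis"
  then have "mcm E a = None" for a using that by (cases "mcm E a") blast+
  then have unmatched: "{a. mcm E a \<noteq> None} = {}" by simp
  obtain i j where ij: "(i, j) \<in> E" using assms by auto
  define \<mu> where "\<mu> = [i \<mapsto> j]"
  have "is_matching \<mu>" "\<forall>i j. \<mu> i = Some j \<longrightarrow> (i, j) \<in> E"
    using ij unfolding \<mu>_def is_matching_def by (auto split: if_splits)
  then have "card {a. \<mu> a \<noteq> None} \<le> card {a. mcm E a \<noteq> None}"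
    using mcm_spec[of E] unfolding max_card_matching_def by blast
  moreover have "{a. \<mu> a \<noteq> None} = {i}" unfolding \<mu>_def by auto
  ultimately show False unfolding unmatched by simp
qed

end

locale barb_trajectory = barb_algorithm arank \<theta> mcm Bth Bx R lam Del1
  for arank :: "'k::{finite,linorder} \<Rightarrow> 'n::{finite,linorder} \<Rightarrow> nat"
    and \<theta> :: "'n \<Rightarrow> (real, 'd::finite) vec"
    and mcm :: "('n \<times> 'k) set \<Rightarrow> ('n, 'k) matching"
    and Bth Bx R lam Del1 :: real +
  fixes T :: nat
  assumes T_ge_2: "T \<ge> 2"
begin

definition uncertain :: "('n, 'd) barb_state \<Rightarrow> ('d, 'k) contexts \<Rightarrow> ('n \<times> 'k) set" where
  "uncertain st x = {(i, j). gap st / eta T < wnorm (gram_inv lam (samples st i)) (x $ j)}"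

abbreviation exploring :: "('n, 'd) barb_state \<Rightarrow> ('d, 'k) contexts \<Rightarrow> bool" where
  "exploring st x \<equiv> uncertain st x \<noteq> {}"

definition est_util :: "('n, 'd) barb_state \<Rightarrow> ('d, 'k) contexts \<Rightarrow> 'n \<Rightarrow> 'k \<Rightarrow> real" where
  "est_util st x i j = ridge_est lam (samples st i) \<bullet> (x $ j)"

definition played :: "('n, 'd) barb_state \<Rightarrow> ('d, 'k) contexts \<Rightarrow> ('n, 'k) matching" where
  "played st x = (if exploring st x then mcm (uncertain st x) else gale_shapley arank (est_util st x))"

definition flagged :: "('n, 'd) barb_state \<Rightarrow> ('d, 'k) contexts \<Rightarrow> bool" where
  "flagged st x \<longleftrightarrow> \<not> exploring st x \<and> (\<exists>i. small_gap CARD('n) (est_util st x) i (gap st))"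

definition batch_ends :: "('n, 'd) barb_state \<Rightarrow> ('d, 'k) contexts \<Rightarrow> bool" where
  "batch_ends st x \<longleftrightarrow> \<not> exploring st x \<and>
     flag_limit T (gap st) < real (flags st + of_bool (flagged st x))"

definition explored :: "('n, 'd) barb_state \<Rightarrow> ('d, 'k) contexts \<Rightarrow> ('n, 'k) matching" where
  "explored st x = (if exploring st x then mcm (uncertain st x) else (\<lambda>_. None))"

definition next_samples ::
    "('n, 'd) barb_state \<Rightarrow> ('d, 'k) contexts \<Rightarrow> ('n \<times> 'k \<Rightarrow> real) \<Rightarrow> 'n \<Rightarrow>
     ((real, 'd) vec \<times> real) list" where
  "next_samples st x e i =
     (case explored st x i of None \<Rightarrow> samples st i
      | Some j \<Rightarrow> samples st i @ [(x $ j, util \<theta> x i j + e (i, j))])"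

definition next_state ::
    "('n, 'd) barb_state \<Rightarrow> ('d, 'k) contexts \<Rightarrow> ('n \<times> 'k \<Rightarrow> real) \<Rightarrow> ('n, 'd) barb_state" where
  "next_state st x e = (if batch_ends st x then (gap st / sqrt 2, 0, \<lambda>_. [])
     else (gap st, flags st + of_bool (flagged st x), next_samples st x e))"

lemma gap_next: "gap (next_state st x e) = (if batch_ends st x then gap st / sqrt 2 else gap st)"
  unfolding next_state_def by simp

lemma flags_next:
  "flags (next_state st x e) = (if batch_ends st x then 0 else flags st + of_bool (flagged st x))"
  unfolding next_state_def by simp

lemma samples_next:
  "samples (next_state st x e) i = (if batch_ends st x then [] else next_samples st x e i)"
  unfolding next_state_def by simp

lemma exploring_not_flagged: "exploring st x \<Longrightarrow> \<not> flagged st x"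
  unfolding flagged_def by simp

lemma exploring_not_batch_ends: "exploring st x \<Longrightarrow> \<not> batch_ends st x"
  unfolding batch_ends_def by simp

lemma next_samples_exploiting: "\<not> exploring st x \<Longrightarrow> next_samples st x e i = samples st i"
  unfolding next_samples_def explored_def by simp

lemma barb_round_eq:
  "barb_round T R lam Bth Bx arank mcm \<theta> (x, e) st =
    (played st x, \<lambda>i. case played st x i of None \<Rightarrow> 0 | Some j \<Rightarrow> util \<theta> x i j + e (i, j),
     next_state st x e)"
proof -
  have explore_set: "{(i, j). gap st / eta T < wnorm (gram_inv lam (samples st i)) (x $ j)}
      = uncertain st x"
    unfolding uncertain_def ..
  have estimates: "(\<lambda>i j. ridge_est lam (samples st i) \<bullet> (x $ j)) = est_util st x"
    unfolding est_util_def by (simp add: fun_eq_iff)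
  have state: "st = (gap st, flags st, samples st)" by simp
  show ?thesis
  proof (cases "exploring st x")
    case False
    then have flags: "(if \<exists>i. small_gap CARD('n) (est_util st x) i (gap st)
        then flags st + 1 else flags st) = flags st + of_bool (flagged st x)"
      unfolding flagged_def by simp
    have "next_samples st x e = samples st"
      using next_samples_exploiting False by (simp add: fun_eq_iff)
    then show ?thesis
      using False
      unfolding barb_round_def prod.case Let_def eta_def[symmetric]
      by (subst state, unfold prod.case explore_set estimates flags)
        (simp add: played_def next_state_def batch_ends_def flag_limit_def)
  next
    case True
    then show ?thesis
      unfolding barb_round_def prod.case Let_def eta_def[symmetric]
      by (subst state, unfold prod.case explore_set estimates)
        (auto simp: played_def next_state_def next_samples_def explored_def fun_eq_iff
          exploring_not_flagged exploring_not_batch_ends split: option.split)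
  qed
qed

text \<open>The state \<open>hist \<omega> t\<close> is the one before round \<open>t + 1\<close>, the round of \<open>ctx \<omega> t\<close> and \<open>noise \<omega> t\<close>.\<close>

abbreviation "hist \<equiv> barb_hist T R lam Bth Bx Del1 arank mcm \<theta>"

abbreviation ctx :: "(nat \<Rightarrow> 'a \<times> 'b) \<Rightarrow> nat \<Rightarrow> 'a" where
  "ctx \<omega> t \<equiv> fst (\<omega> (Suc t))"

abbreviation noise :: "(nat \<Rightarrow> 'a \<times> 'b) \<Rightarrow> nat \<Rightarrow> 'b" where
  "noise \<omega> t \<equiv> snd (\<omega> (Suc t))"

lemma hist_Suc: "hist \<omega> (Suc t) = next_state (hist \<omega> t) (ctx \<omega> t) (noise \<omega> t)"
  using barb_round_eq[of "ctx \<omega> t" "noise \<omega> t" "hist \<omega> t"] by simp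

declare barb_hist.simps(2) [simp del]

lemma hist_cong:
  assumes "\<And>s. 1 \<le> s \<Longrightarrow> s \<le> t \<Longrightarrow> \<omega> s = \<omega>' s"
  shows "hist \<omega> t = hist \<omega>' t"
  using assms by (induction t) (auto simp: hist_Suc)

definition count_rounds ::
    "(('n, 'd) barb_state \<Rightarrow> ('d, 'k) contexts \<Rightarrow> bool) \<Rightarrow>
     ('n, 'k, 'd) environment \<Rightarrow> nat \<Rightarrow> nat" where
  "count_rounds P \<omega> t = (\<Sum>s<t. of_bool (P (hist \<omega> s) (ctx \<omega> s)))"

lemma count_rounds_0 [simp]: "count_rounds P \<omega> 0 = 0"
  unfolding count_rounds_def by simp

lemma count_rounds_Suc [simp]:
  "count_rounds P \<omega> (Suc t) = count_rounds P \<omega> t + of_bool (P (hist \<omega> t) (ctx \<omega> t))"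
  unfolding count_rounds_def by simp

lemma count_rounds_le: "count_rounds P \<omega> t \<le> t"
  by (induction t) auto

lemma ln_T_pos: "0 < ln (real T)"
  using T_ge_2 by simp

lemma conf_level_pos: "0 < conf_level T"
proof -
  have "(1 + real T * Bx\<^sup>2 / lam) * (real T)\<^sup>2 \<ge> 1 * 2\<^sup>2"
    using T_ge_2 lam_pos by (intro mult_mono power_mono) auto
  then show ?thesis unfolding conf_level_def by simp
qed

lemma eta_pos: "0 < eta T"
  unfolding eta_eq using conf_level_pos R_pos lam_pos Bth_nonneg by (intro add_pos_nonneg) auto

lemma flag_limit_nonneg: "0 \<le> flag_limit T \<Delta>"
  unfolding flag_limit_def using ln_T_pos by simp

lemma flag_rate_nonneg: "0 \<le> flag_rate T"
  unfolding flag_rate_def using ln_T_pos by simp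

lemma fine_gap_pos: "0 < fine_gap T"
  unfolding fine_gap_def using T_ge_2 by simp

lemma inv_sq_gap_bound_mono: "g \<le> g' \<Longrightarrow> inv_sq_gap_bound T D g \<le> inv_sq_gap_bound T D g'"
  unfolding inv_sq_gap_bound_def using ln_T_pos by (intro add_left_mono mult_left_mono) auto

subsection \<open>Regret of one round\<close>

definition player_accurate :: "'n \<Rightarrow> ('n, 'd) barb_state \<Rightarrow> bool" where
  "player_accurate i st \<longleftrightarrow>
     (wnorm (gram_inv lam (samples st i)) (noise_sum (\<theta> i) (samples st i)))\<^sup>2 \<le> R\<^sup>2 * conf_level T"

definition accurate :: "('n, 'd) barb_state \<Rightarrow> bool" where
  "accurate st \<longleftrightarrow> (\<forall>i. player_accurate i st)"

lemma accurate_est_util: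
  assumes acc: "accurate st" and exploit: "\<not> exploring st x" and gap: "0 < gap st"
  shows "\<bar>est_util st x i j - util \<theta> x i j\<bar> \<le> gap st"
proof -
  let ?D = "samples st i" and ?W = "gram_inv lam (samples st i)"
  have "(wnorm ?W (noise_sum (\<theta> i) ?D))\<^sup>2 \<le> (R * sqrt (conf_level T))\<^sup>2"
    using acc conf_level_pos unfolding accurate_def player_accurate_def
    by (simp add: power_mult_distrib)
  then have noise: "wnorm ?W (noise_sum (\<theta> i) ?D) \<le> R * sqrt (conf_level T)"
    by (rule power2_le_imp_le) (use R_pos conf_level_pos in auto)
  have width: "wnorm ?W (x $ j) \<le> gap st / eta T"
    using exploit unfolding uncertain_def by (auto simp: not_less[symmetric])
  have "\<bar>est_util st x i j - util \<theta> x i j\<bar> = \<bar>(ridge_est lam ?D - \<theta> i) \<bullet> (x $ j)\<bar>"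
    unfolding est_util_def util_def by (simp add: inner_diff_left)
  also have "\<dots> \<le> wnorm ?W (x $ j) * (wnorm ?W (noise_sum (\<theta> i) ?D) + sqrt lam * norm (\<theta> i))"
    by (rule ridge_est_error[OF lam_pos])
  also have "\<dots> \<le> gap st / eta T * eta T"
  proof (rule mult_mono[OF width])
    show "wnorm ?W (noise_sum (\<theta> i) ?D) + sqrt lam * norm (\<theta> i) \<le> eta T"
      unfolding eta_eq using noise theta_bound[of i] lam_pos by (intro add_mono mult_left_mono) auto
    show "0 \<le> wnorm ?W (noise_sum (\<theta> i) ?D) + sqrt lam * norm (\<theta> i)"
      using lam_pos by (simp add: wnorm_nonneg pos_def_gram_inv)
  qed (use gap eta_pos in simp)
  also have "\<dots> = gap st" using eta_pos by simp
  finally show ?thesis .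
qed

lemma flagged_delta_min:
  assumes acc: "accurate st" and flag: "flagged st x" and gap: "0 < gap st"
  shows "delta_min \<theta> x \<le> 4 * gap st"
proof -
  obtain i where "small_gap CARD('n) (est_util st x) i (gap st)"
    using flag unfolding flagged_def by blast
  moreover have "\<bar>est_util st x i j - util \<theta> x i j\<bar> \<le> gap st" for i j
    using flag accurate_est_util[OF acc _ gap] unfolding flagged_def by blast
  ultimately show ?thesis by (rule small_gap_delta_min)
qed

lemma abs_match_val_le:
  assumes x: "\<And>j. norm (x $ j) \<le> Bx"
  shows "\<bar>match_val (util \<theta> x) \<mu> i\<bar> \<le> 1 / 2"
proof (cases "\<mu> i")
  case (Some j)
  have "\<bar>util \<theta> x i j\<bar> \<le> norm (\<theta> i) * norm (x $ j)"
    unfolding util_def by (rule Cauchy_Schwarz_ineq2)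
  also have "\<dots> \<le> Bth * Bx" using theta_bound x Bth_nonneg by (intro mult_mono) auto
  finally show ?thesis using Some utility_bound unfolding match_val_def by simp
qed (simp add: match_val_def)

lemma abs_Ustar_le:
  assumes x: "\<And>j. norm (x $ j) \<le> Bx"
  shows "\<bar>Ustar arank \<theta> x i\<bar> \<le> 1 / 2"
  by (rule Ustar_attained[of \<theta> x i]) (use abs_match_val_le[OF x] in simp)

abbreviation round_regret :: "('n, 'd) barb_state \<Rightarrow> ('d, 'k) contexts \<Rightarrow> 'n \<Rightarrow> real" where
  "round_regret st x i \<equiv> Ustar arank \<theta> x i - match_val (util \<theta> x) (played st x) i"

lemma round_regret_le:
  assumes x: "\<And>j. norm (x $ j) \<le> Bx" and gap: "0 < gap st"
  shows "round_regret st x i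
    \<le> of_bool (exploring st x) + of_bool (flagged st x) + of_bool (\<not> accurate st)"
proof (cases "\<not> exploring st x \<and> \<not> flagged st x \<and> accurate st")
  case True
  then have "Ustar arank \<theta> x i \<le> match_val (util \<theta> x) (gale_shapley arank (est_util st x)) i"
    using accurate_est_util[OF _ _ gap] unfolding flagged_def by (intro Ustar_le_gale_shapley) auto
  then show ?thesis using True unfolding played_def by simp
next
  case False
  have "round_regret st x i \<le> 1"
    using abs_Ustar_le[OF x, of i] abs_match_val_le[OF x, of "played st x" i] by linarith
  then show ?thesis using False by auto
qed

subsection \<open>Invariants of a batch\<close>

definition valid_samples :: "nat \<Rightarrow> real \<Rightarrow> ((real, 'd) vec \<times> real) list \<Rightarrow> bool" where
  "valid_samples t \<Delta> D \<longleftrightarrow> length D \<le> t \<and> (\<forall>p\<in>set D. norm (fst p) \<le> Bx) \<and>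
     lam ^ CARD('d) * (1 + (\<Delta> / eta T)\<^sup>2) ^ length D \<le> det (gram lam D)"

definition valid_state :: "nat \<Rightarrow> ('n, 'd) barb_state \<Rightarrow> bool" where
  "valid_state t st \<longleftrightarrow> 0 < gap st \<and> gap st \<le> Del1 \<and> real (flags st) \<le> flag_limit T (gap st) \<and>
     (\<forall>i. valid_samples t (gap st) (samples st i))"

lemma valid_stateD:
  assumes "valid_state t st"
  shows "0 < gap st" "gap st \<le> Del1" "real (flags st) \<le> flag_limit T (gap st)"
    "valid_samples t (gap st) (samples st i)"
  using assms unfolding valid_state_def by auto

lemma valid_samples_Nil: "valid_samples t \<Delta> []"
  unfolding valid_samples_def by (simp add: det_mat)

lemma valid_samples_snoc:
  assumes valid: "valid_samples t \<Delta> D" and "0 \<le> \<Delta>" and x: "norm x \<le> Bx"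
    and width: "\<Delta> / eta T < wnorm (gram_inv lam D) x"
  shows "valid_samples (Suc t) \<Delta> (D @ [(x, y)])"
proof -
  let ?c = "1 + (\<Delta> / eta T)\<^sup>2"
  have "?c \<le> 1 + (wnorm (gram_inv lam D) x)\<^sup>2"
    using width \<open>0 \<le> \<Delta>\<close> eta_pos by (intro add_left_mono power_mono) auto
  moreover have "lam ^ CARD('d) * ?c ^ length D \<le> det (gram lam D)"
    using valid unfolding valid_samples_def by blast
  moreover have "0 \<le> lam ^ CARD('d) * ?c ^ length D"
    using lam_pos by (intro mult_nonneg_nonneg) auto
  ultimately have "lam ^ CARD('d) * ?c ^ length D * ?c
      \<le> det (gram lam D) * (1 + (wnorm (gram_inv lam D) x)\<^sup>2)"
    by (intro mult_mono) auto
  then show ?thesis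
    using valid x det_gram_snoc[OF lam_pos, of D "(x, y)"] unfolding valid_samples_def
    by (auto simp: mult_ac)
qed

lemma valid_state_next:
  assumes valid: "valid_state t st" and x: "\<And>j. norm (x $ j) \<le> Bx"
  shows "valid_state (Suc t) (next_state st x e)"
proof (cases "batch_ends st x")
  case True
  have "gap st / sqrt 2 \<le> gap st" using valid_stateD(1)[OF valid] by (simp add: field_simps)
  then have "gap st / sqrt 2 \<le> Del1" using valid_stateD(2)[OF valid] by linarith
  then show ?thesis
    using True valid_stateD(1)[OF valid] flag_limit_nonneg valid_samples_Nil
    unfolding valid_state_def gap_next flags_next samples_next by simp
next
  case False
  have "valid_samples (Suc t) (gap st) (next_samples st x e i)" for i
  proof (cases "explored st x i")
    case None
    then show ?thesis
      using valid_stateD(4)[OF valid, of i] unfolding next_samples_def valid_samples_def by auto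
  next
    case (Some j)
    then have j: "mcm (uncertain st x) i = Some j"
      unfolding explored_def by (simp split: if_splits)
    have "gap st / eta T < wnorm (gram_inv lam (samples st i)) (x $ j)"
      using mcm_edges[OF j] unfolding uncertain_def by simp
    then show ?thesis
      unfolding next_samples_def Some option.case
      using valid_samples_snoc[OF valid_stateD(4)[OF valid] _ x] valid_stateD(1)[OF valid] by simp
  qed
  moreover have "real (flags st + of_bool (flagged st x)) \<le> flag_limit T (gap st)"
    using False valid_stateD(3)[OF valid] exploring_not_flagged[of st x]
    unfolding batch_ends_def by (cases "exploring st x") auto
  ultimately show ?thesis
    using False valid_stateD(1,2)[OF valid]
    unfolding valid_state_def gap_next flags_next samples_next by simp
qed

lemma samples_le:
  assumes valid: "valid_state t st" and t: "t \<le> T"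
  shows "real (length (samples st i)) \<le> log_det_growth T * (Del1\<^sup>2 + (eta T)\<^sup>2) / (gap st)\<^sup>2"
proof -
  let ?n = "real (length (samples st i))"
  define z where "z = (gap st / eta T)\<^sup>2"
  note gap = valid_stateD(1,2)[OF valid]
  have z: "0 < z" unfolding z_def using gap eta_pos by simp
  have "?n * z \<le> log_det_growth T * (1 + z)"
    unfolding log_det_growth_def
    using valid_stateD(4)[OF valid, of i] t lam_pos z
    by (intro elliptical_potential) (auto simp: valid_samples_def z_def)
  then have "?n * (z * (eta T)\<^sup>2) \<le> log_det_growth T * ((1 + z) * (eta T)\<^sup>2)"
    by (metis mult.assoc mult_right_mono zero_le_power2)
  moreover have "z * (eta T)\<^sup>2 = (gap st)\<^sup>2" unfolding z_def using eta_pos by (simp add: power_divide)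
  ultimately have "?n * (gap st)\<^sup>2 \<le> log_det_growth T * ((eta T)\<^sup>2 + (gap st)\<^sup>2)"
    by (simp add: distrib_right)
  also have "\<dots> \<le> log_det_growth T * (Del1\<^sup>2 + (eta T)\<^sup>2)"
    using gap log_det_growth_nonneg by (intro mult_left_mono) (auto intro: power_mono)
  finally show ?thesis using gap by (simp add: pos_le_divide_eq)
qed

lemma total_samples_le:
  assumes "valid_state t st" "t \<le> T"
  shows "(\<Sum>i\<in>UNIV. real (length (samples st i))) \<le> explore_rate T / (gap st)\<^sup>2"
proof -
  have "(\<Sum>i\<in>UNIV. real (length (samples st i)))
      \<le> (\<Sum>i\<in>(UNIV :: 'n set). log_det_growth T * (Del1\<^sup>2 + (eta T)\<^sup>2) / (gap st)\<^sup>2)"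
    by (intro sum_mono samples_le[OF assms])
  then show ?thesis unfolding explore_rate_def by simp
qed

subsection \<open>Counting rounds\<close>

text \<open>The inverse square of the gap doubles from batch to batch, so the contributions of the finished
  batches add up to at most that of the current one.\<close>

lemma inv_sq_gap_halved: "a / (gap st / sqrt 2)\<^sup>2 = 2 * (a / (gap st)\<^sup>2)"
  by (simp add: power_divide)

definition bounded_ctx :: "('n, 'k, 'd) environment \<Rightarrow> bool" where
  "bounded_ctx \<omega> \<longleftrightarrow> (\<forall>t<T. \<forall>j. norm (ctx \<omega> t $ j) \<le> Bx)"

lemma bounded_ctxD: "bounded_ctx \<omega> \<Longrightarrow> t < T \<Longrightarrow> norm (ctx \<omega> t $ j) \<le> Bx"
  unfolding bounded_ctx_def by blast

lemma valid_hist: "bounded_ctx \<omega> \<Longrightarrow> t \<le> T \<Longrightarrow> valid_state t (hist \<omega> t)"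
proof (induction t)
  case 0
  show ?case
    using Del1_pos flag_limit_nonneg valid_samples_Nil unfolding valid_state_def by simp
next
  case (Suc t)
  then show ?case
    unfolding hist_Suc by (intro valid_state_next bounded_ctxD) auto
qed

lemma exploring_adds_sample:
  assumes "exploring st x"
  shows "(\<Sum>i\<in>UNIV. real (length (samples st i))) + 1
    \<le> (\<Sum>i\<in>UNIV. real (length (next_samples st x e i)))"
proof -
  obtain i j where "mcm (uncertain st x) i = Some j"
    using mcm_nonempty[OF assms] .
  then have "length (samples st i) < length (next_samples st x e i)"
    using assms unfolding next_samples_def explored_def by simp
  moreover have "length (samples st a) \<le> length (next_samples st x e a)" for a
    unfolding next_samples_def by (simp split: option.split)
  ultimately have "(\<Sum>i\<in>UNIV. length (samples st i)) < (\<Sum>i\<in>UNIV. length (next_samples st x e i))"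
    by (intro sum_strict_mono_ex1) auto
  then show ?thesis unfolding of_nat_sum[symmetric] by linarith
qed

lemma exploring_rounds_le:
  assumes b: "bounded_ctx \<omega>"
  shows "t \<le> T \<Longrightarrow> real (count_rounds exploring \<omega> t)
    \<le> explore_rate T / (gap (hist \<omega> t))\<^sup>2 + (\<Sum>i\<in>UNIV. real (length (samples (hist \<omega> t) i)))"
proof (induction t)
  case 0
  show ?case using explore_rate_nonneg by simp
next
  case (Suc t)
  let ?st = "hist \<omega> t" and ?x = "ctx \<omega> t"
  have t: "t \<le> T" using Suc.prems by simp
  note IH = Suc.IH[OF t]
  consider (explore) "exploring ?st ?x" | (batch_end) "\<not> exploring ?st ?x" "batch_ends ?st ?x"
    | (exploit) "\<not> exploring ?st ?x" "\<not> batch_ends ?st ?x"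
    by blast
  then show ?case
  proof cases
    case explore
    then show ?thesis
      using IH exploring_adds_sample[OF explore, of "noise \<omega> t"] exploring_not_batch_ends[OF explore]
      unfolding hist_Suc gap_next samples_next by simp
  next
    case batch_end
    then show ?thesis
      using IH total_samples_le[OF valid_hist[OF b t] t]
      unfolding hist_Suc gap_next samples_next by (simp add: inv_sq_gap_halved)
  next
    case exploit
    then show ?thesis
      using IH unfolding hist_Suc gap_next samples_next by (simp add: next_samples_exploiting)
  qed
qed

lemma flagged_rounds_le:
  assumes b: "bounded_ctx \<omega>"
  shows "t \<le> T \<Longrightarrow> real (count_rounds flagged \<omega> t)
    \<le> flag_rate T / (gap (hist \<omega> t))\<^sup>2 + real (flags (hist \<omega> t))"
proof (induction t)
  case 0
  show ?case using flag_rate_nonneg by simp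
next
  case (Suc t)
  let ?st = "hist \<omega> t" and ?x = "ctx \<omega> t"
  have t: "t \<le> T" using Suc.prems by simp
  note IH = Suc.IH[OF t] and valid = valid_stateD[OF valid_hist[OF b t]]
  show ?case
  proof (cases "batch_ends ?st ?x")
    case False
    then show ?thesis using IH unfolding hist_Suc gap_next flags_next by simp
  next
    case True
    have "(gap ?st)\<^sup>2 \<le> Del1\<^sup>2" using valid(1,2) by (intro power_mono) auto
    then have "1 \<le> Del1\<^sup>2 / (gap ?st)\<^sup>2" using valid(1) by simp
    moreover have "real (flags ?st) \<le> (3 * ln (real T) / 16) / (gap ?st)\<^sup>2"
      using valid(3) unfolding flag_limit_def by simp
    ultimately have "real (flags ?st) + 1 \<le> flag_rate T / (gap ?st)\<^sup>2"
      unfolding flag_rate_def add_divide_distrib by linarith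
    then show ?thesis
      using True IH unfolding hist_Suc gap_next flags_next
      by (simp add: inv_sq_gap_halved)
  qed
qed

abbreviation fine_flagged :: "real \<Rightarrow> ('n, 'd) barb_state \<Rightarrow> ('d, 'k) contexts \<Rightarrow> bool" where
  "fine_flagged D st x \<equiv> flagged st x \<and> gap st \<le> D"

lemma flags_le_fine_flagged:
  "gap (hist \<omega> t) \<le> D \<Longrightarrow> flags (hist \<omega> t) \<le> count_rounds (fine_flagged D) \<omega> t"
  by (induction t) (auto simp: hist_Suc gap_next flags_next)

lemma inv_sq_gap_le:
  assumes b: "bounded_ctx \<omega>" and D: "D > 0"
  shows "t \<le> T \<Longrightarrow>
    1 / (gap (hist \<omega> t))\<^sup>2 \<le> inv_sq_gap_bound T D (real (count_rounds (fine_flagged D) \<omega> t))"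
proof (induction t)
  case 0
  show ?case by (simp add: inv_sq_gap_bound_def)
next
  case (Suc t)
  let ?st = "hist \<omega> t" and ?x = "ctx \<omega> t"
  let ?g = "real (count_rounds (fine_flagged D) \<omega> (Suc t))"
  have t: "t \<le> T" using Suc.prems by simp
  have gap: "0 < gap ?st" using valid_stateD(1)[OF valid_hist[OF b t]] .
  show ?case
  proof (cases "batch_ends ?st ?x")
    case False
    have "1 / (gap ?st)\<^sup>2 \<le> inv_sq_gap_bound T D ?g"
      using Suc.IH[OF t] by (rule order_trans) (intro inv_sq_gap_bound_mono, simp)
    then show ?thesis using False unfolding hist_Suc gap_next by simp
  next
    case True
    have "2 * (1 / (gap ?st)\<^sup>2) \<le> inv_sq_gap_bound T D ?g"
    proof (cases "gap ?st \<le> D")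
      case fine: True
      have "flag_limit T (gap ?st) \<le> ?g"
        using flags_le_fine_flagged[OF fine] True fine unfolding batch_ends_def by simp
      then have "2 * (1 / (gap ?st)\<^sup>2) \<le> 32 / (3 * ln (real T)) * ?g"
        using ln_T_pos gap unfolding flag_limit_def by (simp add: field_simps)
      then show ?thesis unfolding inv_sq_gap_bound_def by (simp add: add_increasing)
    next
      case False
      then have "1 / (gap ?st)\<^sup>2 \<le> 1 / D\<^sup>2"
        using D gap by (intro divide_left_mono power_mono) auto
      moreover have "0 \<le> 32 / (3 * ln (real T)) * ?g" "0 \<le> 1 / Del1\<^sup>2" using ln_T_pos by auto
      ultimately show ?thesis unfolding inv_sq_gap_bound_def by linarith
    qed
    then show ?thesis using True unfolding hist_Suc gap_next by (simp add: inv_sq_gap_halved)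
  qed
qed

lemma costly_rounds_le:
  assumes b: "bounded_ctx \<omega>" and D: "D > 0"
  shows "real (count_rounds exploring \<omega> T) + real (count_rounds flagged \<omega> T)
    \<le> 2 * (explore_rate T + flag_rate T)
        * inv_sq_gap_bound T D (real (count_rounds (fine_flagged D) \<omega> T))"
proof -
  let ?st = "hist \<omega> T"
  note valid = valid_hist[OF b order_refl]
  have "real (count_rounds exploring \<omega> T) \<le> 2 * explore_rate T / (gap ?st)\<^sup>2"
    using exploring_rounds_le[OF b order_refl] total_samples_le[OF valid order_refl] by simp
  moreover have "real (flags ?st) \<le> flag_rate T / (gap ?st)\<^sup>2"
    using valid_stateD(3)[OF valid] unfolding flag_limit_def flag_rate_def
    by (simp add: add_divide_distrib add_increasing2)
  then have "real (count_rounds flagged \<omega> T) \<le> 2 * flag_rate T / (gap ?st)\<^sup>2"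
    using flagged_rounds_le[OF b order_refl] by simp
  ultimately have "real (count_rounds exploring \<omega> T) + real (count_rounds flagged \<omega> T)
      \<le> 2 * (explore_rate T + flag_rate T) * (1 / (gap ?st)\<^sup>2)"
    by (simp add: add_divide_distrib distrib_left)
  also have "\<dots> \<le> 2 * (explore_rate T + flag_rate T)
      * inv_sq_gap_bound T D (real (count_rounds (fine_flagged D) \<omega> T))"
    using explore_rate_nonneg flag_rate_nonneg by (intro mult_left_mono inv_sq_gap_le[OF b D]) auto
  finally show ?thesis .
qed

lemma cumulative_regret_le:
  assumes b: "bounded_ctx \<omega>" and D: "D > 0"
  shows "(\<Sum>t<T. round_regret (hist \<omega> t) (ctx \<omega> t) i)
    \<le> 2 * (explore_rate T + flag_rate T)
        * inv_sq_gap_bound T D (real (count_rounds (fine_flagged D) \<omega> T))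
      + real (count_rounds (\<lambda>st _. \<not> accurate st) \<omega> T)"
proof -
  have "(\<Sum>t<T. round_regret (hist \<omega> t) (ctx \<omega> t) i)
      \<le> (\<Sum>t<T. of_bool (exploring (hist \<omega> t) (ctx \<omega> t)) + of_bool (flagged (hist \<omega> t) (ctx \<omega> t))
          + of_bool (\<not> accurate (hist \<omega> t)))"
    using bounded_ctxD[OF b] valid_stateD(1)[OF valid_hist[OF b]]
    by (intro sum_mono round_regret_le) auto
  also have "\<dots> = real (count_rounds exploring \<omega> T) + real (count_rounds flagged \<omega> T)
      + real (count_rounds (\<lambda>st _. \<not> accurate st) \<omega> T)"
    unfolding count_rounds_def by (simp add: sum.distrib)
  finally show ?thesis using costly_rounds_le[OF b D] by linarith
qed

lemma gap_hist: "gap (hist \<omega> t) = Del1 / sqrt 2 ^ count_rounds batch_ends \<omega> t"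
  by (induction t) (simp_all add: hist_Suc gap_next)

lemma batches_le:
  assumes b: "bounded_ctx \<omega>" and t: "t \<le> T"
  shows "real (count_rounds batch_ends \<omega> t) \<le> max_batches T"
proof -
  let ?n = "count_rounds batch_ends \<omega> t" and ?D = "fine_gap T"
  have "(sqrt 2 ^ ?n)\<^sup>2 = (2 :: real) ^ ?n"
    by (metis power_mult mult.commute real_sqrt_pow2 zero_le_numeral)
  then have "(2 :: real) ^ ?n = Del1\<^sup>2 * (1 / (gap (hist \<omega> t))\<^sup>2)"
    unfolding gap_hist using Del1_pos by (simp add: power_divide)
  also have "1 / (gap (hist \<omega> t))\<^sup>2
      \<le> inv_sq_gap_bound T ?D (real (count_rounds (fine_flagged ?D) \<omega> t))"
    by (rule inv_sq_gap_le[OF b fine_gap_pos t])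
  also have "\<dots> \<le> inv_sq_gap_bound T ?D (real T)"
    using count_rounds_le[of "fine_flagged ?D" \<omega> t] t by (intro inv_sq_gap_bound_mono) simp
  finally have "log 2 (2 ^ ?n) \<le> max_batches T"
    unfolding max_batches_def using Del1_pos by (intro log_mono) (auto intro: mult_left_mono)
  then show ?thesis by (simp add: log_nat_power)
qed

lemma max_batches_nonneg: "0 \<le> max_batches T"
proof -
  have "1 / Del1\<^sup>2 \<le> inv_sq_gap_bound T (fine_gap T) (real T)"
    unfolding inv_sq_gap_bound_def using ln_T_pos by simp
  then have "1 \<le> Del1\<^sup>2 * inv_sq_gap_bound T (fine_gap T) (real T)"
    using Del1_pos by (simp add: field_simps)
  then show ?thesis unfolding max_batches_def by simp
qed

end

section \<open>Measurability\<close>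

lemma measurable_countableI:
  fixes f :: "'a \<Rightarrow> 'b::countable"
  assumes "\<And>b. Measurable.pred M (\<lambda>w. f w = b)"
  shows "f \<in> M \<rightarrow>\<^sub>M count_space UNIV"
proof -
  have "{w \<in> space M. f w = b} \<in> sets M" for b
    using assms[of b] by (simp add: pred_def)
  moreover have "f -` {b} \<inter> space M = {w \<in> space M. f w = b}" for b by auto
  ultimately show ?thesis by (simp add: measurable_count_space_eq2_countable)
qed

lemma borel_measurable_of_bool:
  assumes [measurable]: "Measurable.pred M P"
  shows "(\<lambda>w. of_bool (P w) :: 'b::{zero_neq_one,topological_space}) \<in> borel_measurable M"
  unfolding of_bool_def by measurable

lemma borel_measurable_vec_nth [measurable (raw)]:
  fixes f :: "'a \<Rightarrow> ('b::euclidean_space, 'd::finite) vec"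
  assumes "f \<in> borel_measurable M"
  shows "(\<lambda>w. f w $ i) \<in> borel_measurable M"
  by (rule borel_measurable_continuous_onI[THEN measurable_compose[OF assms]]) (intro continuous_intros)

lemma borel_measurable_vec_lambda [measurable (raw)]:
  fixes f :: "'a \<Rightarrow> 'd::finite \<Rightarrow> 'b::euclidean_space"
  assumes "\<And>i. (\<lambda>w. f w i) \<in> borel_measurable M"
  shows "(\<lambda>w. (\<chi> i. f w i)) \<in> borel_measurable M"
proof -
  have "(\<chi> i. f w i) = (\<Sum>i\<in>UNIV. axis i (f w i))" for w
    by (simp add: vec_eq_iff axis_def)
  moreover have "(\<lambda>w. axis i (f w i)) \<in> borel_measurable M" for i
  proof (rule measurable_compose[OF assms])
    have "linear (axis i :: 'b \<Rightarrow> ('b, 'd) vec)"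
      by (rule linearI) (auto simp: vec_eq_iff axis_def)
    then show "(axis i :: 'b \<Rightarrow> ('b, 'd) vec) \<in> borel_measurable borel"
      by (intro borel_measurable_continuous_onI linear_continuous_on)
        (simp add: linear_conv_bounded_linear)
  qed
  ultimately show ?thesis by simp
qed

lemma borel_measurable_det [measurable (raw)]:
  fixes A :: "'a \<Rightarrow> real^'d^'d"
  assumes [measurable]: "A \<in> borel_measurable M"
  shows "(\<lambda>w. det (A w)) \<in> borel_measurable M"
  unfolding det_def by measurable

lemma borel_measurable_matrix_vector_mult [measurable (raw)]:
  fixes A :: "'a \<Rightarrow> real^'d^'d"
  assumes [measurable]: "A \<in> borel_measurable M" "b \<in> borel_measurable M"
  shows "(\<lambda>w. A w *v b w) \<in> borel_measurable M"
  unfolding matrix_vector_mult_def by measurable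

lemma borel_measurable_rank_one [measurable (raw)]:
  fixes x :: "'a \<Rightarrow> real^'d" and y :: "'a \<Rightarrow> real^'d"
  assumes [measurable]: "x \<in> borel_measurable M" "y \<in> borel_measurable M"
  shows "(\<lambda>w. rank_one (y w) (x w)) \<in> borel_measurable M"
  unfolding rank_one_def by measurable

lemma matrix_inv_Cramer:
  fixes A :: "real^'d^'d"
  assumes "invertible A"
  shows "matrix_inv A *v b = (\<chi> k. det (\<chi> i j. if j = k then b $ i else A $ i $ j) / det A)"
  using assms cramer[of A "matrix_inv A *v b" b] matrix_inv_cancel(1)[OF assms]
  by (simp add: invertible_det_nz)

lemma borel_measurable_matrix_inv_mult:
  fixes A :: "'a \<Rightarrow> real^'d^'d"
  assumes [measurable]: "A \<in> borel_measurable M" "b \<in> borel_measurable M"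
    and inv: "\<And>w. invertible (A w)"
  shows "(\<lambda>w. matrix_inv (A w) *v b w) \<in> borel_measurable M"
proof -
  have [measurable]: "(\<lambda>w. if j = k then b w $ i else A w $ i $ j) \<in> borel_measurable M" for i j k
    by (cases "j = k") simp_all
  show ?thesis unfolding matrix_inv_Cramer[OF inv] by measurable
qed

lemma borel_measurable_desc_vals:
  fixes f :: "'a \<Rightarrow> 'k::{finite,linorder} \<Rightarrow> real"
  assumes [measurable]: "\<And>j. (\<lambda>w. f w j) \<in> borel_measurable M" and q: "q < CARD('k)"
  shows "(\<lambda>w. desc_vals (f w) ! q) \<in> borel_measurable M"
proof (subst borel_measurable_iff_greater, intro allI)
  fix a
  have "a < desc_vals (f w) ! q \<longleftrightarrow> q < (\<Sum>j\<in>UNIV. of_bool (a < f w j))" for w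
    using desc_vals_nth_iff[of "\<lambda>z. a < z" q "f w"] q by (simp add: of_bool_def sum.If_cases)
  moreover have "{w \<in> space M. q < (\<Sum>j\<in>UNIV. of_bool (a < f w j) :: nat)} \<in> sets M"
    unfolding of_bool_def by measurable
  ultimately show "{w \<in> space M. a < desc_vals (f w) ! q} \<in> sets M" by simp
qed

lemma pred_small_gap [measurable (raw)]:
  fixes U :: "'a \<Rightarrow> 'n::{finite,linorder} \<Rightarrow> 'k::{finite,linorder} \<Rightarrow> real"
  assumes [measurable]: "\<And>i j. (\<lambda>w. U w i j) \<in> borel_measurable M" "\<Delta> \<in> borel_measurable M"
  shows "Measurable.pred M (\<lambda>w. small_gap n (U w) i (\<Delta> w))"
proof -
  have "Measurable.pred M (\<lambda>w. m + 1 < CARD('k) \<and> m < n \<and>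
      desc_vals (U w i) ! m - desc_vals (U w i) ! (m + 1) \<le> 2 * \<Delta> w)" for m
  proof (cases "m + 1 < CARD('k)")
    case True
    then have [measurable]: "(\<lambda>w. desc_vals (U w i) ! m) \<in> borel_measurable M"
      "(\<lambda>w. desc_vals (U w i) ! (m + 1)) \<in> borel_measurable M"
      by (auto intro!: borel_measurable_desc_vals)
    show ?thesis by measurable
  qed simp
  then show ?thesis unfolding small_gap_iff by (rule pred_intros_countable)
qed

text \<open>Deferred acceptance depends on the estimated utilities only through the finitely many rankings.\<close>

lemma measurable_gale_shapley:
  fixes U :: "'a \<Rightarrow> 'n::{finite,linorder} \<Rightarrow> 'k::{finite,linorder} \<Rightarrow> real"
  assumes [measurable]: "\<And>i j. (\<lambda>w. U w i j) \<in> borel_measurable M"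
  shows "(\<lambda>w. gale_shapley arank (U w)) \<in> M \<rightarrow>\<^sub>M count_space UNIV"
proof -
  define matching_of where
    "matching_of P = gale_shapley arank (SOME U' :: 'n \<Rightarrow> 'k \<Rightarrow> real. pbetter U' = P)" for P
  have "gale_shapley arank (U w) = matching_of (pbetter (U w))" for w
    unfolding matching_of_def
    by (rule gale_shapley_cong) (rule someI[of "\<lambda>U'. pbetter U' = pbetter (U w)", symmetric], rule refl)
  moreover have "(\<lambda>w. pbetter (U w)) \<in> M \<rightarrow>\<^sub>M count_space UNIV"
  proof (rule measurable_countableI)
    fix P
    have "(\<lambda>w. pbetter (U w) = P) = (\<lambda>w. \<forall>i j j'. pbetter (U w) i j j' = P i j j')"
      by (auto simp: fun_eq_iff)
    moreover have "Measurable.pred M (\<lambda>w. \<forall>i j j'. pbetter (U w) i j j' = P i j j')"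
      unfolding pbetter_def by measurable
    ultimately show "Measurable.pred M (\<lambda>w. pbetter (U w) = P)" by simp
  qed
  ultimately show ?thesis
    using measurable_compose[of "\<lambda>w. pbetter (U w)" M "count_space UNIV" matching_of "count_space UNIV"]
    by simp
qed

lemma borel_measurable_util [measurable (raw)]:
  assumes [measurable]: "x \<in> borel_measurable M"
  shows "(\<lambda>w. util \<theta> (x w) i j) \<in> borel_measurable M"
  unfolding util_def by measurable

lemma borel_measurable_match_val [measurable (raw)]:
  assumes [measurable]: "\<And>i j. (\<lambda>w. U w i j) \<in> borel_measurable M"
  shows "(\<lambda>w. match_val (U w) \<mu> i) \<in> borel_measurable M"
  unfolding match_val_def by (cases "\<mu> i") auto

lemma pred_delta_min [measurable (raw)]:
  fixes \<theta> :: "'n::{finite,linorder} \<Rightarrow> (real, 'd::finite) vec"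
    and x :: "'a \<Rightarrow> ((real, 'd) vec, 'k::{finite,linorder}) vec"
  assumes [measurable]: "x \<in> borel_measurable M"
  shows "Measurable.pred M (\<lambda>w. delta_min \<theta> (x w) \<le> a)"
proof (cases "\<exists>j j'::'k. j \<noteq> j'")
  case True
  show ?thesis unfolding delta_min_le_iff[OF True] by measurable
next
  case False
  then have "{\<bar>\<theta> i \<bullet> (x w $ j - x w $ j')\<bar> | i j j'. j \<noteq> j'} = {}" for w by blast
  then show ?thesis unfolding delta_min_def by simp
qed

lemma (in strict_market) pred_stable:
  assumes [measurable]: "\<And>i j. (\<lambda>w. U w i j) \<in> borel_measurable M"
  shows "Measurable.pred M (\<lambda>w. stable arank (U w) \<mu>)"
proof -
  have "Measurable.pred M (\<lambda>w. \<mu> i = Some j' \<longrightarrow> U w i j' < U w i j)" for i j j'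
    by (cases "\<mu> i = Some j'") auto
  then show ?thesis unfolding stable_iff blocking_pair_def by measurable
qed

lemma (in strict_market) borel_measurable_Ustar [measurable (raw)]:
  fixes \<theta> :: "'n \<Rightarrow> (real, 'd::finite) vec"
  assumes [measurable]: "x \<in> borel_measurable M"
  shows "(\<lambda>w. Ustar arank \<theta> (x w) i) \<in> borel_measurable M"
proof (subst borel_measurable_iff_greater, intro allI)
  fix a
  have [measurable]: "Measurable.pred M (\<lambda>w. stable arank (util \<theta> (x w)) \<mu>)" for \<mu>
    by (rule pred_stable) measurable
  show "{w \<in> space M. a < Ustar arank \<theta> (x w) i} \<in> sets M"
    unfolding Ustar_greater_iff by measurable
qed

text \<open>The algorithm sees the samples of a player only through their Gram matrix and weighted sum.\<close>

definition state_algebra :: "real \<Rightarrow> ('n::finite, 'd::finite) barb_state measure" where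
  "state_algebra lam = vimage_algebra UNIV
     (\<lambda>st. (gap st, flags st, \<lambda>i. (gram lam (samples st i), weighted_sum (samples st i))))
     (borel \<Otimes>\<^sub>M count_space UNIV \<Otimes>\<^sub>M PiM UNIV (\<lambda>_. borel \<Otimes>\<^sub>M borel))"

lemma measurable_state_algebraI:
  fixes S :: "'a \<Rightarrow> ('n::finite, 'd::finite) barb_state"
  assumes [measurable]: "(\<lambda>w. gap (S w)) \<in> borel_measurable M"
    "(\<lambda>w. flags (S w)) \<in> M \<rightarrow>\<^sub>M count_space UNIV"
    "\<And>i. (\<lambda>w. gram lam (samples (S w) i)) \<in> borel_measurable M"
    "\<And>i. (\<lambda>w. weighted_sum (samples (S w) i)) \<in> borel_measurable M"
  shows "S \<in> M \<rightarrow>\<^sub>M state_algebra lam"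
  unfolding state_algebra_def
  by (rule measurable_vimage_algebra2)
    (auto intro!: measurable_Pair measurable_PiM_single' simp: space_pair_measure)

lemma measurable_state_algebraD:
  fixes S :: "'a \<Rightarrow> ('n::finite, 'd::finite) barb_state"
  assumes S: "S \<in> M \<rightarrow>\<^sub>M state_algebra lam"
  shows "(\<lambda>w. gap (S w)) \<in> borel_measurable M"
    and "(\<lambda>w. flags (S w)) \<in> M \<rightarrow>\<^sub>M count_space UNIV"
    and "(\<lambda>w. gram lam (samples (S w) i)) \<in> borel_measurable M"
    and "(\<lambda>w. weighted_sum (samples (S w) i)) \<in> borel_measurable M"
proof -
  let ?N = "borel \<Otimes>\<^sub>M count_space UNIV \<Otimes>\<^sub>M PiM UNIV (\<lambda>_ :: 'n. borel \<Otimes>\<^sub>M borel)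
    :: (real \<times> nat \<times> ('n \<Rightarrow> (real^'d^'d) \<times> (real^'d))) measure"
  have features: "(\<lambda>w. (gap (S w), flags (S w),
      \<lambda>i. (gram lam (samples (S w) i), weighted_sum (samples (S w) i)))) \<in> M \<rightarrow>\<^sub>M ?N"
    by (rule measurable_compose[OF S[unfolded state_algebra_def] measurable_vimage_algebra1])
      (simp add: space_pair_measure space_PiM)
  note tail = measurable_compose[OF features measurable_snd]
  note component = measurable_compose[OF measurable_compose[OF tail measurable_snd]
      measurable_component_singleton[OF UNIV_I]]
  show "(\<lambda>w. gap (S w)) \<in> borel_measurable M"
    using measurable_compose[OF features measurable_fst] by simp
  show "(\<lambda>w. flags (S w)) \<in> M \<rightarrow>\<^sub>M count_space UNIV"
    using measurable_compose[OF tail measurable_fst] by simp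
  show "(\<lambda>w. gram lam (samples (S w) i)) \<in> borel_measurable M"
    using measurable_compose[OF component[of i] measurable_fst] by simp
  show "(\<lambda>w. weighted_sum (samples (S w) i)) \<in> borel_measurable M"
    using measurable_compose[OF component[of i] measurable_snd] by simp
qed

context barb_trajectory
begin

context
  fixes M :: "'a measure" and S :: "'a \<Rightarrow> ('n, 'd) barb_state"
  assumes S: "S \<in> M \<rightarrow>\<^sub>M state_algebra lam"
begin

lemmas [measurable] = measurable_state_algebraD[OF S]

lemma borel_measurable_gram_inv_mult:
  "b \<in> borel_measurable M \<Longrightarrow> (\<lambda>w. gram_inv lam (samples (S w) i) *v b w) \<in> borel_measurable M"
  by (intro borel_measurable_matrix_inv_mult invertible_pos_def pos_def_gram lam_pos) measurable

lemma borel_measurable_wnorm_gram_inv: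
  assumes [measurable]: "b \<in> borel_measurable M"
  shows "(\<lambda>w. wnorm (gram_inv lam (samples (S w) i)) (b w)) \<in> borel_measurable M"
proof -
  note [measurable] = borel_measurable_gram_inv_mult[OF assms]
  show ?thesis unfolding wnorm_def by measurable
qed

lemma borel_measurable_noise_sum: "(\<lambda>w. noise_sum th (samples (S w) i)) \<in> borel_measurable M"
  unfolding noise_sum_eq[of th _ lam] by measurable

lemma pred_player_accurate [measurable (raw)]: "Measurable.pred M (\<lambda>w. player_accurate i (S w))"
proof -
  note [measurable] = borel_measurable_wnorm_gram_inv[OF borel_measurable_noise_sum]
  show ?thesis unfolding player_accurate_def by measurable
qed

lemma pred_accurate [measurable (raw)]: "Measurable.pred M (\<lambda>w. accurate (S w))"
proof -
  note [measurable] = pred_player_accurate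
  show ?thesis unfolding accurate_def by measurable
qed

lemma borel_measurable_noise_exponential:
  assumes [measurable]: "u \<in> borel_measurable M"
  shows "(\<lambda>w. noise_exponential R th (u w) (samples (S w) i)) \<in> borel_measurable M"
proof -
  note [measurable] = borel_measurable_noise_sum
  show ?thesis unfolding noise_exponential_eq[of R th _ _ lam] by measurable
qed

context
  fixes x :: "'a \<Rightarrow> ('d, 'k) contexts"
  assumes x [measurable]: "x \<in> borel_measurable M"
begin

lemma measurable_uncertain: "(\<lambda>w. uncertain (S w) (x w)) \<in> M \<rightarrow>\<^sub>M count_space UNIV"
proof (rule measurable_countableI)
  fix E
  have [measurable]: "(\<lambda>w. wnorm (gram_inv lam (samples (S w) i)) (x w $ j)) \<in> borel_measurable M"
    for i j
    by (rule borel_measurable_wnorm_gram_inv) measurable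
  have "(\<lambda>w. uncertain (S w) (x w) = E) =
    (\<lambda>w. \<forall>i j. (gap (S w) / eta T < wnorm (gram_inv lam (samples (S w) i)) (x w $ j)) = ((i, j) \<in> E))"
    unfolding uncertain_def by (auto simp: fun_eq_iff)
  then show "Measurable.pred M (\<lambda>w. uncertain (S w) (x w) = E)" by simp
qed

lemma pred_exploring: "Measurable.pred M (\<lambda>w. exploring (S w) (x w))"
  using measurable_compose[OF measurable_uncertain, of "\<lambda>E. E \<noteq> {}" "count_space UNIV"] by simp

lemma borel_measurable_est_util: "(\<lambda>w. est_util (S w) (x w) i j) \<in> borel_measurable M"
proof -
  have [measurable]: "(\<lambda>w. ridge_est lam (samples (S w) i)) \<in> borel_measurable M"
    unfolding ridge_est_eq by (rule borel_measurable_gram_inv_mult) measurable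
  show ?thesis unfolding est_util_def by measurable
qed

lemma measurable_played [measurable (raw)]: "(\<lambda>w. played (S w) (x w)) \<in> M \<rightarrow>\<^sub>M count_space UNIV"
proof -
  have "(\<lambda>w. mcm (uncertain (S w) (x w))) \<in> M \<rightarrow>\<^sub>M count_space UNIV"
    by (rule measurable_compose[OF measurable_uncertain]) simp
  then show ?thesis
    unfolding played_def
    using measurable_gale_shapley[OF borel_measurable_est_util] pred_exploring by measurable
qed

lemma pred_flagged [measurable (raw)]: "Measurable.pred M (\<lambda>w. flagged (S w) (x w))"
proof -
  note [measurable] = borel_measurable_est_util pred_exploring
  show ?thesis unfolding flagged_def by measurable
qed

lemma pred_batch_ends [measurable (raw)]: "Measurable.pred M (\<lambda>w. batch_ends (S w) (x w))"
proof -
  note [measurable] = pred_flagged pred_exploring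
  show ?thesis unfolding batch_ends_def flag_limit_def of_bool_def by measurable
qed

lemma measurable_explored: "(\<lambda>w. explored (S w) (x w)) \<in> M \<rightarrow>\<^sub>M count_space UNIV"
proof -
  have "(\<lambda>w. mcm (uncertain (S w) (x w))) \<in> M \<rightarrow>\<^sub>M count_space UNIV"
    by (rule measurable_compose[OF measurable_uncertain]) simp
  then show ?thesis unfolding explored_def using pred_exploring by measurable
qed

lemma borel_measurable_next_samples:
  assumes [measurable]: "\<And>p. (\<lambda>w. e w p) \<in> borel_measurable M"
  shows "(\<lambda>w. gram lam (next_samples (S w) (x w) (e w) i)) \<in> borel_measurable M" (is ?gram)
    and "(\<lambda>w. weighted_sum (next_samples (S w) (x w) (e w) i)) \<in> borel_measurable M" (is ?sum)
proof -
  let ?gram_after = "\<lambda>(\<mu> :: ('n, 'k) matching) w. gram lam (samples (S w) i) +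
    (case \<mu> i of None \<Rightarrow> 0 | Some j \<Rightarrow> rank_one (x w $ j) (x w $ j))"
  have "?gram_after \<mu> \<in> borel_measurable M" for \<mu>
    by (cases "\<mu> i") auto
  then have "(\<lambda>w. ?gram_after (explored (S w) (x w)) w) \<in> borel_measurable M"
    by (rule measurable_compose_countable[OF _ measurable_explored])
  moreover have "gram lam (next_samples (S w) (x w) (e w) i) = ?gram_after (explored (S w) (x w)) w"
    for w
    unfolding next_samples_def by (simp split: option.split)
  ultimately show ?gram by simp
  let ?sum_after = "\<lambda>(\<mu> :: ('n, 'k) matching) w. weighted_sum (samples (S w) i) +
    (case \<mu> i of None \<Rightarrow> 0 | Some j \<Rightarrow> (util \<theta> (x w) i j + e w (i, j)) *\<^sub>R (x w $ j))"
  have "?sum_after \<mu> \<in> borel_measurable M" for \<mu>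
    by (cases "\<mu> i") auto
  then have "(\<lambda>w. ?sum_after (explored (S w) (x w)) w) \<in> borel_measurable M"
    by (rule measurable_compose_countable[OF _ measurable_explored])
  moreover have "weighted_sum (next_samples (S w) (x w) (e w) i) = ?sum_after (explored (S w) (x w)) w"
    for w
    unfolding next_samples_def by (simp split: option.split)
  ultimately show ?sum by simp
qed

lemma measurable_next_state:
  assumes [measurable]: "\<And>p. (\<lambda>w. e w p) \<in> borel_measurable M"
  shows "(\<lambda>w. next_state (S w) (x w) (e w)) \<in> M \<rightarrow>\<^sub>M state_algebra lam"
proof -
  note [measurable] = borel_measurable_next_samples[OF assms] pred_batch_ends pred_flagged
  show ?thesis
  proof (rule measurable_state_algebraI)
    show "(\<lambda>w. gap (next_state (S w) (x w) (e w))) \<in> borel_measurable M"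
      unfolding gap_next by measurable
    show "(\<lambda>w. flags (next_state (S w) (x w) (e w))) \<in> M \<rightarrow>\<^sub>M count_space UNIV"
      unfolding flags_next of_bool_def by measurable
    show "(\<lambda>w. gram lam (samples (next_state (S w) (x w) (e w)) i)) \<in> borel_measurable M" for i
      unfolding samples_next if_distrib[of "gram lam"] by measurable
    show "(\<lambda>w. weighted_sum (samples (next_state (S w) (x w) (e w)) i)) \<in> borel_measurable M" for i
      unfolding samples_next if_distrib[of weighted_sum] by measurable
  qed
qed

end

end

end

section \<open>The random environment\<close>

lemma nn_integral_PiM_resample:
  assumes fin: "finite I" and s: "s \<in> I" and P: "prob_space P"
    and f [measurable]: "f \<in> borel_measurable (PiM I (\<lambda>_. P))"
  shows "(\<integral>\<^sup>+\<omega>. f \<omega> \<partial>(PiM I (\<lambda>_. P))) = (\<integral>\<^sup>+\<omega>. (\<integral>\<^sup>+z. f (fun_upd \<omega> s z) \<partial>P) \<partial>(PiM I (\<lambda>_. P)))"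
proof -
  interpret P: prob_space P by fact
  interpret product_sigma_finite "\<lambda>_. P" by unfold_locales
  define J where "J = I - {s}"
  have I: "I = insert s J" "finite J" "s \<notin> J" using s fin unfolding J_def by auto
  let ?resampled = "\<lambda>\<omega>. \<integral>\<^sup>+z. f (fun_upd \<omega> s z) \<partial>P"
  have "(\<lambda>(\<omega>, z). fun_upd \<omega> s z) \<in> PiM I (\<lambda>_. P) \<Otimes>\<^sub>M P \<rightarrow>\<^sub>M PiM I (\<lambda>_. P)"
    using measurable_add_dim[of s I "\<lambda>_. P"] s by (simp add: insert_absorb)
  then have "?resampled \<in> borel_measurable (PiM I (\<lambda>_. P))"
    using P.borel_measurable_nn_integral_fst[OF measurable_compose[OF _ f]] by simp
  then have "(\<integral>\<^sup>+\<omega>. ?resampled \<omega> \<partial>(PiM I (\<lambda>_. P)))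
      = (\<integral>\<^sup>+\<omega>. (\<integral>\<^sup>+z'. ?resampled (fun_upd \<omega> s z') \<partial>P) \<partial>(PiM J (\<lambda>_. P)))"
    unfolding I(1) by (rule product_nn_integral_insert[OF I(2,3)])
  also have "\<dots> = (\<integral>\<^sup>+\<omega>. ?resampled \<omega> \<partial>(PiM J (\<lambda>_. P)))"
    by (simp add: P.emeasure_space_1)
  also have "\<dots> = (\<integral>\<^sup>+\<omega>. f \<omega> \<partial>(PiM I (\<lambda>_. P)))"
    using f unfolding I(1) by (rule product_nn_integral_insert[OF I(2,3), symmetric])
  finally show ?thesis ..
qed

locale barb_market = barb_algorithm arank \<theta> mcm Bth Bx R lam Del1
  for arank :: "'k::{finite,linorder} \<Rightarrow> 'n::{finite,linorder} \<Rightarrow> nat"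
    and \<theta> :: "'n \<Rightarrow> (real, 'd::finite) vec"
    and mcm :: "('n \<times> 'k) set \<Rightarrow> ('n, 'k) matching"
    and Bth Bx R lam Del1 :: real +
  fixes Dx :: "('d, 'k) contexts measure" and \<nu> :: "real measure" and c Del0 :: real
  assumes Dx_prob: "prob_space Dx" and Dx_sets [measurable_cong]: "sets Dx = sets borel"
    and ctx_bound: "AE x in Dx. \<forall>j. norm (x $ j) \<le> Bx"
    and nu_prob: "prob_space \<nu>" and nu_sets [measurable_cong]: "sets \<nu> = sets borel"
    and nu_integrable: "integrable \<nu> (\<lambda>z. z)" and nu_mean: "(\<integral>z. z \<partial>\<nu>) = 0"
    and nu_subgaussian: "integrable \<nu> (\<lambda>z. exp (s * z)) \<and>
      (\<integral>z. exp (s * z) \<partial>\<nu>) \<le> exp (s\<^sup>2 * R\<^sup>2 / 2)"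
    and Del0_pos: "Del0 > 0"
    and delta_min_cdf: "0 < \<Delta> \<Longrightarrow> \<Delta> \<le> Del0 \<Longrightarrow>
      measure Dx {x \<in> space Dx. delta_min \<theta> x \<le> \<Delta>} \<le> c * \<Delta>"
begin

definition noise_space :: "('n \<times> 'k \<Rightarrow> real) measure" where
  "noise_space = PiM UNIV (\<lambda>_. \<nu>)"

definition round_space :: "(('d, 'k) contexts \<times> ('n \<times> 'k \<Rightarrow> real)) measure" where
  "round_space = Dx \<Otimes>\<^sub>M noise_space"

sublocale Dx: prob_space Dx by (rule Dx_prob)

sublocale nu: prob_space \<nu> by (rule nu_prob)

sublocale noise_space: prob_space noise_space
  unfolding noise_space_def by (rule prob_space_PiM) (rule nu_prob)

sublocale round_space: prob_space round_space
proof -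
  interpret pair_prob_space Dx noise_space ..
  show "prob_space round_space" unfolding round_space_def by (rule prob_space_axioms)
qed

lemma round_measure_eq: "round_measure Dx \<nu> = round_space"
  unfolding round_space_def noise_space_def round_measure_def ..

lemma sets_round_space [measurable_cong]: "sets round_space = sets (borel \<Otimes>\<^sub>M noise_space)"
  unfolding round_space_def by (intro sets_pair_measure_cong Dx_sets refl)

lemma borel_measurable_noise_coordinate [measurable]: "(\<lambda>e. e p) \<in> borel_measurable noise_space"
  unfolding noise_space_def by measurable

lemma nn_integral_noise_coordinate:
  assumes "g \<in> borel_measurable borel"
  shows "(\<integral>\<^sup>+e. g (e p) \<partial>noise_space) = (\<integral>\<^sup>+z. g z \<partial>\<nu>)"
proof -
  have "distr noise_space \<nu> (\<lambda>e. e p) = \<nu>"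
    unfolding noise_space_def by (rule distr_PiM_component) (auto intro: nu_prob)
  moreover have "(\<integral>\<^sup>+z. g z \<partial>(distr noise_space \<nu> (\<lambda>e. e p))) = (\<integral>\<^sup>+e. g (e p) \<partial>noise_space)"
    using assms by (intro nn_integral_distr) measurable
  ultimately show ?thesis by simp
qed

lemma nn_integral_subgaussian_le_1: "(\<integral>\<^sup>+z. ennreal (exp (a * z - R\<^sup>2 / 2 * a\<^sup>2)) \<partial>\<nu>) \<le> 1"
proof -
  have "(\<integral>\<^sup>+z. ennreal (exp (a * z - R\<^sup>2 / 2 * a\<^sup>2)) \<partial>\<nu>)
      = (\<integral>\<^sup>+z. ennreal (exp (- (R\<^sup>2 / 2 * a\<^sup>2)) * exp (a * z)) \<partial>\<nu>)"
    by (simp add: exp_add[symmetric])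
  also have "\<dots> = ennreal (\<integral>z. exp (- (R\<^sup>2 / 2 * a\<^sup>2)) * exp (a * z) \<partial>\<nu>)"
    using nu_subgaussian[of a] by (intro nn_integral_eq_integral) auto
  also have "\<dots> \<le> ennreal (exp (- (R\<^sup>2 / 2 * a\<^sup>2)) * exp (a\<^sup>2 * R\<^sup>2 / 2))"
    using nu_subgaussian[of a] by (intro ennreal_leI) simp
  also have "\<dots> = 1" by (simp add: exp_add[symmetric])
  finally show ?thesis .
qed

lemma nn_integral_round_noise:
  assumes g [measurable]: "(\<lambda>(x, e). g x e) \<in> borel_measurable (borel \<Otimes>\<^sub>M noise_space)"
  shows "(\<integral>\<^sup>+z. g (fst z) (snd z) \<partial>round_space)
    = (\<integral>\<^sup>+z. (\<integral>\<^sup>+e. g (fst z) e \<partial>noise_space) \<partial>round_space)"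
proof -
  define h where "h x = (\<integral>\<^sup>+e. g x e \<partial>noise_space)" for x
  have [measurable]: "h \<in> borel_measurable borel"
    unfolding h_def by measurable
  have "(\<lambda>z. g (fst z) (snd z)) \<in> borel_measurable (Dx \<Otimes>\<^sub>M noise_space)"
    using g
    by (simp add: split_beta' measurable_cong_sets[OF sets_pair_measure_cong[OF Dx_sets refl] refl])
  then have "(\<integral>\<^sup>+z. g (fst z) (snd z) \<partial>round_space) = (\<integral>\<^sup>+x. h x \<partial>Dx)"
    unfolding round_space_def h_def by (subst noise_space.nn_integral_fst[symmetric]) simp_all
  also have "\<dots> = (\<integral>\<^sup>+z. h (fst z) \<partial>round_space)"
    unfolding round_space_def
    by (subst noise_space.nn_integral_fst[symmetric]) (simp_all add: noise_space.emeasure_space_1)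
  finally show ?thesis unfolding h_def .
qed

end

locale barb_run = barb_market arank \<theta> mcm Bth Bx R lam Del1 Dx \<nu> c Del0 +
    barb_trajectory arank \<theta> mcm Bth Bx R lam Del1 T
  for arank :: "'k::{finite,linorder} \<Rightarrow> 'n::{finite,linorder} \<Rightarrow> nat"
    and \<theta> :: "'n \<Rightarrow> (real, 'd::finite) vec"
    and mcm :: "('n \<times> 'k) set \<Rightarrow> ('n, 'k) matching"
    and Bth Bx R lam Del1 :: real
    and Dx :: "('d, 'k) contexts measure" and \<nu> :: "real measure" and c Del0 :: real
    and T :: nat
begin

definition run_space :: "('n, 'k, 'd) environment measure" where
  "run_space = PiM {1..T} (\<lambda>_. round_space)"

sublocale run_space: prob_space run_space
  unfolding run_space_def by (rule prob_space_PiM) (rule round_space.prob_space_axioms)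

lemma measurable_round: "t < T \<Longrightarrow> (\<lambda>\<omega>. \<omega> (Suc t)) \<in> run_space \<rightarrow>\<^sub>M round_space"
  unfolding run_space_def by (rule measurable_component_singleton) simp

lemma distr_round: "t < T \<Longrightarrow> distr run_space round_space (\<lambda>\<omega>. \<omega> (Suc t)) = round_space"
  unfolding run_space_def
  by (rule distr_PiM_component[where M="\<lambda>_. round_space"]) (auto intro: round_space.prob_space_axioms)

lemma borel_measurable_ctx: "t < T \<Longrightarrow> (\<lambda>\<omega>. ctx \<omega> t) \<in> borel_measurable run_space"
  by (rule measurable_compose[OF measurable_round]) measurable

lemma borel_measurable_noise: "t < T \<Longrightarrow> (\<lambda>\<omega>. noise \<omega> t p) \<in> borel_measurable run_space"
  by (rule measurable_compose[OF measurable_round]) measurable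

lemma measurable_hist: "t \<le> T \<Longrightarrow> (\<lambda>\<omega>. hist \<omega> t) \<in> run_space \<rightarrow>\<^sub>M state_algebra lam"
proof (induction t)
  case 0
  show ?case by (rule measurable_state_algebraI) simp_all
next
  case (Suc t)
  then show ?case
    unfolding hist_Suc by (intro measurable_next_state borel_measurable_ctx borel_measurable_noise) auto
qed

lemma AE_bounded_ctx: "AE \<omega> in run_space. bounded_ctx \<omega>"
proof -
  have "AE x in distr round_space Dx fst. \<forall>j. norm (x $ j) \<le> Bx"
    unfolding round_space_def noise_space.distr_pair_fst by (rule ctx_bound)
  then have "AE z in round_space. \<forall>j. norm (fst z $ j) \<le> Bx"
    by (rule AE_distrD[rotated]) measurable
  then have "AE \<omega> in run_space. \<forall>j. norm (ctx \<omega> t $ j) \<le> Bx" if "t < T" for t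
    unfolding run_space_def using that round_space.prob_space_axioms
    by (intro AE_PiM_component[where P="\<lambda>z. \<forall>j. norm (fst z $ j) \<le> Bx"]) auto
  then have "AE \<omega> in run_space. \<forall>t\<in>{..<T}. \<forall>j. norm (ctx \<omega> t $ j) \<le> Bx"
    by (intro AE_finite_allI) auto
  then show ?thesis unfolding bounded_ctx_def by (simp add: Ball_def)
qed

lemma nn_integral_next_round:
  assumes t: "t < T"
    and g [measurable]: "(\<lambda>(st, z). g st z) \<in> borel_measurable (state_algebra lam \<Otimes>\<^sub>M round_space)"
  shows "(\<integral>\<^sup>+\<omega>. g (hist \<omega> t) (\<omega> (Suc t)) \<partial>run_space)
    = (\<integral>\<^sup>+\<omega>. (\<integral>\<^sup>+z. g (hist \<omega> t) z \<partial>round_space) \<partial>run_space)"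
proof -
  have [measurable]: "(\<lambda>\<omega>. hist \<omega> t) \<in> run_space \<rightarrow>\<^sub>M state_algebra lam"
    using t by (intro measurable_hist) simp
  note [measurable] = measurable_round[OF t]
  have "(\<lambda>\<omega>. g (hist \<omega> t) (\<omega> (Suc t))) \<in> borel_measurable run_space" by measurable
  then have "(\<integral>\<^sup>+\<omega>. g (hist \<omega> t) (\<omega> (Suc t)) \<partial>run_space)
      = (\<integral>\<^sup>+\<omega>. (\<integral>\<^sup>+z. g (hist (fun_upd \<omega> (Suc t) z) t) z \<partial>round_space) \<partial>run_space)"
    unfolding run_space_def using t
    by (subst nn_integral_PiM_resample[of _ "Suc t"]) (auto intro: round_space.prob_space_axioms)
  moreover have "hist (fun_upd \<omega> (Suc t) z) t = hist \<omega> t" for \<omega> z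
    by (rule hist_cong) simp
  ultimately show ?thesis by simp
qed

lemma nn_integral_next_noise:
  assumes t: "t < T"
    and g: "(\<lambda>(st, x, e). g st x e)
      \<in> borel_measurable (state_algebra lam \<Otimes>\<^sub>M borel \<Otimes>\<^sub>M noise_space)"
  shows "(\<integral>\<^sup>+\<omega>. g (hist \<omega> t) (ctx \<omega> t) (noise \<omega> t) \<partial>run_space)
    = (\<integral>\<^sup>+\<omega>. (\<integral>\<^sup>+e. g (hist \<omega> t) (ctx \<omega> t) e \<partial>noise_space) \<partial>run_space)"
proof -
  have [measurable]: "(\<lambda>p. g (fst p) (fst (snd p)) (snd (snd p)))
      \<in> borel_measurable (state_algebra lam \<Otimes>\<^sub>M borel \<Otimes>\<^sub>M noise_space)"
    using g by (simp add: split_beta')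
  define h where "h st x = (\<integral>\<^sup>+e. g st x e \<partial>noise_space)" for st x
  have h: "(\<lambda>(st, z). h st (fst z)) \<in> borel_measurable (state_algebra lam \<Otimes>\<^sub>M round_space)"
  proof -
    have "(\<lambda>q. (fst (fst q), fst (snd (fst q)), snd q))
        \<in> (state_algebra lam \<Otimes>\<^sub>M round_space) \<Otimes>\<^sub>M noise_space
          \<rightarrow>\<^sub>M state_algebra lam \<Otimes>\<^sub>M borel \<Otimes>\<^sub>M noise_space"
      by measurable
    from noise_space.borel_measurable_nn_integral_fst[OF measurable_compose[OF this g]]
    show ?thesis unfolding h_def by (simp add: split_beta')
  qed
  have inner: "(\<integral>\<^sup>+z. g st (fst z) (snd z) \<partial>round_space) = (\<integral>\<^sup>+z. h st (fst z) \<partial>round_space)" for st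
  proof -
    have "st \<in> space (state_algebra lam)" unfolding state_algebra_def by simp
    then have "(\<lambda>(x, e). g st x e) \<in> borel_measurable (borel \<Otimes>\<^sub>M noise_space)"
      using measurable_compose[OF measurable_Pair1' g] by simp
    then show ?thesis unfolding h_def by (rule nn_integral_round_noise)
  qed
  have "(\<integral>\<^sup>+\<omega>. g (hist \<omega> t) (ctx \<omega> t) (noise \<omega> t) \<partial>run_space)
      = (\<integral>\<^sup>+\<omega>. (\<integral>\<^sup>+z. g (hist \<omega> t) (fst z) (snd z) \<partial>round_space) \<partial>run_space)"
    by (rule nn_integral_next_round[OF t, of "\<lambda>st z. g st (fst z) (snd z)"]) measurable
  also have "\<dots> = (\<integral>\<^sup>+\<omega>. (\<integral>\<^sup>+z. h (hist \<omega> t) (fst z) \<partial>round_space) \<partial>run_space)"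
    unfolding inner ..
  also have "\<dots> = (\<integral>\<^sup>+\<omega>. h (hist \<omega> t) (ctx \<omega> t) \<partial>run_space)"
    by (rule nn_integral_next_round[OF t, of "\<lambda>st z. h st (fst z)", symmetric]) (rule h)
  finally show ?thesis unfolding h_def .
qed

lemma measurable_hist_before_round:
  "t < T \<Longrightarrow> (\<lambda>\<omega>. hist \<omega> t) \<in> run_space \<rightarrow>\<^sub>M state_algebra lam"
  by (rule measurable_hist) simp

subsection \<open>The exponential supermartingale\<close>

abbreviation player_exponential :: "'n \<Rightarrow> (real, 'd) vec \<Rightarrow> ('n, 'd) barb_state \<Rightarrow> real" where
  "player_exponential i u st \<equiv> noise_exponential R (\<theta> i) u (samples st i)"

lemma nn_integral_player_exponential_next:
  "(\<integral>\<^sup>+e. ennreal (player_exponential i u (next_state st x e)) \<partial>noise_space)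
    \<le> ennreal (player_exponential i u st) + of_bool (batch_ends st x)"
proof (cases "batch_ends st x")
  case True
  then show ?thesis
    unfolding samples_next by (simp add: noise_space.emeasure_space_1 add_increasing)
next
  case continues: False
  show ?thesis
  proof (cases "explored st x i")
    case None
    then show ?thesis
      using continues unfolding samples_next next_samples_def
      by (simp add: noise_space.emeasure_space_1)
  next
    case (Some j)
    let ?a = "u \<bullet> (x $ j)"
    have "player_exponential i u (next_state st x e)
        = player_exponential i u st * exp (?a * e (i, j) - R\<^sup>2 / 2 * ?a\<^sup>2)" for e
      using continues Some unfolding samples_next next_samples_def by (simp add: util_def)
    then have "(\<integral>\<^sup>+e. ennreal (player_exponential i u (next_state st x e)) \<partial>noise_space)
        = (\<integral>\<^sup>+e. ennreal (player_exponential i u st)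
            * ennreal (exp (?a * e (i, j) - R\<^sup>2 / 2 * ?a\<^sup>2)) \<partial>noise_space)"
      by (simp add: ennreal_mult' less_imp_le[OF noise_exponential_pos])
    also have "\<dots> = ennreal (player_exponential i u st)
        * (\<integral>\<^sup>+e. ennreal (exp (?a * e (i, j) - R\<^sup>2 / 2 * ?a\<^sup>2)) \<partial>noise_space)"
      by (rule nn_integral_cmult) measurable
    also have "(\<integral>\<^sup>+e. ennreal (exp (?a * e (i, j) - R\<^sup>2 / 2 * ?a\<^sup>2)) \<partial>noise_space)
        = (\<integral>\<^sup>+z. ennreal (exp (?a * z - R\<^sup>2 / 2 * ?a\<^sup>2)) \<partial>\<nu>)"
      by (rule nn_integral_noise_coordinate) measurable
    also have "ennreal (player_exponential i u st) * \<dots> \<le> ennreal (player_exponential i u st) * 1"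
      by (intro mult_left_mono nn_integral_subgaussian_le_1) simp
    finally show ?thesis by (simp add: add_increasing2)
  qed
qed

lemma borel_measurable_player_exponential_next:
  "(\<lambda>(st, x, e). ennreal (player_exponential i u (next_state st x e)))
    \<in> borel_measurable (state_algebra lam \<Otimes>\<^sub>M borel \<Otimes>\<^sub>M noise_space)"
  unfolding split_beta'
  by (intro measurable_compose[OF _ measurable_ennreal] borel_measurable_noise_exponential
      measurable_next_state measurable_compose[OF _ borel_measurable_noise_coordinate]) measurable

text \<open>A batch end resets the supermartingale to \<open>1\<close>, at the cost of one unit of expectation.\<close>

lemma nn_integral_player_exponential_le:
  "t \<le> T \<Longrightarrow> (\<integral>\<^sup>+\<omega>. ennreal (player_exponential i u (hist \<omega> t)) \<partial>run_space)
    \<le> 1 + (\<Sum>s<t. \<integral>\<^sup>+\<omega>. of_bool (batch_ends (hist \<omega> s) (ctx \<omega> s)) \<partial>run_space)"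
proof (induction t)
  case 0
  show ?case by (simp add: run_space.emeasure_space_1)
next
  case (Suc t)
  then have t: "t < T" by simp
  note [measurable] = measurable_hist_before_round[OF t] borel_measurable_ctx[OF t]
  let ?ends = "\<lambda>\<omega>. of_bool (batch_ends (hist \<omega> t) (ctx \<omega> t)) :: ennreal"
  have "(\<integral>\<^sup>+\<omega>. ennreal (player_exponential i u (hist \<omega> (Suc t))) \<partial>run_space)
      = (\<integral>\<^sup>+\<omega>. (\<integral>\<^sup>+e. ennreal (player_exponential i u (next_state (hist \<omega> t) (ctx \<omega> t) e))
          \<partial>noise_space) \<partial>run_space)"
    unfolding hist_Suc by (rule nn_integral_next_noise[OF t borel_measurable_player_exponential_next])
  also have "\<dots> \<le> (\<integral>\<^sup>+\<omega>. ennreal (player_exponential i u (hist \<omega> t)) + ?ends \<omega> \<partial>run_space)"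
    by (intro nn_integral_mono nn_integral_player_exponential_next)
  also have "\<dots> = (\<integral>\<^sup>+\<omega>. ennreal (player_exponential i u (hist \<omega> t)) \<partial>run_space)
      + (\<integral>\<^sup>+\<omega>. ?ends \<omega> \<partial>run_space)"
    by (intro nn_integral_add measurable_compose[OF _ measurable_ennreal]
        borel_measurable_noise_exponential borel_measurable_of_bool) measurable
  also have "\<dots> \<le> 1 + (\<Sum>s<t. \<integral>\<^sup>+\<omega>. of_bool (batch_ends (hist \<omega> s) (ctx \<omega> s)) \<partial>run_space)
      + (\<integral>\<^sup>+\<omega>. ?ends \<omega> \<partial>run_space)"
    using Suc by (intro add_right_mono) simp
  finally show ?case by (simp add: add.assoc)
qed

lemma nn_integral_count_rounds:
  assumes "\<And>s. s < t \<Longrightarrow> Measurable.pred run_space (\<lambda>\<omega>. P (hist \<omega> s) (ctx \<omega> s))"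
  shows "(\<Sum>s<t. \<integral>\<^sup>+\<omega>. of_bool (P (hist \<omega> s) (ctx \<omega> s)) \<partial>run_space)
    = (\<integral>\<^sup>+\<omega>. of_nat (count_rounds P \<omega> t) \<partial>run_space)"
proof -
  have "(\<integral>\<^sup>+\<omega>. of_nat (count_rounds P \<omega> t) \<partial>run_space)
      = (\<integral>\<^sup>+\<omega>. (\<Sum>s<t. of_bool (P (hist \<omega> s) (ctx \<omega> s))) \<partial>run_space)"
    unfolding count_rounds_def by simp
  also have "\<dots> = (\<Sum>s<t. \<integral>\<^sup>+\<omega>. of_bool (P (hist \<omega> s) (ctx \<omega> s)) \<partial>run_space)"
    using assms by (intro nn_integral_sum borel_measurable_of_bool) simp
  finally show ?thesis ..
qed

lemma nn_integral_player_exponential_le_batches: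
  assumes t: "t \<le> T"
  shows "(\<integral>\<^sup>+\<omega>. ennreal (player_exponential i u (hist \<omega> t)) \<partial>run_space) \<le> ennreal (1 + max_batches T)"
proof -
  have "Measurable.pred run_space (\<lambda>\<omega>. batch_ends (hist \<omega> s) (ctx \<omega> s))" if "s < t" for s
    using that t by (intro pred_batch_ends measurable_hist borel_measurable_ctx) auto
  then have count: "(\<Sum>s<t. \<integral>\<^sup>+\<omega>. of_bool (batch_ends (hist \<omega> s) (ctx \<omega> s)) \<partial>run_space)
      = (\<integral>\<^sup>+\<omega>. of_nat (count_rounds batch_ends \<omega> t) \<partial>run_space)"
    by (rule nn_integral_count_rounds)
  have "(\<integral>\<^sup>+\<omega>. ennreal (player_exponential i u (hist \<omega> t)) \<partial>run_space)
      \<le> 1 + (\<integral>\<^sup>+\<omega>. of_nat (count_rounds batch_ends \<omega> t) \<partial>run_space)"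
    using nn_integral_player_exponential_le[OF t] unfolding count .
  also have "(\<integral>\<^sup>+\<omega>. of_nat (count_rounds batch_ends \<omega> t) \<partial>run_space)
      \<le> (\<integral>\<^sup>+\<omega>. ennreal (max_batches T) \<partial>run_space)"
  proof (rule nn_integral_mono_AE, use AE_bounded_ctx in eventually_elim)
    fix \<omega> assume "bounded_ctx \<omega>"
    then show "of_nat (count_rounds batch_ends \<omega> t) \<le> ennreal (max_batches T)"
      using batches_le[OF _ t] by (simp add: ennreal_of_nat_eq_real_of_nat ennreal_leI)
  qed
  also have "1 + (\<integral>\<^sup>+\<omega>. ennreal (max_batches T) \<partial>run_space) = ennreal (1 + max_batches T)"
    using max_batches_nonneg by (simp add: run_space.emeasure_space_1 ennreal_plus)
  finally show ?thesis by (simp add: add_left_mono)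
qed

subsection \<open>Inaccurate estimates are rare\<close>

abbreviation mixture_weight :: "(real, 'd) vec \<Rightarrow> real" where
  "mixture_weight \<equiv> gauss_weight (R\<^sup>2 * lam / 2)"

definition noise_mixture :: "'n \<Rightarrow> ('n, 'd) barb_state \<Rightarrow> ennreal" where
  "noise_mixture i st = (\<integral>\<^sup>+u. ennreal (player_exponential i u st * mixture_weight u) \<partial>lborel)"

definition mixture_mass :: ennreal where
  "mixture_mass = (\<integral>\<^sup>+u. ennreal (mixture_weight u) \<partial>lborel)"

lemma mixture_mass_nonzero: "mixture_mass \<noteq> 0"
  and mixture_mass_finite: "mixture_mass \<noteq> \<top>"
proof -
  have weight_pos: "0 < R\<^sup>2 * lam / 2" using R_pos lam_pos by simp
  then have "0 < sqrt (pi / (R\<^sup>2 * lam / 2)) ^ DIM((real, 'd) vec)"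
    by (intro zero_less_power) simp
  then show "mixture_mass \<noteq> 0" "mixture_mass \<noteq> \<top>"
    unfolding mixture_mass_def nn_integral_gauss_weight[OF weight_pos] ennreal_eq_0_iff
    by (simp_all only: not_le ennreal_neq_top not_False_eq_True)
qed

lemma borel_measurable_mixture:
  assumes "t \<le> T"
  shows "(\<lambda>(\<omega>, u). ennreal (player_exponential i u (hist \<omega> t) * mixture_weight u))
    \<in> borel_measurable (run_space \<Otimes>\<^sub>M lborel)"
proof -
  note [measurable] = measurable_hist[OF assms]
  have "(\<lambda>p. player_exponential i (snd p) (hist (fst p) t)) \<in> borel_measurable (run_space \<Otimes>\<^sub>M lborel)"
    by (rule borel_measurable_noise_exponential) measurable
  then show ?thesis unfolding split_beta' by measurable
qed

lemma nn_integral_noise_mixture_le: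
  assumes t: "t \<le> T"
  shows "(\<integral>\<^sup>+\<omega>. noise_mixture i (hist \<omega> t) \<partial>run_space) \<le> ennreal (1 + max_batches T) * mixture_mass"
proof -
  interpret pair_sigma_finite run_space "lborel :: (real, 'd) vec measure" ..
  let ?f = "\<lambda>\<omega> u. player_exponential i u (hist \<omega> t)"
  have "(\<integral>\<^sup>+\<omega>. noise_mixture i (hist \<omega> t) \<partial>run_space)
      = (\<integral>\<^sup>+u. (\<integral>\<^sup>+\<omega>. ennreal (?f \<omega> u * mixture_weight u) \<partial>run_space) \<partial>lborel)"
    unfolding noise_mixture_def by (rule Fubini'[OF borel_measurable_mixture[OF t], symmetric])
  also have "\<dots> \<le> (\<integral>\<^sup>+u. ennreal (1 + max_batches T) * ennreal (mixture_weight u) \<partial>lborel)"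
  proof (rule nn_integral_mono)
    fix u :: "(real, 'd) vec"
    have "(\<integral>\<^sup>+\<omega>. ennreal (?f \<omega> u * mixture_weight u) \<partial>run_space)
        = (\<integral>\<^sup>+\<omega>. ennreal (?f \<omega> u) * ennreal (mixture_weight u) \<partial>run_space)"
      by (simp add: ennreal_mult'' gauss_weight_def)
    also have "\<dots> = (\<integral>\<^sup>+\<omega>. ennreal (?f \<omega> u) \<partial>run_space) * ennreal (mixture_weight u)"
      by (intro nn_integral_multc measurable_compose[OF _ measurable_ennreal]
          borel_measurable_noise_exponential measurable_hist t) simp
    also have "\<dots> \<le> ennreal (1 + max_batches T) * ennreal (mixture_weight u)"
      by (intro mult_right_mono nn_integral_player_exponential_le_batches t) simp
    finally show "(\<integral>\<^sup>+\<omega>. ennreal (?f \<omega> u * mixture_weight u) \<partial>run_space)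
      \<le> ennreal (1 + max_batches T) * ennreal (mixture_weight u)" .
  qed
  also have "\<dots> = ennreal (1 + max_batches T) * mixture_mass"
    unfolding mixture_mass_def by (rule nn_integral_cmult) measurable
  finally show ?thesis .
qed

lemma noise_mixture_ge_if_inaccurate:
  assumes valid: "valid_state t st" and t: "t \<le> T" and bad: "\<not> player_accurate i st"
  shows "ennreal (real T ^ CARD('d)) * mixture_mass \<le> noise_mixture i st"
  unfolding mixture_mass_def noise_mixture_def
proof (rule self_normalised_mixture[OF lam_pos R_pos])
  show "T > 0" using T_ge_2 by simp
  show "norm (fst p) \<le> Bx" if "p \<in> set (samples st i)" for p
    using valid_stateD(4)[OF valid] that unfolding valid_samples_def by blast
  show "length (samples st i) \<le> T"
    using valid_stateD(4)[OF valid] t unfolding valid_samples_def by (meson order_trans)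
  show "R\<^sup>2 * (real CARD('d) * ln ((1 + real T * Bx\<^sup>2 / lam) * (real T)\<^sup>2))
      \<le> (wnorm (gram_inv lam (samples st i)) (noise_sum (\<theta> i) (samples st i)))\<^sup>2"
    using bad unfolding player_accurate_def conf_level_def by simp
qed

lemma prob_player_inaccurate_le:
  assumes t: "t \<le> T"
  shows "real T * measure run_space {\<omega> \<in> space run_space. \<not> player_accurate i (hist \<omega> t)}
    \<le> 1 + max_batches T"
proof -
  define B where "B = {\<omega> \<in> space run_space. \<not> player_accurate i (hist \<omega> t)}"
  let ?c = "ennreal (real T ^ CARD('d)) * mixture_mass"
  note [measurable] = measurable_hist[OF t]
  have [measurable]: "B \<in> sets run_space" unfolding B_def by measurable
  have "?c * emeasure run_space B = (\<integral>\<^sup>+\<omega>. ?c * indicator B \<omega> \<partial>run_space)"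
    by (subst nn_integral_cmult) auto
  also have "\<dots> \<le> (\<integral>\<^sup>+\<omega>. noise_mixture i (hist \<omega> t) \<partial>run_space)"
  proof (rule nn_integral_mono_AE, use AE_bounded_ctx in eventually_elim)
    fix \<omega> assume "bounded_ctx \<omega>"
    then show "?c * indicator B \<omega> \<le> noise_mixture i (hist \<omega> t)"
      using noise_mixture_ge_if_inaccurate[OF valid_hist[OF _ t] t]
      unfolding B_def by (cases "player_accurate i (hist \<omega> t)") (auto simp: indicator_def)
  qed
  also have "\<dots> \<le> ennreal (1 + max_batches T) * mixture_mass"
    by (rule nn_integral_noise_mixture_le[OF t])
  finally have "mixture_mass * (ennreal (real T ^ CARD('d)) * emeasure run_space B)
      \<le> mixture_mass * ennreal (1 + max_batches T)"
    by (simp add: mult_ac)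
  then have "ennreal (real T ^ CARD('d)) * emeasure run_space B \<le> ennreal (1 + max_batches T)"
    using mixture_mass_nonzero mixture_mass_finite by (simp add: ennreal_mult_le_mult_iff)
  then have "ennreal (real T ^ CARD('d) * measure run_space B) \<le> ennreal (1 + max_batches T)"
    by (simp add: run_space.emeasure_eq_measure ennreal_mult)
  then have bound: "real T ^ CARD('d) * measure run_space B \<le> 1 + max_batches T"
    using max_batches_nonneg by (subst (asm) ennreal_le_iff) auto
  have "real T ^ 1 \<le> real T ^ CARD('d)"
    using T_ge_2 by (intro power_increasing) (auto simp: Suc_leI)
  then have "real T * measure run_space B \<le> real T ^ CARD('d) * measure run_space B"
    by (intro mult_right_mono) auto
  then show ?thesis using bound unfolding B_def by linarith
qed

lemma prob_inaccurate_le: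
  assumes t: "t \<le> T"
  shows "measure run_space {\<omega> \<in> space run_space. \<not> accurate (hist \<omega> t)} \<le> failure_prob T"
proof -
  let ?bad = "\<lambda>i. {\<omega> \<in> space run_space. \<not> player_accurate i (hist \<omega> t)}"
  note [measurable] = measurable_hist[OF t]
  have "{\<omega> \<in> space run_space. \<not> accurate (hist \<omega> t)} = (\<Union>i. ?bad i)"
    unfolding accurate_def by auto
  then have "measure run_space {\<omega> \<in> space run_space. \<not> accurate (hist \<omega> t)}
      \<le> (\<Sum>i\<in>UNIV. measure run_space (?bad i))"
    using run_space.finite_measure_subadditive_finite[of UNIV ?bad] by (simp add: image_subset_iff)
  also have "\<dots> \<le> (\<Sum>i\<in>(UNIV :: 'n set). (1 + max_batches T) / real T)"
    using prob_player_inaccurate_le[OF t] T_ge_2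
    by (intro sum_mono) (simp add: pos_le_divide_eq mult.commute)
  also have "\<dots> = failure_prob T" unfolding failure_prob_def by simp
  finally show ?thesis .
qed

subsection \<open>Fine flagged rounds are rare\<close>

lemma distr_ctx:
  assumes t: "t < T"
  shows "distr run_space Dx (\<lambda>\<omega>. ctx \<omega> t) = Dx"
proof -
  note [measurable] = measurable_round[OF t]
  have "distr run_space Dx (\<lambda>\<omega>. ctx \<omega> t)
      = distr (distr run_space round_space (\<lambda>\<omega>. \<omega> (Suc t))) Dx fst"
    by (subst distr_distr) (simp_all add: comp_def, measurable)
  also have "\<dots> = Dx"
    unfolding distr_round[OF t] unfolding round_space_def by (rule noise_space.distr_pair_fst)
  finally show ?thesis .
qed

lemma prob_small_delta_min:
  assumes t: "t < T" and a: "0 < a" "a \<le> Del0"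
  shows "measure run_space {\<omega> \<in> space run_space. delta_min \<theta> (ctx \<omega> t) \<le> a} \<le> c * a"
proof -
  let ?A = "{x \<in> space Dx. delta_min \<theta> x \<le> a}"
  have ctx: "(\<lambda>\<omega>. ctx \<omega> t) \<in> run_space \<rightarrow>\<^sub>M Dx"
    by (subst measurable_cong_sets[OF refl Dx_sets]) (rule borel_measurable_ctx[OF t])
  have "measure Dx ?A = measure run_space ((\<lambda>\<omega>. ctx \<omega> t) -` ?A \<inter> space run_space)"
    by (subst distr_ctx[OF t, symmetric], rule measure_distr[OF ctx]) measurable
  also have "(\<lambda>\<omega>. ctx \<omega> t) -` ?A \<inter> space run_space
      = {\<omega> \<in> space run_space. delta_min \<theta> (ctx \<omega> t) \<le> a}"
    using measurable_space[OF ctx] by auto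
  finally show ?thesis using delta_min_cdf[OF a] by simp
qed

lemma prob_fine_flagged_le:
  assumes t: "t < T" and D: "0 < D" "4 * D \<le> Del0"
  shows "measure run_space {\<omega> \<in> space run_space. fine_flagged D (hist \<omega> t) (ctx \<omega> t)}
    \<le> failure_prob T + c * (4 * D)"
proof -
  note [measurable] = measurable_hist_before_round[OF t] borel_measurable_ctx[OF t]
  let ?bad = "{\<omega> \<in> space run_space. \<not> accurate (hist \<omega> t)}"
  let ?close = "{\<omega> \<in> space run_space. delta_min \<theta> (ctx \<omega> t) \<le> 4 * D}"
  have "measure run_space {\<omega> \<in> space run_space. fine_flagged D (hist \<omega> t) (ctx \<omega> t)}
      \<le> measure run_space (?bad \<union> ?close)"
  proof (rule run_space.finite_measure_mono_AE, use AE_bounded_ctx in eventually_elim, rule impI)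
    fix \<omega> assume "bounded_ctx \<omega>" and "\<omega> \<in> {\<omega> \<in> space run_space. fine_flagged D (hist \<omega> t) (ctx \<omega> t)}"
    then show "\<omega> \<in> ?bad \<union> ?close"
      using flagged_delta_min[of "hist \<omega> t" "ctx \<omega> t"] valid_stateD(1)[OF valid_hist, of \<omega> t] t by force
  qed measurable
  also have "\<dots> \<le> measure run_space ?bad + measure run_space ?close"
    by (rule measure_Un_le) measurable
  also have "\<dots> \<le> failure_prob T + c * (4 * D)"
    using prob_inaccurate_le[of t] prob_small_delta_min[OF t, of "4 * D"] D t by (intro add_mono) auto
  finally show ?thesis .
qed

subsection \<open>The noise has mean zero\<close>

abbreviation matched :: "nat \<Rightarrow> 'n \<Rightarrow> 'k \<Rightarrow> ('n, 'k, 'd) environment \<Rightarrow> bool" where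
  "matched t i j \<omega> \<equiv> played (hist \<omega> t) (ctx \<omega> t) i = Some j"

lemma pred_played_eq:
  assumes "S \<in> M \<rightarrow>\<^sub>M state_algebra lam" "x \<in> borel_measurable M"
  shows "Measurable.pred M (\<lambda>w. played (S w) (x w) i = Some j)"
  using measurable_compose[OF measurable_played[OF assms], of "\<lambda>\<mu>. \<mu> i = Some j" "count_space UNIV"]
  by simp

lemma nn_integral_matched_noise:
  assumes t: "t < T" and g [measurable]: "g \<in> borel_measurable borel"
  shows "(\<integral>\<^sup>+\<omega>. of_bool (matched t i j \<omega>) * g (noise \<omega> t (i, j)) \<partial>run_space)
    = (\<integral>\<^sup>+\<omega>. of_bool (matched t i j \<omega>) \<partial>run_space) * (\<integral>\<^sup>+z. g z \<partial>\<nu>)"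
proof -
  note [measurable] = measurable_hist_before_round[OF t] borel_measurable_ctx[OF t]
  let ?A = "state_algebra lam \<Otimes>\<^sub>M borel \<Otimes>\<^sub>M noise_space"
  have [measurable]:
    "(\<lambda>p. of_bool (played (fst p) (fst (snd p)) i = Some j) :: ennreal) \<in> borel_measurable ?A"
    by (intro borel_measurable_of_bool pred_played_eq) measurable
  have [measurable]: "(\<lambda>p. g (snd (snd p) (i, j))) \<in> borel_measurable ?A"
    by (rule measurable_compose[OF measurable_compose[OF _ borel_measurable_noise_coordinate] g])
      measurable
  have "(\<lambda>(st, x, e). of_bool (played st x i = Some j) * g (e (i, j))) \<in> borel_measurable ?A"
    unfolding split_beta' by measurable
  then have "(\<integral>\<^sup>+\<omega>. of_bool (matched t i j \<omega>) * g (noise \<omega> t (i, j)) \<partial>run_space)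
      = (\<integral>\<^sup>+\<omega>. (\<integral>\<^sup>+e. of_bool (matched t i j \<omega>) * g (e (i, j)) \<partial>noise_space) \<partial>run_space)"
    by (rule nn_integral_next_noise[OF t])
  also have "\<dots> = (\<integral>\<^sup>+\<omega>. of_bool (matched t i j \<omega>) * (\<integral>\<^sup>+z. g z \<partial>\<nu>) \<partial>run_space)"
    by (intro nn_integral_cong) (simp add: nn_integral_cmult nn_integral_noise_coordinate[OF g])
  also have "\<dots> = (\<integral>\<^sup>+\<omega>. of_bool (matched t i j \<omega>) \<partial>run_space) * (\<integral>\<^sup>+z. g z \<partial>\<nu>)"
    by (intro nn_integral_multc borel_measurable_of_bool pred_played_eq) measurable
  finally show ?thesis .
qed

lemma
  assumes t: "t < T"
  defines "reward_noise \<equiv> \<lambda>i j \<omega>. of_bool (matched t i j \<omega>) * noise \<omega> t (i, j)"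
  shows integrable_matched_noise: "integrable run_space (reward_noise i j)"
    and integral_matched_noise: "(\<integral>\<omega>. reward_noise i j \<omega> \<partial>run_space) = 0"
proof -
  note [measurable] = measurable_hist_before_round[OF t] borel_measurable_ctx[OF t]
    borel_measurable_noise[OF t]
  have meas: "reward_noise i j \<in> borel_measurable run_space"
    unfolding reward_noise_def
    by (intro borel_measurable_times borel_measurable_of_bool pred_played_eq) measurable
  define match_prob where "match_prob = (\<integral>\<^sup>+\<omega>. of_bool (matched t i j \<omega>) \<partial>run_space)"
  have "match_prob \<le> (\<integral>\<^sup>+\<omega>. 1 \<partial>run_space)" unfolding match_prob_def by (intro nn_integral_mono) simp
  then have le_1: "match_prob \<le> 1" by (simp add: run_space.emeasure_space_1)
  have noise_integral: "(\<integral>\<^sup>+\<omega>. ennreal (h (reward_noise i j \<omega>)) \<partial>run_space)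
      = match_prob * (\<integral>\<^sup>+z. ennreal (h z) \<partial>\<nu>)"
    if [measurable]: "h \<in> borel_measurable borel" and "h 0 = 0" for h :: "real \<Rightarrow> real"
  proof -
    have "ennreal (h (reward_noise i j \<omega>))
        = of_bool (matched t i j \<omega>) * ennreal (h (noise \<omega> t (i, j)))" for \<omega>
      unfolding reward_noise_def using \<open>h 0 = 0\<close> by simp
    then show ?thesis
      unfolding match_prob_def using nn_integral_matched_noise[OF t, of "\<lambda>z. ennreal (h z)" i j] by simp
  qed
  have "(\<integral>\<^sup>+\<omega>. ennreal \<bar>reward_noise i j \<omega>\<bar> \<partial>run_space) = match_prob * (\<integral>\<^sup>+z. ennreal \<bar>z\<bar> \<partial>\<nu>)"
    by (rule noise_integral) auto
  also have "\<dots> \<le> 1 * (\<integral>\<^sup>+z. ennreal \<bar>z\<bar> \<partial>\<nu>)" using le_1 by (intro mult_right_mono) auto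
  also have "\<dots> < \<infinity>" using nu_integrable by (simp add: integrable_iff_bounded)
  finally show int: "integrable run_space (reward_noise i j)"
    using meas by (intro integrableI_bounded) auto
  have "enn2real (\<integral>\<^sup>+z. ennreal z \<partial>\<nu>) = enn2real (\<integral>\<^sup>+z. ennreal (- z) \<partial>\<nu>)"
    using real_lebesgue_integral_def[OF nu_integrable] nu_mean by simp
  moreover have "(\<integral>\<^sup>+\<omega>. ennreal (reward_noise i j \<omega>) \<partial>run_space) = match_prob * (\<integral>\<^sup>+z. ennreal z \<partial>\<nu>)"
    using noise_integral[of "\<lambda>z. z"] by simp
  moreover have "(\<integral>\<^sup>+\<omega>. ennreal (- reward_noise i j \<omega>) \<partial>run_space)
      = match_prob * (\<integral>\<^sup>+z. ennreal (- z) \<partial>\<nu>)"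
    using noise_integral[of "\<lambda>z. - z"] by simp
  ultimately show "(\<integral>\<omega>. reward_noise i j \<omega> \<partial>run_space) = 0"
    using real_lebesgue_integral_def[OF int] by (simp add: enn2real_mult)
qed

subsection \<open>The expected regret\<close>

lemma barb_obs_eq:
  "barb_obs T R lam Bth Bx Del1 arank mcm \<theta> \<omega> (Suc t) i =
    match_val (util \<theta> (ctx \<omega> t)) (played (hist \<omega> t) (ctx \<omega> t)) i
    + (\<Sum>j\<in>UNIV. of_bool (matched t i j \<omega>) * noise \<omega> t (i, j))"
proof -
  have "barb_obs T R lam Bth Bx Del1 arank mcm \<theta> \<omega> (Suc t) i =
    (case played (hist \<omega> t) (ctx \<omega> t) i of None \<Rightarrow> 0
      | Some j \<Rightarrow> util \<theta> (ctx \<omega> t) i j + noise \<omega> t (i, j))"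
    unfolding barb_obs_def using barb_round_eq[of "ctx \<omega> t" "noise \<omega> t" "hist \<omega> t"] by simp
  then show ?thesis unfolding match_val_def by (simp split: option.split)
qed

lemma integrable_Ustar:
  assumes t: "t < T"
  shows "integrable run_space (\<lambda>\<omega>. Ustar arank \<theta> (ctx \<omega> t) i)"
proof (rule run_space.integrable_const_bound[where B="1 / 2"])
  show "(\<lambda>\<omega>. Ustar arank \<theta> (ctx \<omega> t) i) \<in> borel_measurable run_space"
    by (rule borel_measurable_Ustar[OF borel_measurable_ctx[OF t]])
  show "AE \<omega> in run_space. norm (Ustar arank \<theta> (ctx \<omega> t) i) \<le> 1 / 2"
    using AE_bounded_ctx by eventually_elim (use abs_Ustar_le[OF bounded_ctxD[OF _ t]] in simp)
qed

lemma integrable_match_val_played: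
  assumes t: "t < T"
  shows "integrable run_space (\<lambda>\<omega>. match_val (util \<theta> (ctx \<omega> t)) (played (hist \<omega> t) (ctx \<omega> t)) i)"
proof (rule run_space.integrable_const_bound[where B="1 / 2"])
  note [measurable] = measurable_hist_before_round[OF t] borel_measurable_ctx[OF t]
  show "(\<lambda>\<omega>. match_val (util \<theta> (ctx \<omega> t)) (played (hist \<omega> t) (ctx \<omega> t)) i) \<in> borel_measurable run_space"
    by (rule measurable_compose_countable[of "\<lambda>\<mu> \<omega>. match_val (util \<theta> (ctx \<omega> t)) \<mu> i"]) measurable
  show "AE \<omega> in run_space. norm (match_val (util \<theta> (ctx \<omega> t)) (played (hist \<omega> t) (ctx \<omega> t)) i) \<le> 1 / 2"
    using AE_bounded_ctx by eventually_elim (use abs_match_val_le[OF bounded_ctxD[OF _ t]] in simp)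
qed

lemma barb_regret_eq:
  "barb_regret T R lam Bth Bx Del1 arank mcm \<theta> Dx \<nu> i =
    (\<integral>\<omega>. (\<Sum>t<T. round_regret (hist \<omega> t) (ctx \<omega> t) i) \<partial>run_space)"
proof -
  define best where "best t \<omega> = Ustar arank \<theta> (ctx \<omega> t) i"
    for t and \<omega> :: "('n, 'k, 'd) environment"
  define earned where
    "earned t \<omega> = match_val (util \<theta> (ctx \<omega> t)) (played (hist \<omega> t) (ctx \<omega> t)) i" for t \<omega>
  define surplus where "surplus t \<omega> = (\<Sum>j\<in>UNIV. of_bool (matched t i j \<omega>) * noise \<omega> t (i, j))" for t \<omega>
  have best: "integrable run_space (best t)" if "t < T" for t
    unfolding best_def[abs_def] using that by (rule integrable_Ustar)
  have earned: "integrable run_space (earned t)" if "t < T" for t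
    unfolding earned_def[abs_def] using that by (rule integrable_match_val_played)
  have surplus: "integrable run_space (surplus t)" if "t < T" for t
    unfolding surplus_def[abs_def]
    by (intro Bochner_Integration.integrable_sum integrable_matched_noise that)
  have mean_zero: "(\<integral>\<omega>. surplus t \<omega> \<partial>run_space) = 0" if "t < T" for t
    unfolding surplus_def Bochner_Integration.integral_sum[OF integrable_matched_noise[OF that]]
      integral_matched_noise[OF that] by simp
  have "barb_regret T R lam Bth Bx Del1 arank mcm \<theta> Dx \<nu> i =
      (\<integral>\<omega>. (\<Sum>t<T. best t \<omega>) \<partial>run_space) - (\<integral>\<omega>. (\<Sum>t<T. earned t \<omega> + surplus t \<omega>) \<partial>run_space)"
    unfolding barb_regret_def Let_def round_measure_eq run_space_def[symmetric]
    unfolding One_nat_def sum.atLeast1_atMost_eq barb_obs_eq best_def earned_def surplus_def ..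
  also have "(\<integral>\<omega>. (\<Sum>t<T. best t \<omega>) \<partial>run_space) = (\<Sum>t<T. \<integral>\<omega>. best t \<omega> \<partial>run_space)"
    using best by (intro Bochner_Integration.integral_sum) auto
  also have "(\<integral>\<omega>. (\<Sum>t<T. earned t \<omega> + surplus t \<omega>) \<partial>run_space) = (\<Sum>t<T. \<integral>\<omega>. earned t \<omega> \<partial>run_space)"
    using earned surplus mean_zero by (simp add: Bochner_Integration.integral_sum)
  also have "(\<Sum>t<T. \<integral>\<omega>. best t \<omega> \<partial>run_space) - (\<Sum>t<T. \<integral>\<omega>. earned t \<omega> \<partial>run_space)
      = (\<integral>\<omega>. (\<Sum>t<T. best t \<omega> - earned t \<omega>) \<partial>run_space)"
    using best earned by (simp add: Bochner_Integration.integral_sum flip: sum_subtractf)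
  finally show ?thesis unfolding best_def earned_def .
qed

lemma
  assumes "\<And>t. t < T \<Longrightarrow> Measurable.pred run_space (\<lambda>\<omega>. P (hist \<omega> t) (ctx \<omega> t))"
  shows integrable_count_rounds: "integrable run_space (\<lambda>\<omega>. real (count_rounds P \<omega> T))"
    and integral_count_rounds: "(\<integral>\<omega>. real (count_rounds P \<omega> T) \<partial>run_space)
      = (\<Sum>t<T. measure run_space {\<omega> \<in> space run_space. P (hist \<omega> t) (ctx \<omega> t)})"
proof -
  let ?event = "\<lambda>t. {\<omega> \<in> space run_space. P (hist \<omega> t) (ctx \<omega> t)}"
  have event: "integrable run_space (indicator (?event t) :: _ \<Rightarrow> real)" if "t < T" for t
    using assms[OF that]
    by (intro integrable_real_indicator) (simp_all add: pred_def less_top[symmetric])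
  have count: "real (count_rounds P \<omega> T) = (\<Sum>t<T. indicator (?event t) \<omega>)"
    if "\<omega> \<in> space run_space" for \<omega>
    using that unfolding count_rounds_def by (simp add: indicator_def)
  have "integrable run_space (\<lambda>\<omega>. (\<Sum>t<T. indicator (?event t) \<omega>) :: real)"
    using event by (intro Bochner_Integration.integrable_sum) simp
  then show "integrable run_space (\<lambda>\<omega>. real (count_rounds P \<omega> T))"
    using count by (simp cong: Bochner_Integration.integrable_cong)
  have "(\<integral>\<omega>. real (count_rounds P \<omega> T) \<partial>run_space) = (\<integral>\<omega>. (\<Sum>t<T. indicator (?event t) \<omega>) \<partial>run_space)"
    using count by (intro Bochner_Integration.integral_cong) auto
  also have "\<dots> = (\<Sum>t<T. \<integral>\<omega>. indicator (?event t) \<omega> \<partial>run_space)"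
    using event by (intro Bochner_Integration.integral_sum) simp
  also have "\<dots> = (\<Sum>t<T. measure run_space (?event t))"
    by (intro sum.cong) (simp_all add: Int_absorb2 subset_iff)
  finally show "(\<integral>\<omega>. real (count_rounds P \<omega> T) \<partial>run_space) = (\<Sum>t<T. measure run_space (?event t))" .
qed

lemma expectation_count_rounds_le:
  assumes "\<And>t. t < T \<Longrightarrow> Measurable.pred run_space (\<lambda>\<omega>. P (hist \<omega> t) (ctx \<omega> t))"
    and "\<And>t. t < T \<Longrightarrow> measure run_space {\<omega> \<in> space run_space. P (hist \<omega> t) (ctx \<omega> t)} \<le> p"
  shows "(\<integral>\<omega>. real (count_rounds P \<omega> T) \<partial>run_space) \<le> real T * p"
  using sum_bounded_above[of "{..<T}" _ p] assms(2) by (simp add: integral_count_rounds[OF assms(1)])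

lemma pred_not_accurate_hist:
  "t < T \<Longrightarrow> Measurable.pred run_space (\<lambda>\<omega>. \<not> accurate (hist \<omega> t))"
  using pred_accurate[OF measurable_hist_before_round] by simp

lemma pred_fine_flagged_hist:
  assumes t: "t < T"
  shows "Measurable.pred run_space (\<lambda>\<omega>. fine_flagged D (hist \<omega> t) (ctx \<omega> t))"
proof -
  note [measurable] = measurable_hist_before_round[OF t] borel_measurable_ctx[OF t]
    measurable_state_algebraD(1)[OF measurable_hist_before_round[OF t]]
  show ?thesis by measurable
qed

theorem barb_regret_le:
  assumes D: "4 * fine_gap T \<le> Del0"
  shows "barb_regret T R lam Bth Bx Del1 arank mcm \<theta> Dx \<nu> i \<le> 2 * (explore_rate T + flag_rate T)
      * inv_sq_gap_bound T (fine_gap T) (real T * (failure_prob T + c * (4 * fine_gap T)))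
    + real T * failure_prob T"
proof -
  let ?D = "fine_gap T" and ?Q = "2 * (explore_rate T + flag_rate T)"
  let ?fine = "\<lambda>\<omega>. real (count_rounds (fine_flagged ?D) \<omega> T)"
  let ?bad = "\<lambda>\<omega>. real (count_rounds (\<lambda>st _. \<not> accurate st) \<omega> T)"
  note fine = integrable_count_rounds[of "fine_flagged ?D", OF pred_fine_flagged_hist]
    and bad = integrable_count_rounds[of "\<lambda>st _. \<not> accurate st", OF pred_not_accurate_hist]
  have "barb_regret T R lam Bth Bx Del1 arank mcm \<theta> Dx \<nu> i
      \<le> (\<integral>\<omega>. ?Q * inv_sq_gap_bound T ?D (?fine \<omega>) + ?bad \<omega> \<partial>run_space)"
    unfolding barb_regret_eq
  proof (rule integral_mono_AE)
    show "integrable run_space (\<lambda>\<omega>. \<Sum>t<T. round_regret (hist \<omega> t) (ctx \<omega> t) i)"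
      by (intro Bochner_Integration.integrable_sum Bochner_Integration.integrable_diff
          integrable_Ustar integrable_match_val_played) auto
    show "integrable run_space (\<lambda>\<omega>. ?Q * inv_sq_gap_bound T ?D (?fine \<omega>) + ?bad \<omega>)"
      unfolding inv_sq_gap_bound_def
      by (intro Bochner_Integration.integrable_add integrable_mult_right fine bad) auto
    show "AE \<omega> in run_space. (\<Sum>t<T. round_regret (hist \<omega> t) (ctx \<omega> t) i)
        \<le> ?Q * inv_sq_gap_bound T ?D (?fine \<omega>) + ?bad \<omega>"
      using AE_bounded_ctx by eventually_elim (rule cumulative_regret_le[OF _ fine_gap_pos])
  qed
  also have "\<dots> = ?Q * inv_sq_gap_bound T ?D (\<integral>\<omega>. ?fine \<omega> \<partial>run_space) + (\<integral>\<omega>. ?bad \<omega> \<partial>run_space)"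
    unfolding inv_sq_gap_bound_def using fine bad by (simp add: run_space.prob_space)
  also have "\<dots> \<le> ?Q * inv_sq_gap_bound T ?D (real T * (failure_prob T + c * (4 * ?D)))
      + real T * failure_prob T"
  proof (intro add_mono mult_left_mono inv_sq_gap_bound_mono)
    show "(\<integral>\<omega>. ?fine \<omega> \<partial>run_space) \<le> real T * (failure_prob T + c * (4 * ?D))"
      by (intro expectation_count_rounds_le pred_fine_flagged_hist prob_fine_flagged_le fine_gap_pos D)
    show "(\<integral>\<omega>. ?bad \<omega> \<partial>run_space) \<le> real T * failure_prob T"
      using expectation_count_rounds_le[of "\<lambda>st _. \<not> accurate st", OF pred_not_accurate_hist]
        prob_inaccurate_le by simp
    show "0 \<le> ?Q" using explore_rate_nonneg flag_rate_nonneg by simp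
  qed
  finally show ?thesis .
qed

end

section \<open>Growth of the regret bound\<close>

context barb_market
begin

definition regret_bound :: "nat \<Rightarrow> real" where
  "regret_bound T = 2 * (explore_rate T + flag_rate T)
      * inv_sq_gap_bound T (fine_gap T) (real T * (failure_prob T + c * (4 * fine_gap T)))
    + real T * failure_prob T"

lemma const_bigo_ln: "(\<lambda>_. a :: real) \<in> O(\<lambda>T. ln (real T))"
  by real_asymp

lemma ln_linear_bigo: "(\<lambda>T. ln (1 + real T * Bx\<^sup>2 / lam)) \<in> O(\<lambda>T. ln (real T))"
proof (cases "Bx = 0")
  case False
  then have "Bx\<^sup>2 / lam > 0" using lam_pos by simp
  then have "(\<lambda>T. ln (1 + real T * (Bx\<^sup>2 / lam))) \<in> O(\<lambda>T. ln (real T))" by real_asymp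
  then show ?thesis by simp
qed simp

lemma conf_level_eq:
  assumes "T \<ge> 1"
  shows "conf_level T = real CARD('d) * (ln (1 + real T * Bx\<^sup>2 / lam) + 2 * ln (real T))"
proof -
  have "0 < 1 + real T * Bx\<^sup>2 / lam" using lam_pos by (intro add_pos_nonneg) auto
  then show ?thesis unfolding conf_level_def using assms by (simp add: ln_mult_pos ln_realpow)
qed

lemma conf_level_bigo: "conf_level \<in> O(\<lambda>T. ln (real T))"
proof -
  let ?f = "\<lambda>T. real CARD('d) * (ln (1 + real T * Bx\<^sup>2 / lam) + 2 * ln (real T))"
  have "eventually (\<lambda>T. conf_level T = ?f T) at_top"
    using conf_level_eq by (rule eventually_at_top_linorderI)
  moreover have "?f \<in> O(\<lambda>T. ln (real T))"
    using ln_linear_bigo by (auto intro!: sum_in_bigo)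
  ultimately show ?thesis by (simp cong: landau_o.big.in_cong)
qed

lemma eta_sq_bigo: "(\<lambda>T. (eta T)\<^sup>2) \<in> O(\<lambda>T. ln (real T))"
proof (rule landau_o.big_trans)
  have "(eta T)\<^sup>2 \<le> 2 * (R\<^sup>2 * conf_level T + lam * Bth\<^sup>2)" if "T \<ge> 1" for T
  proof -
    have "0 \<le> ln (1 + real T * Bx\<^sup>2 / lam)" using lam_pos by (intro ln_ge_zero) simp
    then have "0 \<le> conf_level T" using that unfolding conf_level_eq[OF that] by simp
    moreover have "(eta T)\<^sup>2 \<le> 2 * ((R * sqrt (conf_level T))\<^sup>2 + (sqrt lam * Bth)\<^sup>2)"
      using sum_squares_bound[of "R * sqrt (conf_level T)" "sqrt lam * Bth"]
      unfolding eta_eq by (simp add: power2_sum)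
    ultimately show ?thesis using lam_pos by (simp add: power_mult_distrib)
  qed
  then show "(\<lambda>T. (eta T)\<^sup>2) \<in> O(\<lambda>T. 2 * (R\<^sup>2 * conf_level T + lam * Bth\<^sup>2))"
    by (intro bigoI[of _ 1] eventually_at_top_linorderI[of 1]) fastforce
  show "(\<lambda>T. 2 * (R\<^sup>2 * conf_level T + lam * Bth\<^sup>2)) \<in> O(\<lambda>T. ln (real T))"
    using conf_level_bigo const_bigo_ln by (auto intro!: sum_in_bigo)
qed

lemma log_det_growth_bigo: "log_det_growth \<in> O(\<lambda>T. ln (real T))"
  unfolding log_det_growth_def[abs_def]
  using ln_linear_bigo const_bigo_ln by (auto intro!: sum_in_bigo)

lemma explore_rate_bigo: "explore_rate \<in> O(\<lambda>T. ln (real T) ^ 2)"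
proof -
  have "(\<lambda>T. Del1\<^sup>2 + (eta T)\<^sup>2) \<in> O(\<lambda>T. ln (real T))"
    by (intro sum_in_bigo const_bigo_ln eta_sq_bigo)
  then have "(\<lambda>T. log_det_growth T * (Del1\<^sup>2 + (eta T)\<^sup>2)) \<in> O(\<lambda>T. ln (real T) * ln (real T))"
    by (rule landau_o.big.mult[OF log_det_growth_bigo])
  then show ?thesis
    unfolding explore_rate_def[abs_def] by (simp add: power2_eq_square mult.assoc)
qed

lemma flag_rate_bigo: "flag_rate \<in> O(\<lambda>T. ln (real T) ^ 2)"
  unfolding flag_rate_def[abs_def] by real_asymp

lemma max_batches_bigo: "max_batches \<in> O(\<lambda>T. ln (real T))"
  unfolding max_batches_def[abs_def] inv_sq_gap_bound_def fine_gap_def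
  using Del1_pos by real_asymp

lemma expected_failures_bigo: "(\<lambda>T. real T * failure_prob T) \<in> O(\<lambda>T. ln (real T))"
proof -
  have "eventually (\<lambda>T. real T * failure_prob T = real CARD('n) * (1 + max_batches T)) at_top"
    using eventually_gt_at_top[of 0] by eventually_elim (simp add: failure_prob_def)
  moreover have "(\<lambda>T. real CARD('n) * (1 + max_batches T)) \<in> O(\<lambda>T. ln (real T))"
    using max_batches_bigo const_bigo_ln[of 1] by (auto intro!: sum_in_bigo)
  ultimately show ?thesis by (simp cong: landau_o.big.in_cong)
qed

lemma inv_sq_gap_bound_bigo:
  "(\<lambda>T. inv_sq_gap_bound T (fine_gap T) (real T * (failure_prob T + c * (4 * fine_gap T))))
    \<in> O(\<lambda>T. real T powr (2 / 3))"
proof -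
  have "(\<lambda>T. 32 / (3 * ln (real T)) * (real T * failure_prob T))
      \<in> O(\<lambda>T. 32 / (3 * ln (real T)) * ln (real T))"
    by (intro landau_o.big.mult expected_failures_bigo) simp
  also have "(\<lambda>T. 32 / (3 * ln (real T)) * ln (real T)) \<in> O(\<lambda>T. real T powr (2 / 3))"
    by real_asymp
  finally have failures:
    "(\<lambda>T. 32 / (3 * ln (real T)) * (real T * failure_prob T)) \<in> O(\<lambda>T. real T powr (2 / 3))" .
  have coarse: "(\<lambda>T. 1 / Del1\<^sup>2 + 2 / (fine_gap T)\<^sup>2) \<in> O(\<lambda>T. real T powr (2 / 3))"
    unfolding fine_gap_def by real_asymp
  have "(\<lambda>T. 32 / (3 * ln (real T)) * (real T * (4 * fine_gap T))) \<in> O(\<lambda>T. real T powr (2 / 3))"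
    unfolding fine_gap_def by real_asymp
  from landau_o.big.mult[OF _ this, of "\<lambda>_. c" "\<lambda>_. 1"]
  have "(\<lambda>T. c * (32 / (3 * ln (real T)) * (real T * (4 * fine_gap T)))) \<in> O(\<lambda>T. real T powr (2 / 3))"
    by simp
  from sum_in_bigo(1)[OF coarse sum_in_bigo(1)[OF failures this]] show ?thesis
    unfolding inv_sq_gap_bound_def by (simp add: distrib_left mult_ac)
qed

lemma regret_bound_bigo: "regret_bound \<in> O(\<lambda>T. real T powr (2 / 3) * ln (real T) ^ 2)"
proof -
  have "(\<lambda>T. 2 * (explore_rate T + flag_rate T)) \<in> O(\<lambda>T. ln (real T) ^ 2)"
    using explore_rate_bigo flag_rate_bigo by (auto intro!: sum_in_bigo)
  from landau_o.big.mult[OF this inv_sq_gap_bound_bigo]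
  have "(\<lambda>T. 2 * (explore_rate T + flag_rate T)
      * inv_sq_gap_bound T (fine_gap T) (real T * (failure_prob T + c * (4 * fine_gap T))))
      \<in> O(\<lambda>T. real T powr (2 / 3) * ln (real T) ^ 2)"
    by (simp add: mult.commute)
  moreover have "(\<lambda>T. ln (real T)) \<in> O(\<lambda>T. real T powr (2 / 3) * ln (real T) ^ 2)"
    by real_asymp
  then have "(\<lambda>T. real T * failure_prob T) \<in> O(\<lambda>T. real T powr (2 / 3) * ln (real T) ^ 2)"
    by (rule landau_o.big_trans[OF expected_failures_bigo])
  ultimately show ?thesis
    unfolding regret_bound_def[abs_def] by (intro sum_in_bigo)
qed

theorem eventually_barb_regret_le:
  "eventually (\<lambda>T. \<forall>i. barb_regret T R lam Bth Bx Del1 arank mcm \<theta> Dx \<nu> i \<le> regret_bound T) at_top"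
proof -
  have "(fine_gap \<longlongrightarrow> 0) at_top"
    unfolding fine_gap_def[abs_def] by real_asymp
  then have "eventually (\<lambda>T. fine_gap T < Del0 / 4) at_top"
    using Del0_pos by (intro order_tendstoD(2)) auto
  then show ?thesis
    using eventually_ge_at_top[of 2]
  proof eventually_elim
    case (elim T)
    then interpret barb_run arank \<theta> mcm Bth Bx R lam Del1 Dx \<nu> c Del0 T
      by unfold_locales
    show ?case
      unfolding regret_bound_def using elim(1) by (intro allI barb_regret_le) simp
  qed
qed

end

theorem theorem3p2:
  fixes \<theta> :: "('n::{finite,linorder}) \<Rightarrow> (real, 'd::finite) vec"
    and arank :: "('k::{finite,linorder}) \<Rightarrow> 'n \<Rightarrow> nat"
    and mcm :: "('n \<times> 'k) set \<Rightarrow> ('n, 'k) matching"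
    and Dx :: "(((real, 'd) vec, 'k) vec) measure"
    and \<nu> :: "real measure"
    and Bth Bx R lam Del1 c Del0 :: real
  assumes NK: "CARD('n) \<le> CARD('k)"
    and rank_strict: "\<And>j. inj (arank j)"
    and theta_bound: "\<And>i. norm (\<theta> i) \<le> Bth"
    and Dx_prob: "prob_space Dx" and Dx_sets: "sets Dx = sets borel"
    and ctx_bound: "AE x in Dx. \<forall>j. norm (x $ j) \<le> Bx"
    and By: "2 * Bth * Bx \<le> 1"
    and nu_prob: "prob_space \<nu>" and nu_sets: "sets \<nu> = sets borel"
    and nu_int: "integrable \<nu> (\<lambda>z. z)" and nu_mean: "(\<integral>z. z \<partial>\<nu>) = 0"
    and R_pos: "R > 0"
    and nu_subg: "\<And>s. integrable \<nu> (\<lambda>z. exp (s * z)) \<and>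
                       (\<integral>z. exp (s * z) \<partial>\<nu>) \<le> exp (s\<^sup>2 * R\<^sup>2 / 2)"
    and lam_pos: "lam > 0" and Del1_pos: "Del1 > 0"
    and mcm_spec: "\<And>E. max_card_matching E (mcm E)"
    and Del0_pos: "Del0 > 0" and c_pos: "c > 0"
    and cdf: "\<And>Del. 0 < Del \<Longrightarrow> Del \<le> Del0 \<Longrightarrow>
                 measure Dx {x \<in> space Dx. delta_min \<theta> x \<le> Del} \<le> c * Del"
  shows "\<exists>C (p::nat) T0. \<forall>T \<ge> T0. \<forall>i.
           barb_regret T R lam Bth Bx Del1 arank mcm \<theta> Dx \<nu> i
             \<le> C * real T powr (2/3) * (ln (real T)) ^ p"
proof -
  interpret barb_market arank \<theta> mcm Bth Bx R lam Del1 Dx \<nu> c Del0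
    by (intro barb_market.intro barb_algorithm.intro strict_market.intro strict_priorities.intro
        strict_market_axioms.intro barb_algorithm_axioms.intro barb_market_axioms.intro) (fact assms)+
  obtain C where "eventually (\<lambda>T. norm (regret_bound T)
      \<le> C * norm (real T powr (2 / 3) * ln (real T) ^ 2)) at_top"
    using regret_bound_bigo by (rule landau_o.bigE)
  with eventually_barb_regret_le
  have "eventually (\<lambda>T. \<forall>i. barb_regret T R lam Bth Bx Del1 arank mcm \<theta> Dx \<nu> i
      \<le> C * real T powr (2 / 3) * ln (real T) ^ 2) at_top"
  proof eventually_elim
    case (elim T)
    have "regret_bound T \<le> C * real T powr (2 / 3) * ln (real T) ^ 2"
      using elim(2) abs_ge_self[of "regret_bound T"] by (simp add: abs_mult mult.assoc)
    then show ?case using elim(1) order_trans by blast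
  qed
  then show ?thesis unfolding eventually_at_top_linorder by blast
qed

end
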